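(* Let $n\ge 2$. For all $1\le i\le n-1$ we have $\mathcal{TO}_{n,1}\le\mathcal{TO}_{n,i}$, $\mathcal{TO}_{n,i}\le\mathcal{TO}_{n,n-1}$, and $\mathcal{TO}_{n,i}=\mathcal{TO}_{n,d}$ where $d=\gcd(n-1,i)$.
   Context: Notation. Maps act on the right. $X_n=\{0,\ldots,n-1\}$; $X_n^*$ (resp. $X_n^k$) is the set of finite words (words of length $k$) over $X_n$; $\epsilon$ is the empty word; for $1\le r\le n-1$, $\dot{\mathbf r}=\{\dot 0,\ldots,\dot{(r-1)}\}$ is a further ordered alphabet; $X_{n,r}^+=\{\dot a w:\dot a\in\dot{\mathbf r},\,w\in X_n^*\}$, $X_{n,r}^*=X_{n,r}^+\cup\{\epsilon\}$. $\mathfrak C_n=X_n^\omega$ and $\mathfrak C_{n,r}=\{\dot a x:\dot a\in\dot{\mathbf r},\,x\in\mathfrak C_n\}$ are Cantor spaces. The relation $\simeq$ on $\mathfrak C_{n,r}$: $x\simeq y$ iff $x=y$, or $\{x,y\}=\{w\,i\,000\ldots,\;w\,(i-1)(n-1)(n-1)\ldots\}$ with $w\in X_{n,r}^+$ and $0<i\le n-1$, or $\{x,y\}=\{\dot a\,00\ldots,\;\dot{(a-1)}(n-1)(n-1)\ldots\}$ with $0<a\le r-1$, or $\{x,y\}=\{\dot 0\,00\ldots,\;\dot{(r-1)}(n-1)(n-1)\ldots\}$. Transducers over $X_n$. A transducer $\langle X_n,Q,\pi,\lambda\rangle$ has transition function $\pi:X_n\times Q\to Q$ and output function $\lambda:X_n\times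 Q\to X_n^*$, extended to words by $\pi(wi,q)=\pi(i,\pi(w,q))$, $\lambda(wi,q)=\lambda(w,q)\lambda(i,\pi(w,q))$, such that infinite inputs give infinite outputs; $h_q:\mathfrak C_n\to\mathfrak C_n$ is the continuous map $\delta\mapsto\lambda(\delta,q)$. Fixing an initial state $q_0$ gives an initial transducer, representing $h_{q_0}$; it is minimal if all states are reachable from $q_0$, $h_q\neq h_p$ for distinct states $q,p$, and for every state $q$ and letter $i$, $\lambda(i,q)$ is the greatest common prefix of $\{(i\delta)h_q:\delta\in\mathfrak C_n\}$. A transducer is synchronizing at level $k$ if for each $\Gamma\in X_n^k$ the state $\pi(\Gamma,q)$ does not depend on $q$ (the state forced by $\Gamma$); its core is the sub-transducer on the states forced by words of $X_n^k$. Transducers over $\mathfrak C_{n,r}$. An initial transducer $A_{q_0}$ over $\mathfrak C_{n,r}$ has state set $Q=R\sqcup S$ with $R$ finite, $q_0\in R$, and functions $\pi,\lambda$ defined on $(\dot{\mathbf r}\times\{q_0\})\sqcup(X_n\times(Q\setminus\{q_0\}))$, $\pi$ with values in $Q\setminus\{q_0\}$ and $\lambda$ with values in $X_{n,r}^*\sqcup X_n^*$, such that: a transition from a state of $R$ outputs $\epsilon$ if it ends in $R$ and a word of $X_{n,r}^+$ if it ends in $S$; transitions from $S$ end in $S$ with output in $X_n^*$; infinite words read from states of $S$ give infinite output; no state of $R$ lies on a cycle. It represents the map $h_{q_0}:\mathfrak C_{n,r}\to\mathfrak C_{n,r}$. It is minimal if all its states are reachable from $q_0$, distinct states $q,p$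 induce distinct maps $\delta\mapsto\lambda(\delta,q)$, $\delta\mapsto\lambda(\delta,p)$ on infinite words, and for every state $q$ and every letter $i$ readable from $q$, $\lambda(i,q)$ is the greatest common prefix of $\{\lambda(i\delta,q):\delta\in\mathfrak C_n\}$; every homeomorphism of $\mathfrak C_{n,r}$ is represented by a unique minimal transducer. It is synchronizing if for some $k$ the state reached by reading a word of length $k$ from any state from which it can be read depends only on the word; its core is then the transducer over $X_n$ formed by the states forced by words of $X_n^k$. Groups. $\mathcal B_{n,r}$ is the group of homeomorphisms $h$ of $\mathfrak C_{n,r}$ such that the minimal transducers of $h$ and $h^{-1}$ are finite and synchronizing; $\mathcal{TB}_{n,r}$ is the subgroup of those $h\in\mathcal B_{n,r}$ preserving $\simeq$. For $h\in\mathcal B_{n,r}$ let $\mathrm{Core}(h)$ be the core of its minimal transducer (a transducer over $X_n$, up to renaming states). $\mathcal O_{n,r}=\{\mathrm{Core}(h):h\in\mathcal B_{n,r}\}$, $\mathcal{TO}_{n,r}=\{\mathrm{Core}(h):h\in\mathcal{TB}_{n,r}\}$, $\mathcal O_n=\bigcup_{1\le r\le n-1}\mathcal O_{n,r}$. The product of $g,h\in\mathcal O_n$ is the core of the minimal transducer representing $h_{q_1}$ followed by $h_{q_2}$, for any states $q_1$ of $g$ and $q_2$ of $h$ (independent of the choice). With this product $\mathcal O_n$ is a group, each $\mathcal O_{n,r}$ and $\mathcal{TO}_{n,r}$ is a subgroup, $\mathcal O_{n,r}\cong\mathrm{Out}(G_{n,r})$ and $\mathcal{TO}_{n,r}\cong\mathrm{Out}(T_{n,r})$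 for the Higman–Thompson groups $G_{n,r}$ and $T_{n,r}$. The relations in the claim are between subgroups of $\mathcal O_n$. *)

theory Defs
  imports "HOL-Analysis.Analysis" "HOL-Library.Omega_Words_Fun" "HOL-Library.Sublist"
begin

section \<open>Words and Cantor spaces\<close>

text \<open>
  Both alphabets live in one type: \<open>Plain i\<close> is the letter \<open>i\<close> of \<open>X\<^sub>n\<close>, and
  \<open>Dotted a\<close> is the dotted letter \<open>a\<close>.  Finite words are lists.  Infinite words are
  functions on \<^typ>\<open>nat\<close>, as in \<^theory>\<open>HOL-Library.Omega_Words_Fun\<close>, where
  \<open>w \<frown> x\<close> is concatenation and \<open>Omega_Words_Fun.prefix k x\<close> is the word formed by the
  first \<open>k\<close> letters of \<open>x\<close>.
\<close>

datatype letter = Dotted nat | Plain nat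

definition Xn :: "nat \<Rightarrow> letter set"
  where "Xn n = Plain ` {..<n}"

definition dotted :: "nat \<Rightarrow> letter set"
  where "dotted r = Dotted ` {..<r}"

definition Xnr_plus :: "nat \<Rightarrow> nat \<Rightarrow> letter list set"
  where "Xnr_plus n r = {a # w | a w. a \<in> dotted r \<and> w \<in> lists (Xn n)}"

definition Xnr_star :: "nat \<Rightarrow> nat \<Rightarrow> letter list set"
  where "Xnr_star n r = Xnr_plus n r \<union> {[]}"

definition Cn :: "nat \<Rightarrow> (nat \<Rightarrow> letter) set"
  where "Cn n = {x. \<forall>k. x k \<in> Xn n}"

definition Cnr :: "nat \<Rightarrow> nat \<Rightarrow> (nat \<Rightarrow> letter) set"
  where "Cnr n r = {[a] \<frown> x | a x. a \<in> dotted r \<and> x \<in> Cn n}"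

definition Cnr_top :: "nat \<Rightarrow> nat \<Rightarrow> (nat \<Rightarrow> letter) topology"
  where "Cnr_top n r =
    subtopology (product_topology (\<lambda>_. discrete_topology UNIV) UNIV) (Cnr n r)"

definition inf_prefix :: "letter list \<Rightarrow> (nat \<Rightarrow> letter) \<Rightarrow> bool"
  where "inf_prefix w x \<longleftrightarrow> (\<exists>z. x = w \<frown> z)"

definition is_gcp :: "letter list \<Rightarrow> (nat \<Rightarrow> letter) set \<Rightarrow> bool"
  where "is_gcp w Y \<longleftrightarrow> (\<forall>y\<in>Y. inf_prefix w y) \<and>
    (\<forall>v. (\<forall>y\<in>Y. inf_prefix v y) \<longrightarrow> Sublist.prefix v w)"


section \<open>The relation gluing \<open>\<CC>\<^sub>n\<^sub>,\<^sub>r\<close> to a circle\<close>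

definition glued :: "nat \<Rightarrow> nat \<Rightarrow> (nat \<Rightarrow> letter) \<Rightarrow> (nat \<Rightarrow> letter) \<Rightarrow> bool"
  where "glued n r x y \<longleftrightarrow>
    (\<exists>w i. w \<in> Xnr_plus n r \<and> 0 < i \<and> i \<le> n - 1 \<and>
       x = w \<frown> [Plain i] \<frown> (\<lambda>_. Plain 0) \<and>
       y = w \<frown> [Plain (i - 1)] \<frown> (\<lambda>_. Plain (n - 1))) \<or>
    (\<exists>a. 0 < a \<and> a \<le> r - 1 \<and>
       x = [Dotted a] \<frown> (\<lambda>_. Plain 0) \<and>
       y = [Dotted (a - 1)] \<frown> (\<lambda>_. Plain (n - 1))) \<or>
    (x = [Dotted 0] \<frown> (\<lambda>_. Plain 0) \<and>
     y = [Dotted (r - 1)] \<frown> (\<lambda>_. Plain (n - 1)))"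

definition simeq :: "nat \<Rightarrow> nat \<Rightarrow> (nat \<Rightarrow> letter) \<Rightarrow> (nat \<Rightarrow> letter) \<Rightarrow> bool"
  where "simeq n r x y \<longleftrightarrow> x = y \<or> glued n r x y \<or> glued n r y x"


section \<open>Transducers over \<open>X\<^sub>n\<close>\<close>

text \<open>
  Only the values of \<open>step\<close> and \<open>out\<close> on states and on letters readable from them matter;
  the values elsewhere are arbitrary.
\<close>

record 's transducer =
  states :: "'s set"
  step :: "letter \<Rightarrow> 's \<Rightarrow> 's"
  out :: "letter \<Rightarrow> 's \<Rightarrow> letter list"

primrec run :: "('s, 'm) transducer_scheme \<Rightarrow> letter list \<Rightarrow> 's \<Rightarrow> 's" where
  "run A [] q = q"
| "run A (x # w) q = run A w (step A x q)"

primrec outs :: "('s, 'm) transducer_scheme \<Rightarrow> letter list \<Rightarrow> 's \<Rightarrow> letter list" where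
  "outs A [] q = []"
| "outs A (x # w) q = out A x q @ outs A w (step A x q)"

definition inf_output :: "('s, 'm) transducer_scheme \<Rightarrow> (nat \<Rightarrow> letter) \<Rightarrow> 's \<Rightarrow> bool"
  where "inf_output A x q \<longleftrightarrow>
    (\<forall>m. \<exists>k. m \<le> length (outs A (Omega_Words_Fun.prefix k x) q))"

text \<open>The output on an infinite word; it is well defined only when \<^const>\<open>inf_output\<close> holds.\<close>

definition omega_out :: "('s, 'm) transducer_scheme \<Rightarrow> (nat \<Rightarrow> letter) \<Rightarrow> 's \<Rightarrow> (nat \<Rightarrow> letter)"
  where "omega_out A x q =
    (THE y. \<forall>k. inf_prefix (outs A (Omega_Words_Fun.prefix k x) q) y)"

definition is_transducer :: "nat \<Rightarrow> 's transducer \<Rightarrow> bool"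
  where "is_transducer n T \<longleftrightarrow>
    (\<forall>q\<in>states T. \<forall>x\<in>Xn n. step T x q \<in> states T \<and> out T x q \<in> lists (Xn n)) \<and>
    (\<forall>q\<in>states T. \<forall>x\<in>Cn n. inf_output T x q)"

text \<open>Equality of transducers over \<open>X\<^sub>n\<close> up to renaming states.\<close>

definition renaming :: "nat \<Rightarrow> 's transducer \<Rightarrow> 't transducer \<Rightarrow> bool"
  where "renaming n T U \<longleftrightarrow> is_transducer n T \<and> is_transducer n U \<and>
    (\<exists>f. bij_betw f (states T) (states U) \<and>
      (\<forall>q\<in>states T. \<forall>x\<in>Xn n.
         f (step T x q) = step U x (f q) \<and> out T x q = out U x (f q)))"


section \<open>Initial transducers over \<open>\<CC>\<^sub>n\<^sub>,\<^sub>r\<close>\<close>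

text \<open>
  \<open>rstates\<close> is the finite part \<open>R\<close> of the state set \<open>Q = R \<squnion> S\<close>, so that
  \<open>S\<close> is \<open>states A - rstates A\<close>.
\<close>

record 's nr_transducer = "'s transducer" +
  init :: 's
  rstates :: "'s set"

definition letters_at :: "nat \<Rightarrow> nat \<Rightarrow> 's nr_transducer \<Rightarrow> 's \<Rightarrow> letter set"
  where "letters_at n r A q = (if q = init A then dotted r else Xn n)"

definition words_at :: "nat \<Rightarrow> nat \<Rightarrow> 's nr_transducer \<Rightarrow> 's \<Rightarrow> letter list set"
  where "words_at n r A q = (if q = init A then Xnr_star n r else lists (Xn n))"

definition is_nr_transducer :: "nat \<Rightarrow> nat \<Rightarrow> 's nr_transducer \<Rightarrow> bool"
  where "is_nr_transducer n r A \<longleftrightarrow>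
    rstates A \<subseteq> states A \<and> finite (rstates A) \<and> init A \<in> rstates A \<and>
    (\<forall>q\<in>states A. \<forall>x\<in>letters_at n r A q. step A x q \<in> states A - {init A}) \<and>
    (\<forall>q\<in>rstates A. \<forall>x\<in>letters_at n r A q.
       if step A x q \<in> rstates A then out A x q = [] else out A x q \<in> Xnr_plus n r) \<and>
    (\<forall>q\<in>states A - rstates A. \<forall>x\<in>Xn n.
       step A x q \<notin> rstates A \<and> out A x q \<in> lists (Xn n)) \<and>
    (\<forall>q\<in>states A - rstates A. \<forall>x\<in>Cn n. inf_output A x q) \<and>
    (\<forall>q\<in>rstates A. \<forall>w\<in>words_at n r A q. w \<noteq> [] \<longrightarrow> run A w q \<noteq> q)"

definition represents :: "nat \<Rightarrow> nat \<Rightarrow> 's nr_transducer \<Rightarrow>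
    ((nat \<Rightarrow> letter) \<Rightarrow> (nat \<Rightarrow> letter)) \<Rightarrow> bool"
  where "represents n r A h \<longleftrightarrow> (\<forall>x\<in>Cnr n r. h x = omega_out A x (init A))"

text \<open>
  In the second clause the initial state can be left out: it is the only state that reads
  \<open>\<CC>\<^sub>n\<^sub>,\<^sub>r\<close> rather than \<open>\<CC>\<^sub>n\<close>, so its map differs from those of the others by its domain.
  In the third clause, a letter read from any state is followed by a point of \<open>\<CC>\<^sub>n\<close>.
\<close>

definition minimal :: "nat \<Rightarrow> nat \<Rightarrow> 's nr_transducer \<Rightarrow> bool"
  where "minimal n r A \<longleftrightarrow> is_nr_transducer n r A \<and>
    (\<forall>q\<in>states A. \<exists>w\<in>words_at n r A (init A). run A w (init A) = q) \<and>
    (\<forall>p\<in>states A - {init A}. \<forall>q\<in>states A - {init A}. p \<noteq> q \<longrightarrow>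
       (\<exists>x\<in>Cn n. omega_out A x p \<noteq> omega_out A x q)) \<and>
    (\<forall>q\<in>states A. \<forall>a\<in>letters_at n r A q.
       is_gcp (out A a q) {omega_out A ([a] \<frown> x) q | x. x \<in> Cn n})"

definition sync_at :: "nat \<Rightarrow> nat \<Rightarrow> 's nr_transducer \<Rightarrow> nat \<Rightarrow> bool"
  where "sync_at n r A k \<longleftrightarrow>
    (\<forall>w. length w = k \<longrightarrow> (\<forall>p\<in>states A. \<forall>q\<in>states A.
       w \<in> words_at n r A p \<and> w \<in> words_at n r A q \<longrightarrow> run A w p = run A w q))"

text \<open>
  The core, for a level \<open>k\<close> at which \<open>A\<close> synchronizes; it does not depend on the choice of
  such a \<open>k\<close>.  Words over \<open>X\<^sub>n\<close> are read from the non-initial states.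
\<close>

definition core :: "nat \<Rightarrow> 's nr_transducer \<Rightarrow> nat \<Rightarrow> 's transducer"
  where "core n A k =
    \<lparr>states = {run A w q | w q. w \<in> lists (Xn n) \<and> length w = k \<and> q \<in> states A - {init A}},
     step = step A, out = out A\<rparr>"


section \<open>The groups \<open>\<B>\<^sub>n\<^sub>,\<^sub>r\<close>, \<open>\<T>\<B>\<^sub>n\<^sub>,\<^sub>r\<close> and \<open>\<T>\<O>\<^sub>n\<^sub>,\<^sub>r\<close>\<close>

text \<open>
  The minimal transducer of a homeomorphism is unique up to renaming states, and its state set is
  countable because all states are reachable; so natural numbers suffice as states, and the minimal
  transducer can be referred to by an existential quantifier.
\<close>

definition fin_sync :: "nat \<Rightarrow> nat \<Rightarrow> ((nat \<Rightarrow> letter) \<Rightarrow> (nat \<Rightarrow> letter)) \<Rightarrow> bool"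
  where "fin_sync n r h \<longleftrightarrow> (\<exists>A :: nat nr_transducer.
    minimal n r A \<and> represents n r A h \<and> finite (states A) \<and> (\<exists>k. sync_at n r A k))"

text \<open>The values of \<open>h\<close> outside \<open>\<CC>\<^sub>n\<^sub>,\<^sub>r\<close> are irrelevant, here and below.\<close>

definition B_nr :: "nat \<Rightarrow> nat \<Rightarrow> ((nat \<Rightarrow> letter) \<Rightarrow> (nat \<Rightarrow> letter)) set"
  where "B_nr n r = {h. \<exists>g. homeomorphic_maps (Cnr_top n r) (Cnr_top n r) h g \<and>
    fin_sync n r h \<and> fin_sync n r g}"

definition TB_nr :: "nat \<Rightarrow> nat \<Rightarrow> ((nat \<Rightarrow> letter) \<Rightarrow> (nat \<Rightarrow> letter)) set"
  where "TB_nr n r = {h \<in> B_nr n r. \<forall>x\<in>Cnr n r. \<forall>y\<in>Cnr n r.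
    simeq n r (h x) (h y) \<longleftrightarrow> simeq n r x y}"

text \<open>
  The core of the minimal transducer of \<open>h\<close>, up to renaming states: the class of all transducers
  over \<open>X\<^sub>n\<close> that are a renaming of it.
\<close>

definition Core :: "nat \<Rightarrow> nat \<Rightarrow> ((nat \<Rightarrow> letter) \<Rightarrow> (nat \<Rightarrow> letter)) \<Rightarrow> nat transducer set"
  where "Core n r h = {T. \<exists>(A :: nat nr_transducer) k.
    minimal n r A \<and> represents n r A h \<and> sync_at n r A k \<and> renaming n T (core n A k)}"

text \<open>
  All the groups \<open>\<T>\<O>\<^sub>n\<^sub>,\<^sub>r\<close> for a given \<open>n\<close> are subgroups of one group \<open>\<O>\<^sub>n\<close> of classes of
  transducers over \<open>X\<^sub>n\<close>; the subgroup relation between them is inclusion of the sets below.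
\<close>

definition TO_nr :: "nat \<Rightarrow> nat \<Rightarrow> nat transducer set set"
  where "TO_nr n r = Core n r ` TB_nr n r"

end

theory Submission
  imports Defs
begin

text \<open>
  The quotient of \<open>\<CC>\<^sub>n\<^sub>,\<^sub>r\<close> by \<open>\<simeq>\<close> is a circle of length \<open>r\<close>. An element of \<open>\<T>\<B>\<^sub>n\<^sub>,\<^sub>r\<close> acts on this
  circle, and its action lifts to the \<open>m\<close>-fold cover, which is the quotient of \<open>\<CC>\<^sub>n\<^sub>,\<^sub>m\<^sub>r\<close>. Replacing the
  last dotted letter \<open>a\<close> by the \<open>n\<close> letters \<open>a 0, \<dots>, a (n-1)\<close> identifies the circles of
  \<open>\<CC>\<^sub>n\<^sub>,\<^sub>r\<^sub>+\<^sub>n\<^sub>-\<^sub>1\<close> and \<open>\<CC>\<^sub>n\<^sub>,\<^sub>r\<close>. Both constructions change a map only by exchanging finite prefixes of its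
  arguments and values. This keeps minimal transducers finite and synchronizing and does not change
  the core, because the core depends only on what remains of the map after long prefixes. Hence
  \<open>\<T>\<O>\<^sub>n\<^sub>,\<^sub>r\<close> is contained in \<open>\<T>\<O>\<^sub>n\<^sub>,\<^sub>s\<close> whenever \<open>s\<close> is congruent to a multiple of \<open>r\<close> modulo \<open>n - 1\<close>.
\<close>


section \<open>Finite and infinite words\<close>

text \<open>Membership in \<open>TO_nr n s\<close> asks for minimal transducers, with natural
  numbers as states, of a map and of its inverse, whereas the lift is given only as a map. So the
  transducer of \<open>h\<close> is not modified: that of the lift is rebuilt from its residuals,
  the maps that remain once greatest common prefixes are removed. Below a certain depth these
  residuals are maps of states of the transducer of \<open>h\<close>, which gives finiteness and
  synchronization. The depth varies with the point; compactness makes it uniform.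

  A homeomorphism of the circle may reverse orientation and may move the base point. A sign
  \<open>e\<close> and a locally constant integer function \<open>c\<close> record this: on the
  \<open>m\<close> sheets the lift acts by the affine map a -> e a + c modulo \<open>m\<close>. An
  identity relating \<open>wrap\<close>, \<open>e\<close> and \<open>c\<close> replaces covering
  theory.

  Multiplying \<open>r\<close> and splitting a dotted letter are both instances of the locale
  \<open>cover\<close>, the latter with a single sheet, so the transfer argument is given only
  once.\<close>

declare build_cons [simp del] build_append [simp del]

abbreviation pre :: "nat \<Rightarrow> 'a word \<Rightarrow> 'a list"
  where "pre k x \<equiv> Omega_Words_Fun.prefix k x"

abbreviation suf :: "nat \<Rightarrow> 'a word \<Rightarrow> 'a word"
  where "suf k x \<equiv> Omega_Words_Fun.suffix k x"

lemma Cn_conc: "w \<frown> x \<in> Cn n \<longleftrightarrow> w \<in> lists (Xn n) \<and> x \<in> Cn n"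
proof -
  have "y \<in> Cn n \<longleftrightarrow> range y \<subseteq> Xn n" for y
    by (auto simp: Cn_def)
  then show ?thesis
    by auto
qed

lemma Cnr_iff: "x \<in> Cnr n r \<longleftrightarrow> x 0 \<in> dotted r \<and> (\<forall>k. x (Suc k) \<in> Xn n)"
proof
  assume "x \<in> Cnr n r"
  then show "x 0 \<in> dotted r \<and> (\<forall>k. x (Suc k) \<in> Xn n)"
    by (auto simp: Cnr_def Cn_def)
next
  assume *: "x 0 \<in> dotted r \<and> (\<forall>k. x (Suc k) \<in> Xn n)"
  have "x = [x 0] \<frown> suf 1 x"
    by (rule ext) (auto simp: conc_def)
  with * show "x \<in> Cnr n r"
    unfolding Cnr_def Cn_def by force
qed

lemma Xnr_plus_iff: "w \<in> Xnr_plus n r \<longleftrightarrow> w \<noteq> [] \<and> hd w \<in> dotted r \<and> tl w \<in> lists (Xn n)"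
  by (cases w) (auto simp: Xnr_plus_def)

lemma Xnr_plus_append: "u \<in> Xnr_plus n r \<Longrightarrow> v \<in> lists (Xn n) \<Longrightarrow> u @ v \<in> Xnr_plus n r"
  by (auto simp: Xnr_plus_iff)

lemma Xnr_plus_Nil [simp]: "[] \<notin> Xnr_plus n r"
  by (simp add: Xnr_plus_iff)

lemma Cnr_conc: "w \<noteq> [] \<Longrightarrow> w \<frown> x \<in> Cnr n r \<longleftrightarrow> w \<in> Xnr_plus n r \<and> x \<in> Cn n"
proof -
  assume "w \<noteq> []"
  then obtain a u where w: "w = [a] @ u" by (cases w) auto
  have "[a] \<frown> y \<in> Cnr n r \<longleftrightarrow> a \<in> dotted r \<and> y \<in> Cn n" for y
    by (auto simp: Cnr_iff Cn_def)
  then show ?thesis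
    unfolding w conc_conc[symmetric] by (simp add: Cn_conc Xnr_plus_iff del: conc_conc)
qed

lemma Cnr_concI: "w \<in> Xnr_plus n r \<Longrightarrow> x \<in> Cn n \<Longrightarrow> w \<frown> x \<in> Cnr n r"
  using Cnr_conc[of w x n r] by (cases "w = []") simp_all

lemma Cnr_prefix: "x \<in> Cnr n r \<Longrightarrow> 0 < k \<Longrightarrow> pre k x \<in> Xnr_plus n r \<and> suf k x \<in> Cn n"
  using Cnr_conc[of "pre k x" "suf k x" n r] by simp

lemma Cnr_prefix_star: "x \<in> Cnr n r \<Longrightarrow> pre k x \<in> Xnr_star n r"
  using Cnr_prefix[of x n r k] by (cases "k = 0") (auto simp: Xnr_star_def)

lemma Cn_prefix: "x \<in> Cn n \<Longrightarrow> pre k x \<in> lists (Xn n) \<and> suf k x \<in> Cn n"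
  using Cn_conc[of "pre k x" "suf k x" n] by simp

lemma zeros_Cn [simp]: "n \<ge> 2 \<Longrightarrow> (\<lambda>_. Plain 0) \<in> Cn n"
  by (auto simp: Cn_def Xn_def)

lemma prefix_mono_eq: "pre k y = pre k x \<Longrightarrow> j \<le> k \<Longrightarrow> pre j y = pre j x"
  by (metis min.absorb1 subsequence_take plus_nat.add_0)

lemma prefix_eq_iff: "pre k y = pre k x \<longleftrightarrow> (\<forall>i<k. y i = x i)"
  by (auto simp: list_eq_iff_nth_eq)

lemma inf_prefix_iff: "inf_prefix w x \<longleftrightarrow> pre (length w) x = w"
  by (metis inf_prefix_def prefix_conc_length prefix_suffix)

lemma inf_prefix_conc [simp]: "inf_prefix w (w \<frown> x)"
  by (auto simp: inf_prefix_def)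

lemma inf_prefix_prefix: "inf_prefix (pre k x) x"
  by (simp add: inf_prefix_iff)

lemma inf_prefix_append: "inf_prefix (u @ v) (u \<frown> x) \<longleftrightarrow> inf_prefix v x"
  by (auto simp: inf_prefix_def simp flip: conc_conc)

lemma inf_prefix_trans: "Sublist.prefix u v \<Longrightarrow> inf_prefix v x \<Longrightarrow> inf_prefix u x"
  by (auto simp: inf_prefix_def prefix_def simp flip: conc_conc)

lemma inf_prefix_linear:
  "inf_prefix u x \<Longrightarrow> inf_prefix v x \<Longrightarrow> length u \<le> length v \<Longrightarrow> Sublist.prefix u v"
  by (metis inf_prefix_iff min.absorb1 plus_nat.add_0 subsequence_take take_is_prefix)


section \<open>The topology of \<open>\<CC>\<^sub>n\<^sub>,\<^sub>r\<close> in terms of prefixes\<close>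

definition word_cont :: "nat \<Rightarrow> nat \<Rightarrow> ((nat \<Rightarrow> letter) \<Rightarrow> (nat \<Rightarrow> letter)) \<Rightarrow> bool"
  where "word_cont n r f \<longleftrightarrow> (\<forall>x\<in>Cnr n r. \<forall>m. \<exists>k. \<forall>y\<in>Cnr n r.
    pre k y = pre k x \<longrightarrow> pre m (f y) = pre m (f x))"

definition loc_const :: "nat \<Rightarrow> nat \<Rightarrow> ((nat \<Rightarrow> letter) \<Rightarrow> 'a) \<Rightarrow> bool"
  where "loc_const n r c \<longleftrightarrow> (\<forall>x\<in>Cnr n r. \<exists>k. \<forall>y\<in>Cnr n r.
    pre k y = pre k x \<longrightarrow> c y = c x)"

lemma topspace_Cnr_top [simp]: "topspace (Cnr_top n r) = Cnr n r"
  by (simp add: Cnr_top_def)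

text \<open>Open boxes of the product restrict finitely many coordinates, so they contain a cylinder
  around each of their points; conversely, cylinders are such boxes.\<close>

lemma openin_Cnr_top: "openin (Cnr_top n r) U \<longleftrightarrow>
   U \<subseteq> Cnr n r \<and> (\<forall>x\<in>U. \<exists>k. \<forall>y\<in>Cnr n r. pre k y = pre k x \<longrightarrow> y \<in> U)"
proof (intro iffI conjI ballI; (elim conjE)?)
  assume "openin (Cnr_top n r) U"
  then obtain T where T: "openin (product_topology (\<lambda>_. discrete_topology UNIV) UNIV) T"
    and U: "U = T \<inter> Cnr n r"
    by (auto simp: Cnr_top_def openin_subtopology)
  show "U \<subseteq> Cnr n r" using U by auto
  fix x assume "x \<in> U"
  with U T obtain V where fin: "finite {i. V i \<noteq> (UNIV :: letter set)}"
    and x: "x \<in> PiE UNIV V" and V: "PiE UNIV V \<subseteq> T"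
    unfolding openin_product_topology_alt by force
  obtain k where k: "{i. V i \<noteq> UNIV} \<subseteq> {..<k}"
    using finite_nat_bounded[OF fin] by blast
  have "y \<in> U" if "y \<in> Cnr n r" "pre k y = pre k x" for y
  proof -
    have "y i \<in> V i" for i
    proof (cases "i < k")
      case True
      then show ?thesis using that(2) x by (auto simp: prefix_eq_iff)
    next
      case False
      then have "V i = UNIV" using k by auto
      then show ?thesis by simp
    qed
    then show ?thesis using that V U by (auto simp: PiE_iff)
  qed
  then show "\<exists>k. \<forall>y\<in>Cnr n r. pre k y = pre k x \<longrightarrow> y \<in> U" by blast
next
  assume U: "U \<subseteq> Cnr n r"
    and *: "\<forall>x\<in>U. \<exists>k. \<forall>y\<in>Cnr n r. pre k y = pre k x \<longrightarrow> y \<in> U"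
  then obtain k where k: "\<And>x y. x \<in> U \<Longrightarrow> y \<in> Cnr n r \<Longrightarrow> pre (k x) y = pre (k x) x \<Longrightarrow> y \<in> U"
    by metis
  define C where "C x = {y. \<forall>i<k x. y i = x i}" for x
  have "openin (product_topology (\<lambda>_. discrete_topology UNIV) UNIV) (C x)" for x :: "nat \<Rightarrow> letter"
    unfolding openin_product_topology_alt
  proof (intro ballI exI conjI)
    fix y assume y: "y \<in> C x"
    show "finite {i \<in> UNIV. (\<lambda>i. if i < k x then {x i} else UNIV) i \<noteq> topspace (discrete_topology (UNIV :: letter set))}"
      by (rule finite_subset[of _ "{..<k x}"]) auto
    show "y \<in> (\<Pi>\<^sub>E i\<in>UNIV. if i < k x then {x i} else UNIV)"
      using y by (auto simp: C_def)
    show "(\<Pi>\<^sub>E i\<in>UNIV. if i < k x then {x i} else UNIV) \<subseteq> C x"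
      unfolding C_def PiE_iff by (auto split: if_splits)
  qed auto
  then have "openin (product_topology (\<lambda>_. discrete_topology UNIV) UNIV) (\<Union>x\<in>U. C x)"
    by blast
  moreover have "U = (\<Union>x\<in>U. C x) \<inter> Cnr n r"
    using U k by (auto simp: C_def prefix_eq_iff)
  ultimately show "openin (Cnr_top n r) U"
    by (auto simp: Cnr_top_def openin_subtopology)
qed

lemma continuous_map_Cnr: "continuous_map (Cnr_top n r) (Cnr_top n s) f \<longleftrightarrow>
   (\<forall>x\<in>Cnr n r. f x \<in> Cnr n s) \<and> word_cont n r f"
proof (intro iffI conjI; (elim conjE)?)
  assume f: "continuous_map (Cnr_top n r) (Cnr_top n s) f"
  then show maps: "\<forall>x\<in>Cnr n r. f x \<in> Cnr n s"
    by (auto simp: continuous_map_def)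
  show "word_cont n r f"
    unfolding word_cont_def
  proof (intro ballI allI)
    fix x m assume x: "x \<in> Cnr n r"
    define U where "U = {z \<in> Cnr n s. pre m z = pre m (f x)}"
    have "openin (Cnr_top n s) U"
      unfolding openin_Cnr_top U_def by (auto intro!: exI[of _ m])
    then have "openin (Cnr_top n r) {x \<in> topspace (Cnr_top n r). f x \<in> U}"
      using f unfolding continuous_map_def by blast
    then have "\<exists>k. \<forall>y\<in>Cnr n r. pre k y = pre k x \<longrightarrow> f y \<in> U"
      unfolding openin_Cnr_top using x maps by (auto simp: U_def)
    then show "\<exists>k. \<forall>y\<in>Cnr n r. pre k y = pre k x \<longrightarrow> pre m (f y) = pre m (f x)"
      by (auto simp: U_def)
  qed
next
  assume maps: "\<forall>x\<in>Cnr n r. f x \<in> Cnr n s" and f: "word_cont n r f"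
  show "continuous_map (Cnr_top n r) (Cnr_top n s) f"
    unfolding continuous_map_def topspace_Cnr_top
  proof (intro conjI allI impI)
    fix U assume U: "openin (Cnr_top n s) U"
    show "openin (Cnr_top n r) {x \<in> Cnr n r. f x \<in> U}"
      unfolding openin_Cnr_top
    proof safe
      fix x assume x: "x \<in> Cnr n r" "f x \<in> U"
      obtain m where m: "\<And>z. z \<in> Cnr n s \<Longrightarrow> pre m z = pre m (f x) \<Longrightarrow> z \<in> U"
        using U x unfolding openin_Cnr_top by blast
      obtain k where "\<forall>y\<in>Cnr n r. pre k y = pre k x \<longrightarrow> pre m (f y) = pre m (f x)"
        using f x unfolding word_cont_def by blast
      then show "\<exists>k. \<forall>y\<in>Cnr n r. pre k y = pre k x \<longrightarrow> y \<in> {x \<in> Cnr n r. f x \<in> U}"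
        using m maps by blast
    qed
  qed (use maps in auto)
qed

text \<open>The space is a product of finite sets, so Tychonoff's theorem applies.\<close>

lemma compact_Cnr: "compact_space (Cnr_top n r)"
proof -
  define F where "F k = (if k = 0 then dotted r else Xn n)" for k :: nat
  have "x \<in> Cnr n r \<longleftrightarrow> (\<forall>k. x k \<in> F k)" for x
    unfolding Cnr_iff F_def by (metis nat.exhaust nat.simps(3))
  then have "Cnr n r = PiE UNIV F"
    by (auto simp: PiE_iff)
  moreover have "compactin (product_topology (\<lambda>_. discrete_topology UNIV) UNIV) (PiE UNIV F)"
    by (auto simp: compactin_PiE compactin_discrete_topology F_def dotted_def Xn_def)
  ultimately show ?thesis
    unfolding Cnr_top_def by (simp add: compact_space_subtopology)
qed

text \<open>The least \<open>k\<close> with \<open>P (pre k x)\<close> is decided by the prefix of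
  that length, hence is a continuous function into a discrete space. By compactness it takes
  finitely many values.\<close>

lemma Cnr_uniform:
  assumes "\<And>x. x \<in> Cnr n r \<Longrightarrow> \<exists>k. P (pre k x)"
  shows "\<exists>N. \<forall>x\<in>Cnr n r. \<exists>k\<le>N. P (pre k x)"
proof -
  define c where "c x = (LEAST k. P (pre k x))" for x
  have P: "P (pre (c x) x)" if "x \<in> Cnr n r" for x
    unfolding c_def using assms[OF that] by (rule LeastI_ex)
  have c: "c y = c x" if "x \<in> Cnr n r" "pre (c x) y = pre (c x) x" for x y
  proof -
    have "c y \<le> c x"
      using P that unfolding c_def by (metis Least_le)
    moreover have "c x \<le> c y"
      using P[OF that(1)] that(2) calculation unfolding c_def
      by (metis (mono_tags, lifting) LeastI Least_le prefix_mono_eq)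
    ultimately show ?thesis by simp
  qed
  have "continuous_map (Cnr_top n r) (discrete_topology UNIV) c"
    unfolding continuous_map_def openin_Cnr_top topspace_Cnr_top
  proof (intro conjI allI impI ballI)
    fix U x assume "x \<in> {x \<in> Cnr n r. c x \<in> U}"
    then show "\<exists>k. \<forall>y\<in>Cnr n r. pre k y = pre k x \<longrightarrow> y \<in> {x \<in> Cnr n r. c x \<in> U}"
      using c[of x] by (metis (mono_tags, lifting) mem_Collect_eq)
  qed auto
  then have "compactin (discrete_topology UNIV) (c ` Cnr n r)"
    using image_compactin[OF compact_Cnr[unfolded compact_space_def topspace_Cnr_top]] by blast
  then have "finite (c ` Cnr n r)"
    by (simp add: compactin_discrete_topology)
  then obtain N where "\<And>x. x \<in> Cnr n r \<Longrightarrow> c x \<le> N"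
    unfolding finite_nat_set_iff_bounded_le by blast
  with P show ?thesis by blast
qed


section \<open>Greatest common prefixes\<close>

lemma is_gcp_unique: "is_gcp u Y \<Longrightarrow> is_gcp v Y \<Longrightarrow> u = v"
  by (meson is_gcp_def prefix_order.antisym)

lemma is_gcp_append:
  assumes "Y \<noteq> {}"
  shows "is_gcp (u @ v) ((\<lambda>x. u \<frown> x) ` Y) \<longleftrightarrow> is_gcp v Y"
proof
  assume *: "is_gcp (u @ v) ((\<lambda>x. u \<frown> x) ` Y)"
  show "is_gcp v Y"
    unfolding is_gcp_def
  proof (intro conjI ballI allI impI)
    show "inf_prefix v y" if "y \<in> Y" for y
      using * that by (auto simp: is_gcp_def inf_prefix_append)
    show "Sublist.prefix w v" if "\<forall>y\<in>Y. inf_prefix w y" for w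
    proof -
      have "\<forall>y\<in>(\<lambda>x. u \<frown> x) ` Y. inf_prefix (u @ w) y"
        using that by (simp add: inf_prefix_append)
      then have "Sublist.prefix (u @ w) (u @ v)"
        using * by (simp only: is_gcp_def)
      then show ?thesis by simp
    qed
  qed
next
  assume *: "is_gcp v Y"
  show "is_gcp (u @ v) ((\<lambda>x. u \<frown> x) ` Y)"
    unfolding is_gcp_def
  proof (intro conjI ballI allI impI)
    show "inf_prefix (u @ v) y" if "y \<in> (\<lambda>x. u \<frown> x) ` Y" for y
      using * that by (auto simp: is_gcp_def inf_prefix_append)
    show "Sublist.prefix w (u @ v)" if w: "\<forall>y\<in>(\<lambda>x. u \<frown> x) ` Y. inf_prefix w y" for w
    proof (cases "length w \<le> length u")
      case True
      then have "Sublist.prefix w u"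
        using w assms inf_prefix_linear[of w _ u] by force
      then show ?thesis by (rule prefix_prefix)
    next
      case False
      then have "Sublist.prefix u w"
        using w assms inf_prefix_linear[of u _ w] by force
      then obtain w' where w': "w = u @ w'" by (auto simp: prefix_def)
      then have "\<forall>y\<in>Y. inf_prefix w' y"
        using w by (auto simp: inf_prefix_append)
      then show ?thesis
        using * w' by (auto simp: is_gcp_def)
    qed
  qed
qed

text \<open>Two distinct points of \<open>Y\<close> bound the length of every common prefix, so a
  longest one exists; common prefixes of one point are linearly ordered.\<close>

lemma is_gcp_exists:
  assumes "x \<in> Y" "y \<in> Y" "x \<noteq> y"
  shows "\<exists>w. is_gcp w Y"
proof -
  define P where "P k \<longleftrightarrow> (\<forall>z\<in>Y. inf_prefix (pre k x) z)" for k
  obtain i where i: "x i \<noteq> y i" using assms by blast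
  have bound: "k \<le> i" if "P k" for k
  proof (rule ccontr)
    assume "\<not> k \<le> i"
    moreover have "pre k y = pre k x"
      using bspec[OF that[unfolded P_def] assms(2)] by (simp add: inf_prefix_iff)
    ultimately show False
      using i by (auto simp: prefix_eq_iff)
  qed
  have P0: "P 0" by (auto simp: P_def inf_prefix_iff)
  define g where "g = (GREATEST k. P k)"
  have "P g"
    unfolding g_def using P0 bound by (rule GreatestI_nat)
  moreover have "Sublist.prefix v (pre g x)" if "\<forall>z\<in>Y. inf_prefix v z" for v
  proof -
    have v: "pre (length v) x = v"
      using bspec[OF that assms(1)] by (simp add: inf_prefix_iff)
    then have "P (length v)"
      using that by (simp add: P_def)
    then have "length v \<le> g"
      unfolding g_def using bound by (rule Greatest_le_nat)
    then show ?thesis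
      using inf_prefix_linear[of v x "pre g x"] that assms by (simp add: inf_prefix_prefix)
  qed
  ultimately have "is_gcp (pre g x) Y"
    by (auto simp: is_gcp_def P_def)
  then show ?thesis ..
qed

text \<open>Two factorizations of the same values are compared. As \<open>s\<close> has trivial
  common prefix, \<open>a\<close> is the greatest common prefix of these values, so it absorbs
  \<open>v\<close> and \<open>v\<close> can be cancelled.\<close>

lemma gcp_strip:
  assumes "is_gcp [] (s ` C)" "C \<noteq> {}" "\<And>x. x \<in> C \<Longrightarrow> a \<frown> s x = v \<frown> t x"
  obtains a' where "is_gcp a' (t ` C)" "a = v @ a'" "\<And>x. x \<in> C \<Longrightarrow> t x = a' \<frown> s x"
proof -
  have "is_gcp (a @ []) ((\<lambda>y. a \<frown> y) ` s ` C)"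
    using is_gcp_append[of "s ` C" a "[]"] assms by simp
  also have "(\<lambda>y. a \<frown> y) ` s ` C = (\<lambda>y. v \<frown> y) ` t ` C"
    using assms(3) by (auto simp: image_image)
  finally have a: "is_gcp a ((\<lambda>y. v \<frown> y) ` t ` C)" by simp
  then have "Sublist.prefix v a"
    by (simp add: is_gcp_def)
  then obtain a' where a': "a = v @ a'" by (auto simp: prefix_def)
  show ?thesis
  proof
    show "a = v @ a'" by fact
    show "is_gcp a' (t ` C)"
      using a is_gcp_append[of "t ` C" v a'] assms(2) a' by simp
    show "t x = a' \<frown> s x" if "x \<in> C" for x
      using assms(3)[OF that] by (simp add: a' flip: conc_conc)
  qed
qed


section \<open>Runs of transducers\<close>

lemma run_append: "run A (u @ v) q = run A v (run A u q)"
  by (induction u arbitrary: q) auto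

lemma outs_append: "outs A (u @ v) q = outs A u q @ outs A v (run A u q)"
  by (induction u arbitrary: q) auto

lemma outs_mono: "j \<le> k \<Longrightarrow> Sublist.prefix (outs A (pre j x) q) (outs A (pre k x) q)"
  by (metis outs_append prefixI prefix_suffix le_add_diff_inverse subsequence_append)

lemma inf_output_conc:
  assumes "inf_output A x (run A w q)"
  shows "inf_output A (w \<frown> x) q"
  unfolding inf_output_def
proof
  fix m
  obtain k where "m \<le> length (outs A (pre k x) (run A w q))"
    using assms by (auto simp: inf_output_def)
  then have "m \<le> length (outs A (pre (length w + k) (w \<frown> x)) q)"
    by (simp add: outs_append)
  then show "\<exists>k. m \<le> length (outs A (pre k (w \<frown> x)) q)" ..
qed

lemma omega_out_eqI:
  assumes "inf_output A x q" "\<And>k. inf_prefix (outs A (pre k x) q) y"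
  shows "omega_out A x q = y"
  unfolding omega_out_def
proof (rule the_equality)
  fix z assume z: "\<forall>k. inf_prefix (outs A (pre k x) q) z"
  have "z m = y m" for m
  proof -
    obtain k where "Suc m \<le> length (outs A (pre k x) q)"
      using assms(1) by (auto simp: inf_output_def)
    moreover have "pre (length (outs A (pre k x) q)) z = pre (length (outs A (pre k x) q)) y"
      using z assms(2) by (simp add: inf_prefix_iff)
    ultimately show ?thesis by (auto simp: prefix_eq_iff)
  qed
  then show "z = y" by blast
qed (use assms in blast)

text \<open>The definite description in \<open>omega_out\<close> has a witness: outputs on longer
  prefixes extend those on shorter ones, so reading letter \<open>m\<close> off any output of length
  greater than \<open>m\<close> gives their limit.\<close>

lemma omega_out_prefix:
  assumes "inf_output A x q"
  shows "inf_prefix (outs A (pre k x) q) (omega_out A x q)"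
proof -
  obtain j where j: "\<And>m. Suc m \<le> length (outs A (pre (j m) x) q)"
    using assms unfolding inf_output_def by (meson choice)
  define y where "y m = outs A (pre (j m) x) q ! m" for m
  have y: "inf_prefix (outs A (pre k x) q) y" for k
    unfolding inf_prefix_iff
  proof (rule nth_equalityI)
    fix i assume "i < length (pre (length (outs A (pre k x) q)) y)"
    then have i: "i < length (outs A (pre k x) q)" by simp
    have "outs A (pre k x) q ! i = outs A (pre (j i) x) q ! i"
    proof (cases "k \<le> j i")
      case True
      from outs_mono[OF this] i show ?thesis
        by (metis nth_append prefix_def)
    next
      case False
      then have "j i \<le> k" by simp
      from outs_mono[OF this, of A x q] j[of i] show ?thesis
        by (metis Suc_le_lessD nth_append prefix_def)
    qed
    then show "pre (length (outs A (pre k x) q)) y ! i = outs A (pre k x) q ! i"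
      using i by (simp add: y_def)
  qed simp
  then show ?thesis
    using omega_out_eqI[OF assms, of y] by simp
qed

lemma omega_out_conc:
  assumes "inf_output A x (run A w q)"
  shows "omega_out A (w \<frown> x) q = outs A w q \<frown> omega_out A x (run A w q)"
proof (rule omega_out_eqI)
  show "inf_output A (w \<frown> x) q" by (rule inf_output_conc) fact
  fix k
  let ?y = "outs A w q \<frown> omega_out A x (run A w q)"
  have "inf_prefix (outs A (pre (length w + k) (w \<frown> x)) q) ?y"
    using omega_out_prefix[OF assms] by (simp add: outs_append inf_prefix_append)
  moreover have "Sublist.prefix (outs A (pre k (w \<frown> x)) q) (outs A (pre (length w + k) (w \<frown> x)) q)"
    by (rule outs_mono) simp
  ultimately show "inf_prefix (outs A (pre k (w \<frown> x)) q) ?y"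
    using inf_prefix_trans by blast
qed


section \<open>Minimal synchronizing transducers\<close>

lemma core_step_out [simp]: "step (core n A k) = step A" "out (core n A k) = out A"
  by (simp_all add: core_def)

lemma core_states: "q \<in> states (core n A k) \<longleftrightarrow>
   (\<exists>w p. w \<in> lists (Xn n) \<and> length w = k \<and> p \<in> states A - {init A} \<and> q = run A w p)"
  by (auto simp: core_def)

locale min_sync =
  fixes n r :: nat and A :: "'s nr_transducer" and k :: nat
  assumes n2: "n \<ge> 2" and r1: "r \<ge> 1" and min: "minimal n r A" and sync: "sync_at n r A k"
begin

lemma nr: "is_nr_transducer n r A"
  using min by (simp add: minimal_def)

lemma init_R: "init A \<in> rstates A" "init A \<in> states A"
  using nr by (auto simp: is_nr_transducer_def)

lemma Plain0: "Plain 0 \<in> Xn n"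
  using n2 by (auto simp: Xn_def)

lemma step_init: "a \<in> dotted r \<Longrightarrow> step A a (init A) \<in> states A - {init A}"
  using nr init_R by (auto simp: is_nr_transducer_def letters_at_def)

lemma step_P:
  assumes "q \<in> states A - {init A}" "a \<in> Xn n"
  shows "step A a q \<in> states A - {init A}"
proof -
  have "\<forall>q\<in>states A. \<forall>x\<in>letters_at n r A q. step A x q \<in> states A - {init A}"
    using nr by (simp add: is_nr_transducer_def)
  then show ?thesis using assms by (auto simp: letters_at_def)
qed

lemma run_P: "q \<in> states A - {init A} \<Longrightarrow> w \<in> lists (Xn n) \<Longrightarrow> run A w q \<in> states A - {init A}"
proof (induction w arbitrary: q)
  case (Cons a w)
  then show ?case using step_P[of q a] by auto
qed simp

lemma run_init: "w \<in> Xnr_plus n r \<Longrightarrow> run A w (init A) \<in> states A - {init A}"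
  using run_P step_init by (force simp: Xnr_plus_def)

lemma run_S: "q \<in> states A - rstates A \<Longrightarrow> w \<in> lists (Xn n) \<Longrightarrow>
    run A w q \<in> states A - rstates A \<and> outs A w q \<in> lists (Xn n)"
proof (induction w arbitrary: q)
  case (Cons a w)
  have "q \<in> states A - {init A}" using Cons.prems init_R by auto
  then have "step A a q \<in> states A - rstates A \<and> out A a q \<in> lists (Xn n)"
    using nr step_P[of q a] Cons.prems by (auto simp: is_nr_transducer_def)
  then show ?case using Cons by auto
qed simp

lemma exists_P: "\<exists>p. p \<in> states A - {init A}"
  using step_init[of "Dotted 0"] r1 by (auto simp: dotted_def)

text \<open>The empty word is readable from the initial state and from all others, so
  synchronization at level 0 would identify them.\<close>

lemma k_pos: "k > 0"
proof (rule ccontr)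
  assume "\<not> k > 0"
  then have "sync_at n r A 0" using sync by simp
  moreover obtain p where "p \<in> states A - {init A}" using exists_P by blast
  ultimately show False
    using init_R by (auto simp: sync_at_def words_at_def Xnr_star_def)
qed

lemma run_sync:
  assumes "w \<in> lists (Xn n)" "k \<le> length w" "p \<in> states A - {init A}" "q \<in> states A - {init A}"
  shows "run A w p = run A w q"
proof -
  have "take k w \<in> lists (Xn n)" using assms(1) by (auto dest: in_set_takeD)
  then have "run A (take k w) p = run A (take k w) q"
    using sync assms unfolding sync_at_def words_at_def by auto
  then show ?thesis
    by (metis append_take_drop_id run_append)
qed

lemma run_in_core:
  assumes "w \<in> lists (Xn n)" "k \<le> length w" "q \<in> states A - {init A}"
  shows "run A w q \<in> states (core n A k)"
proof -
  \<comment> \<open>The core is defined by words of length exactly \<open>k\<close>, so the last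
    \<open>k\<close> letters are split off.\<close>
  define u where "u = take (length w - k) w"
  define v where "v = drop (length w - k) w"
  have w: "w = u @ v" by (simp add: u_def v_def)
  have "u \<in> lists (Xn n)" "v \<in> lists (Xn n)" using assms(1) w by auto
  then show ?thesis
    unfolding w run_append using run_P[OF assms(3), of u] assms(2)
    by (intro core_states[THEN iffD2] exI[of _ v] exI[of _ "run A u q"]) (auto simp: v_def)
qed

text \<open>A word that forces \<open>q\<close> from every state also leads from \<open>q\<close>
  back to \<open>q\<close>. Thus \<open>q\<close> lies on a cycle, and no state of \<open>R\<close>
  does.\<close>

lemma core_S: "states (core n A k) \<subseteq> states A - rstates A"
proof
  fix q assume q: "q \<in> states (core n A k)"
  then obtain w p where w: "w \<in> lists (Xn n)" "length w = k" "p \<in> states A - {init A}" "q = run A w p"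
    by (auto simp: core_states)
  then have qP: "q \<in> states A - {init A}" using run_P[of p w] w by simp
  have "run A w q = q"
    using run_sync[of w q p] w qP by simp
  moreover have "w \<noteq> []" using w k_pos by auto
  moreover have "w \<in> words_at n r A q" using w qP by (simp add: words_at_def)
  moreover have "\<forall>q\<in>rstates A. \<forall>w\<in>words_at n r A q. w \<noteq> [] \<longrightarrow> run A w q \<noteq> q"
    using nr by (simp add: is_nr_transducer_def)
  ultimately have "q \<notin> rstates A" by metis
  then show "q \<in> states A - rstates A" using qP by simp
qed

text \<open>The definition grants infinite output only from states of \<open>S\<close>. From the
  other non-initial states, \<open>k\<close> letters lead into the core and hence into
  \<open>S\<close>.\<close>

lemma inf_output_P:
  assumes "q \<in> states A - {init A}" "x \<in> Cn n"
  shows "inf_output A x q"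
proof -
  have "run A (pre k x) q \<in> states A - rstates A"
    using run_in_core[of "pre k x" q] core_S assms Cn_prefix by auto
  then have "inf_output A (suf k x) (run A (pre k x) q)"
    using nr Cn_prefix[OF assms(2)] by (auto simp: is_nr_transducer_def)
  from inf_output_conc[OF this] show ?thesis by simp
qed

lemma omega_out_P:
  assumes "q \<in> states A - {init A}" "w \<in> lists (Xn n)" "x \<in> Cn n"
  shows "omega_out A (w \<frown> x) q = outs A w q \<frown> omega_out A x (run A w q)"
  using assms by (intro omega_out_conc inf_output_P run_P)

lemma omega_out_init:
  assumes "w \<in> Xnr_plus n r" "x \<in> Cn n"
  shows "omega_out A (w \<frown> x) (init A) = outs A w (init A) \<frown> omega_out A x (run A w (init A))"
  using assms by (intro omega_out_conc inf_output_P run_init)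

lemma Cn_nonempty: "Cn n \<noteq> {}"
  using zeros_Cn[OF n2] by blast

lemma is_gcp_out:
  assumes "q \<in> states A" "a \<in> letters_at n r A q"
  shows "is_gcp (out A a q) ((\<lambda>x. omega_out A ([a] \<frown> x) q) ` Cn n)"
  using assms min unfolding minimal_def Setcompr_eq_image by blast

text \<open>Every non-initial state is entered by some letter, and by minimality the output on that
  letter already contains the whole common prefix of what follows.\<close>

lemma is_gcp_P:
  assumes "p \<in> states A - {init A}"
  shows "is_gcp [] ((\<lambda>x. omega_out A x p) ` Cn n)"
proof -
  have "\<forall>q\<in>states A. \<exists>w\<in>words_at n r A (init A). run A w (init A) = q"
    using min by (simp add: minimal_def)
  then obtain w where w: "w \<in> Xnr_star n r" "run A w (init A) = p"
    using assms by (auto simp: words_at_def)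
  then have "w \<noteq> []" using assms by auto
  then have wp: "w \<in> Xnr_plus n r" using w by (auto simp: Xnr_star_def)
  obtain u a where ua: "w = u @ [a]" using \<open>w \<noteq> []\<close> by (cases w rule: rev_cases) auto
  define q where "q = run A u (init A)"
  have q: "q \<in> states A \<and> a \<in> letters_at n r A q"
  proof (cases "u = []")
    case True
    then show ?thesis using wp ua init_R by (auto simp: q_def letters_at_def Xnr_plus_iff)
  next
    case False
    then have "u \<in> Xnr_plus n r" "a \<in> Xn n" using wp ua by (auto simp: Xnr_plus_iff)
    then show ?thesis using run_init[of u] by (auto simp: q_def letters_at_def)
  qed
  have p: "p = run A [a] q" using w ua by (simp add: q_def run_append)
  have "(\<lambda>x. omega_out A ([a] \<frown> x) q) ` Cn n = (\<lambda>y. out A a q \<frown> y) ` (\<lambda>x. omega_out A x p) ` Cn n"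
    unfolding image_image
  proof (rule image_cong)
    fix x assume "x \<in> Cn n"
    then have "inf_output A x (run A [a] q)" using inf_output_P assms p by blast
    from omega_out_conc[OF this] p show "omega_out A ([a] \<frown> x) q = out A a q \<frown> omega_out A x p"
      by simp
  qed simp
  with is_gcp_out[of q a] q is_gcp_append[of "(\<lambda>x. omega_out A x p) ` Cn n" "out A a q" "[]"] Cn_nonempty
  show ?thesis by simp
qed

lemma omega_out_inj:
  assumes "p \<in> states A - {init A}" "q \<in> states A - {init A}"
    and "\<And>x. x \<in> Cn n \<Longrightarrow> omega_out A x p = omega_out A x q"
  shows "p = q"
proof -
  have "\<forall>p\<in>states A - {init A}. \<forall>q\<in>states A - {init A}. p \<noteq> q \<longrightarrow>
       (\<exists>x\<in>Cn n. omega_out A x p \<noteq> omega_out A x q)"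
    using min by (simp add: minimal_def)
  with assms show ?thesis by blast
qed

lemma is_transducer_core: "is_transducer n (core n A k)"
proof -
  have outs: "outs (core n A k) w q = outs A w q" for w q
    by (induction w arbitrary: q) (auto simp: core_def)
  have "step A a q \<in> states (core n A k)" if q: "q \<in> states (core n A k)" and a: "a \<in> Xn n" for q a
  proof -
    obtain w p where w: "w \<in> lists (Xn n)" "length w = k" "p \<in> states A - {init A}" "q = run A w p"
      using q by (auto simp: core_states)
    then show ?thesis using run_in_core[of "w @ [a]" p] a by (simp add: run_append)
  qed
  moreover have "out A a q \<in> lists (Xn n)" if "q \<in> states (core n A k)" "a \<in> Xn n" for q a
    using run_S[of q "[a]"] core_S that by auto
  moreover have "inf_output (core n A k) x q" if "q \<in> states (core n A k)" "x \<in> Cn n" for q x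
  proof -
    have "inf_output A x q"
      using inf_output_P[of q x] core_S that init_R by blast
    then show ?thesis by (simp add: inf_output_def outs)
  qed
  ultimately show ?thesis
    unfolding is_transducer_def by auto
qed

end


section \<open>Comparing the cores of two minimal transducers\<close>

locale min_sync_pair = A: min_sync n r A k + B: min_sync n s B l
  for n r s and A :: "'s nr_transducer" and B :: "'t nr_transducer" and k l
begin

definition sim :: "'s \<Rightarrow> 't \<Rightarrow> bool"
  where "sim p q \<longleftrightarrow> (\<forall>x\<in>Cn n. omega_out A x p = omega_out B x q)"

text \<open>In a minimal transducer the output on a letter is a greatest common prefix, so it is
  determined by the map of the state; equal outputs can then be cancelled.\<close>

lemma sim_step:
  assumes "p \<in> states A - {init A}" "q \<in> states B - {init B}" "sim p q" "a \<in> Xn n"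
  shows "out A a p = out B a q \<and> sim (step A a p) (step B a q)"
proof -
  have a: "[a] \<frown> x \<in> Cn n" if "x \<in> Cn n" for x
    using that assms by (simp add: Cn_conc)
  have "(\<lambda>x. omega_out A ([a] \<frown> x) p) ` Cn n = (\<lambda>x. omega_out B ([a] \<frown> x) q) ` Cn n"
    using assms(3) a by (auto simp: sim_def)
  moreover have "is_gcp (out A a p) ((\<lambda>x. omega_out A ([a] \<frown> x) p) ` Cn n)"
    using assms by (intro A.is_gcp_out) (auto simp: letters_at_def)
  moreover have "is_gcp (out B a q) ((\<lambda>x. omega_out B ([a] \<frown> x) q) ` Cn n)"
    using assms by (intro B.is_gcp_out) (auto simp: letters_at_def)
  ultimately have out: "out A a p = out B a q"
    using is_gcp_unique by metis
  moreover have "omega_out A x (step A a p) = omega_out B x (step B a q)" if "x \<in> Cn n" for x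
  proof -
    have "omega_out A ([a] \<frown> x) p = omega_out B ([a] \<frown> x) q"
      using assms(3) a[OF that] by (simp add: sim_def)
    moreover have "omega_out A ([a] \<frown> x) p = out A a p \<frown> omega_out A x (step A a p)"
      using A.omega_out_P[of p "[a]" x] assms that by simp
    moreover have "omega_out B ([a] \<frown> x) q = out B a q \<frown> omega_out B x (step B a q)"
      using B.omega_out_P[of q "[a]" x] assms that by simp
    ultimately show ?thesis using out by simp
  qed
  ultimately show ?thesis by (simp add: sim_def)
qed

lemma sim_run:
  assumes "p \<in> states A - {init A}" "q \<in> states B - {init B}" "sim p q" "w \<in> lists (Xn n)"
  shows "sim (run A w p) (run B w q)"
  using assms
proof (induction w arbitrary: p q)
  case (Cons a w)
  then show ?case
    using sim_step[of p q a] A.step_P[of p a] B.step_P[of q a] by auto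
qed simp

text \<open>One pair of states with equal maps suffices: by synchronization every core state can be
  reached from it, and equality of maps persists along runs. Minimality makes the resulting
  correspondence one-to-one.\<close>

lemma renaming_core:
  assumes p0: "p0 \<in> states A - {init A}" and q0: "q0 \<in> states B - {init B}" and sim0: "sim p0 q0"
  shows "renaming n (core n A k) (core n B l)"
proof -
  let ?S = "states (core n A k)" and ?T = "states (core n B l)"
  have SP: "?S \<subseteq> states A - {init A}" and TP: "?T \<subseteq> states B - {init B}"
    using A.core_S A.init_R B.core_S B.init_R by auto
  have left: "\<exists>q\<in>?T. sim p q" if p: "p \<in> ?S" for p
  proof -
    obtain v p' where v: "v \<in> lists (Xn n)" "length v = k" "p' \<in> states A - {init A}" "p = run A v p'"
      using p by (auto simp: core_states)
    \<comment> \<open>The \<open>l\<close> zeros make \<open>?w\<close> long enough to bring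
      \<open>B\<close> into its core, while \<open>v\<close> at the end still forces
      \<open>A\<close> into \<open>p\<close>.\<close>
    let ?w = "replicate l (Plain 0) @ v"
    have w: "?w \<in> lists (Xn n)" using v A.Plain0 by auto
    have u: "replicate l (Plain 0) \<in> lists (Xn n)" using A.Plain0 by auto
    have "p = run A ?w p0"
      unfolding run_append v(4) using A.run_P[OF p0 u] v by (intro A.run_sync) auto
    moreover have "run B ?w q0 \<in> ?T"
      using w q0 by (intro B.run_in_core) auto
    ultimately show ?thesis
      using sim_run[OF p0 q0 sim0 w] by blast
  qed
  have right: "\<exists>p\<in>?S. sim p q" if q: "q \<in> ?T" for q
  proof -
    obtain v q' where v: "v \<in> lists (Xn n)" "length v = l" "q' \<in> states B - {init B}" "q = run B v q'"
      using q by (auto simp: core_states)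
    let ?w = "replicate k (Plain 0) @ v"
    have w: "?w \<in> lists (Xn n)" using v A.Plain0 by auto
    have u: "replicate k (Plain 0) \<in> lists (Xn n)" using A.Plain0 by auto
    have "q = run B ?w q0"
      unfolding run_append v(4) using B.run_P[OF q0 u] v by (intro B.run_sync) auto
    moreover have "run A ?w p0 \<in> ?S"
      using w p0 by (intro A.run_in_core) auto
    ultimately show ?thesis
      using sim_run[OF p0 q0 sim0 w] by blast
  qed
  have uniq: "q = q'" if "q \<in> ?T" "q' \<in> ?T" "sim p q" "sim p q'" for p q q'
    using that TP by (intro B.omega_out_inj) (auto simp: sim_def)
  have inj: "p = p'" if "p \<in> ?S" "p' \<in> ?S" "sim p q" "sim p' q" for p p' q
    using that SP by (intro A.omega_out_inj) (auto simp: sim_def)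
  define f where "f p = (SOME q. q \<in> ?T \<and> sim p q)" for p
  have f: "f p \<in> ?T \<and> sim p (f p)" if "p \<in> ?S" for p
    unfolding f_def by (rule someI_ex) (use left[OF that] in blast)
  have "bij_betw f ?S ?T"
    unfolding bij_betw_def
  proof
    show "inj_on f ?S"
    proof (rule inj_onI)
      fix p p' assume *: "p \<in> ?S" "p' \<in> ?S" "f p = f p'"
      then have "sim p (f p)" "sim p' (f p)" using f[of p] f[of p'] by auto
      with * inj show "p = p'" by blast
    qed
    show "f ` ?S = ?T"
    proof
      show "f ` ?S \<subseteq> ?T" using f by blast
      show "?T \<subseteq> f ` ?S"
      proof
        fix q assume "q \<in> ?T"
        then obtain p where "p \<in> ?S" "sim p q" using right by blast
        then have "q = f p" using f[of p] uniq \<open>q \<in> ?T\<close> by blast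
        then show "q \<in> f ` ?S" using \<open>p \<in> ?S\<close> by blast
      qed
    qed
  qed
  moreover have "f (step A a p) = step B a (f p) \<and> out A a p = out B a (f p)"
    if "p \<in> ?S" "a \<in> Xn n" for p a
  proof -
    have "step A a p \<in> ?S" "step B a (f p) \<in> ?T"
      using A.is_transducer_core B.is_transducer_core f[of p] that
      unfolding is_transducer_def by simp_all
    moreover have "out A a p = out B a (f p) \<and> sim (step A a p) (step B a (f p))"
      using f that SP TP by (intro sim_step) auto
    ultimately show ?thesis using f uniq by blast
  qed
  ultimately show ?thesis
    using A.is_transducer_core B.is_transducer_core
    unfolding renaming_def core_step_out by blast
qed

end

lemma renaming_trans:
  assumes "renaming n T U" "renaming n U V"
  shows "renaming n T V"
proof -
  obtain f where f: "bij_betw f (states T) (states U)"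
    "\<forall>q\<in>states T. \<forall>x\<in>Xn n. f (step T x q) = step U x (f q) \<and> out T x q = out U x (f q)"
    using assms(1) by (auto simp: renaming_def)
  obtain g where g: "bij_betw g (states U) (states V)"
    "\<forall>q\<in>states U. \<forall>x\<in>Xn n. g (step U x q) = step V x (g q) \<and> out U x q = out V x (g q)"
    using assms(2) by (auto simp: renaming_def)
  have "f q \<in> states U" if "q \<in> states T" for q
    using f(1) that by (auto simp: bij_betw_def)
  then have "\<forall>q\<in>states T. \<forall>x\<in>Xn n.
      (g \<circ> f) (step T x q) = step V x ((g \<circ> f) q) \<and> out T x q = out V x ((g \<circ> f) q)"
    using f(2) g(2) by simp
  with bij_betw_trans[OF f(1) g(1)] show ?thesis
    using assms unfolding renaming_def by blast
qed


section \<open>The canonical transducer of an injective continuous map\<close>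

definition gp :: "nat \<Rightarrow> ((nat \<Rightarrow> letter) \<Rightarrow> (nat \<Rightarrow> letter)) \<Rightarrow> letter list"
  where "gp n f = (THE w. is_gcp w (f ` Cn n))"

lemma gp_eqI: "is_gcp w (f ` Cn n) \<Longrightarrow> gp n f = w"
  unfolding gp_def by (rule the_equality) (auto intro: is_gcp_unique)

lemma gp_cong: "(\<And>x. x \<in> Cn n \<Longrightarrow> f x = g x) \<Longrightarrow> gp n f = gp n g"
  unfolding gp_def by (metis image_cong)

locale cantor_embedding =
  fixes n s :: nat and H :: "(nat \<Rightarrow> letter) \<Rightarrow> (nat \<Rightarrow> letter)"
  assumes n2: "n \<ge> 2" and s1: "s \<ge> 1"
    and maps: "x \<in> Cnr n s \<Longrightarrow> H x \<in> Cnr n s"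
    and inj: "inj_on H (Cnr n s)"
    and cont: "word_cont n s H"
begin

text \<open>
  The value \<open>G [] = []\<close> is a convention, not a greatest common prefix: it makes \<open>res []\<close> equal to
  \<open>H\<close>, as an initial state outputs full words of \<open>X\<^sub>n\<^sub>,\<^sub>r\<^sup>+\<close>.
\<close>

definition G :: "letter list \<Rightarrow> letter list"
  where "G W = (if W = [] then [] else gp n (\<lambda>x. H (W \<frown> x)))"

text \<open>The local action of \<open>H\<close> below \<open>W\<close>. Distinct local actions on
  \<open>Cn n\<close> will be the non-initial states of the minimal transducer.\<close>

definition res :: "letter list \<Rightarrow> (nat \<Rightarrow> letter) \<Rightarrow> (nat \<Rightarrow> letter)"
  where "res W x = suf (length (G W)) (H (W \<frown> x))"

lemma G_Nil [simp]: "G [] = []" and res_Nil [simp]: "res [] = H"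
  by (auto simp: G_def res_def fun_eq_iff)

lemma Cn_two: "\<exists>x\<in>Cn n. \<exists>y\<in>Cn n. x \<noteq> y"
proof -
  have "(\<lambda>_. Plain 0) \<in> Cn n" "(\<lambda>_. Plain 1) \<in> Cn n"
    using n2 by (auto simp: Cn_def Xn_def)
  moreover have "(\<lambda>_. Plain 0) \<noteq> (\<lambda>_::nat. Plain 1)" by (simp add: fun_eq_iff)
  ultimately show ?thesis by blast
qed

lemma Cn_nonempty: "Cn n \<noteq> {}"
  using Cn_two by blast

text \<open>By injectivity \<open>H\<close> takes two different values below \<open>W\<close>, so
  their common prefixes are bounded.\<close>

lemma is_gcp_G:
  assumes "W \<in> Xnr_plus n s"
  shows "is_gcp (G W) ((\<lambda>x. H (W \<frown> x)) ` Cn n)"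
proof -
  obtain x y where xy: "x \<in> Cn n" "y \<in> Cn n" "x \<noteq> y" using Cn_two by blast
  have W: "W \<noteq> []" using assms by (auto simp: Xnr_plus_iff)
  have "W \<frown> x \<in> Cnr n s" "W \<frown> y \<in> Cnr n s" using assms xy by (auto intro: Cnr_concI)
  then have "H (W \<frown> x) \<noteq> H (W \<frown> y)"
    using inj_on_eq_iff[OF inj] xy by simp
  then obtain w where w: "is_gcp w ((\<lambda>x. H (W \<frown> x)) ` Cn n)"
    using is_gcp_exists xy by (metis (no_types, lifting) imageI)
  then show ?thesis using W gp_eqI[OF w] by (simp add: G_def)
qed

lemma H_split:
  assumes "W \<frown> x \<in> Cnr n s"
  shows "H (W \<frown> x) = G W \<frown> res W x"
proof (cases "W = []")
  case False
  then have "inf_prefix (G W) (H (W \<frown> x))"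
    using is_gcp_G assms by (auto simp: is_gcp_def Cnr_conc)
  then show ?thesis
    by (metis inf_prefix_iff prefix_suffix res_def)
qed simp

lemma append_cases:
  assumes "W \<in> Xnr_star n s"
  shows "W @ v \<in> Xnr_star n s \<longleftrightarrow> (if W = [] then v \<in> Xnr_star n s else v \<in> lists (Xn n))"
  using assms by (auto simp: Xnr_star_def Xnr_plus_iff)

lemma star_prefix: "W @ v \<in> Xnr_star n s \<Longrightarrow> W \<in> Xnr_star n s"
  by (auto simp: Xnr_star_def Xnr_plus_iff)

text \<open>All values of \<open>H\<close> below \<open>W\<close> start with \<open>G W\<close>, so
  passing to \<open>W @ v\<close> only adds the common prefix of the residual. This makes the
  outputs along a run telescope.\<close>

lemma is_gcp_res:
  assumes "W @ v \<in> Xnr_plus n s"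
  shows "is_gcp (gp n (\<lambda>x. res W (v \<frown> x))) ((\<lambda>x. res W (v \<frown> x)) ` Cn n)"
    and "G (W @ v) = G W @ gp n (\<lambda>x. res W (v \<frown> x))"
    and "x \<in> Cn n \<Longrightarrow> res W (v \<frown> x) = gp n (\<lambda>x. res W (v \<frown> x)) \<frown> res (W @ v) x"
proof -
  have C: "W \<frown> (v \<frown> x) \<in> Cnr n s" if "x \<in> Cn n" for x
    using Cnr_concI[OF assms that] by simp
  have *: "(\<lambda>x. H ((W @ v) \<frown> x)) ` Cn n = (\<lambda>y. G W \<frown> y) ` (\<lambda>x. res W (v \<frown> x)) ` Cn n"
    unfolding image_image
  proof (rule image_cong)
    fix x assume "x \<in> Cn n"
    from H_split[OF C[OF this]] show "H ((W @ v) \<frown> x) = G W \<frown> res W (v \<frown> x)" by simp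
  qed simp
  have g: "is_gcp (G (W @ v)) ((\<lambda>y. G W \<frown> y) ` (\<lambda>x. res W (v \<frown> x)) ` Cn n)"
    using is_gcp_G[OF assms] * by simp
  then have "Sublist.prefix (G W) (G (W @ v))"
    by (auto simp: is_gcp_def)
  then obtain u where u: "G (W @ v) = G W @ u" by (auto simp: prefix_def)
  have "is_gcp u ((\<lambda>x. res W (v \<frown> x)) ` Cn n)"
    using g u is_gcp_append[of "(\<lambda>x. res W (v \<frown> x)) ` Cn n" "G W" u] Cn_nonempty by simp
  then have gp: "gp n (\<lambda>x. res W (v \<frown> x)) = u" and
    "is_gcp (gp n (\<lambda>x. res W (v \<frown> x))) ((\<lambda>x. res W (v \<frown> x)) ` Cn n)"
    using gp_eqI by auto
  then show "is_gcp (gp n (\<lambda>x. res W (v \<frown> x))) ((\<lambda>x. res W (v \<frown> x)) ` Cn n)"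
    "G (W @ v) = G W @ gp n (\<lambda>x. res W (v \<frown> x))"
    using u by auto
  show "res W (v \<frown> x) = gp n (\<lambda>x. res W (v \<frown> x)) \<frown> res (W @ v) x" if "x \<in> Cn n"
  proof -
    have "G W \<frown> res W (v \<frown> x) = H (W \<frown> (v \<frown> x))"
      using H_split[OF C[OF that]] by simp
    also have "\<dots> = (G W @ u) \<frown> res (W @ v) x"
      using H_split[of "W @ v" x] C[OF that] u by simp
    finally show ?thesis by (simp add: gp flip: conc_conc)
  qed
qed

text \<open>Continuity fixes the first \<open>m\<close> letters of the value on some cylinder, and
  these letters then belong to the common prefix. This is what yields infinite output.\<close>

lemma long_G:
  assumes "W \<frown> x \<in> Cnr n s"
  shows "\<exists>k. m \<le> length (G (W @ pre k x))"
proof -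
  obtain k where k: "\<And>y. y \<in> Cnr n s \<Longrightarrow> pre k y = pre k (W \<frown> x) \<Longrightarrow> pre m (H y) = pre m (H (W \<frown> x))"
    using cont assms unfolding word_cont_def by blast
  \<comment> \<open>\<open>Suc k\<close> instead of \<open>k\<close> keeps \<open>U\<close> nonempty
    even if \<open>W\<close> is empty, since \<open>G []\<close> is only a convention.\<close>
  define U where "U = W @ pre (Suc k) x"
  have eq: "W \<frown> x = U \<frown> suf (Suc k) x"
    by (simp add: U_def del: subseq_to_Suc flip: conc_conc)
  have "U \<noteq> []" by (simp add: U_def)
  then have U: "U \<in> Xnr_plus n s" using assms Cnr_conc[of U] eq by auto
  have "inf_prefix (pre m (H (W \<frown> x))) (H (U \<frown> y))" if "y \<in> Cn n" for y
  proof -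
    have "pre k (U \<frown> y) = pre k (W \<frown> x)"
      unfolding eq by (simp add: U_def)
    then have "pre m (H (U \<frown> y)) = pre m (H (W \<frown> x))"
      using k U that Cnr_conc[OF \<open>U \<noteq> []\<close>] by blast
    then show ?thesis by (simp add: inf_prefix_iff)
  qed
  then have "Sublist.prefix (pre m (H (W \<frown> x))) (G U)"
    using is_gcp_G[OF U] by (auto simp: is_gcp_def)
  then have "m \<le> length (G U)"
    using prefix_length_le by fastforce
  then show ?thesis unfolding U_def by blast
qed

end

text \<open>Synchronization is required only between nonempty words, that is, between non-initial
  states. \<open>code\<close> turns residuals into natural numbers, the state type used by
  \<open>fin_sync\<close> and \<open>Core\<close>.\<close>

locale finite_residuals = cantor_embedding +
  fixes code :: "((nat \<Rightarrow> letter) \<Rightarrow> (nat \<Rightarrow> letter)) \<Rightarrow> nat" and K :: nat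
  assumes fin: "finite ((\<lambda>W. restrict (res W) (Cn n)) ` Xnr_plus n s)"
    and code: "inj_on code ((\<lambda>W. restrict (res W) (Cn n)) ` Xnr_plus n s)"
    and res_sync: "\<lbrakk>u \<in> Xnr_plus n s; u' \<in> Xnr_plus n s; v \<in> lists (Xn n); K \<le> length v; x \<in> Cn n\<rbrakk>
      \<Longrightarrow> res (u @ v) x = res (u' @ v) x"
begin

text \<open>The value 0 is reserved for the empty word, so that the initial state is never merged
  with another one. The restriction to \<open>Cn n\<close> discards irrelevant values that could
  separate equal states.\<close>

definition id_of :: "letter list \<Rightarrow> nat"
  where "id_of W = (if W = [] then 0 else Suc (code (restrict (res W) (Cn n))))"

lemma id_of_eq_iff:
  assumes "W \<in> Xnr_star n s" "W' \<in> Xnr_star n s"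
  shows "id_of W = id_of W' \<longleftrightarrow> (W = [] \<longleftrightarrow> W' = []) \<and> (W \<noteq> [] \<longrightarrow> (\<forall>x\<in>Cn n. res W x = res W' x))"
proof (cases "W = [] \<or> W' = []")
  case False
  then have "W \<in> Xnr_plus n s" "W' \<in> Xnr_plus n s" using assms by (auto simp: Xnr_star_def)
  then have "id_of W = id_of W' \<longleftrightarrow> restrict (res W) (Cn n) = restrict (res W') (Cn n)"
    using False code by (auto simp: id_of_def inj_on_def)
  also have "\<dots> \<longleftrightarrow> (\<forall>x\<in>Cn n. res W x = res W' x)"
    by (auto simp: restrict_def fun_eq_iff)
  finally show ?thesis using False by auto
qed (auto simp: id_of_def)

definition rep :: "nat \<Rightarrow> letter list"
  where "rep q = (SOME W. W \<in> Xnr_star n s \<and> id_of W = q)"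

text \<open>A construction in the style of Myhill and Nerode: a letter emits what it adds to the
  greatest common prefix. \<open>R\<close> consists of the states reached before anything of the
  value is known.\<close>

definition B :: "nat nr_transducer"
  where "B = \<lparr>states = id_of ` Xnr_star n s,
    step = \<lambda>a q. id_of (rep q @ [a]),
    out = \<lambda>a q. gp n (\<lambda>x. res (rep q) ([a] \<frown> x)),
    init = 0,
    rstates = id_of ` {W \<in> Xnr_star n s. G W = []}\<rparr>"

lemma rep:
  assumes "W \<in> Xnr_star n s"
  shows "rep (id_of W) \<in> Xnr_star n s" "id_of (rep (id_of W)) = id_of W"
    "rep (id_of W) = [] \<longleftrightarrow> W = []"
    "W \<noteq> [] \<Longrightarrow> x \<in> Cn n \<Longrightarrow> res (rep (id_of W)) x = res W x"
proof -
  have "rep (id_of W) \<in> Xnr_star n s \<and> id_of (rep (id_of W)) = id_of W"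
    unfolding rep_def by (rule someI_ex) (use assms in blast)
  then show "rep (id_of W) \<in> Xnr_star n s" "id_of (rep (id_of W)) = id_of W"
    "rep (id_of W) = [] \<longleftrightarrow> W = []"
    "W \<noteq> [] \<Longrightarrow> x \<in> Cn n \<Longrightarrow> res (rep (id_of W)) x = res W x"
    using id_of_eq_iff[of "rep (id_of W)" W] assms by auto
qed

text \<open>The choice made by \<open>rep\<close> does not matter: words with equal residuals still
  have equal residuals after one more letter, by \<open>is_gcp_res\<close>.\<close>

lemma step_out:
  assumes "W @ [a] \<in> Xnr_star n s"
  shows "step B a (id_of W) = id_of (W @ [a])"
    and "out B a (id_of W) = gp n (\<lambda>x. res W ([a] \<frown> x))"
proof -
  let ?V = "rep (id_of W)"
  have W: "W \<in> Xnr_star n s" using assms by (rule star_prefix)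
  have Va: "?V @ [a] \<in> Xnr_star n s"
    using rep[OF W] assms W append_cases[OF W] append_cases[of ?V] by auto
  have plus: "W @ [a] \<in> Xnr_plus n s" "?V @ [a] \<in> Xnr_plus n s"
    using assms Va by (auto simp: Xnr_star_def)
  have eq: "res ?V ([a] \<frown> x) = res W ([a] \<frown> x)" if "x \<in> Cn n" for x
  proof (cases "W = []")
    case True
    then show ?thesis using rep(3)[OF W] by simp
  next
    case False
    then have "a \<in> Xn n" using plus by (auto simp: Xnr_plus_iff)
    then have "[a] \<frown> x \<in> Cn n" using that by (simp add: Cn_conc)
    then show ?thesis using rep(4)[OF W False] by simp
  qed
  then have gp: "gp n (\<lambda>x. res ?V ([a] \<frown> x)) = gp n (\<lambda>x. res W ([a] \<frown> x))"
    by (rule gp_cong)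
  then show "out B a (id_of W) = gp n (\<lambda>x. res W ([a] \<frown> x))"
    by (simp add: B_def)
  have "res (?V @ [a]) x = res (W @ [a]) x" if "x \<in> Cn n" for x
    using is_gcp_res(3)[OF plus(1) that] is_gcp_res(3)[OF plus(2) that] eq[OF that] gp
    by simp
  then have "id_of (?V @ [a]) = id_of (W @ [a])"
    using id_of_eq_iff[OF Va assms] by simp
  then show "step B a (id_of W) = id_of (W @ [a])"
    by (simp add: B_def)
qed

lemma run_outs:
  assumes "W @ v \<in> Xnr_star n s"
  shows "run B v (id_of W) = id_of (W @ v)" and "G (W @ v) = G W @ outs B v (id_of W)"
  using assms
proof (induction v arbitrary: W)
  case (Cons a v)
  { case 1
    then have "W @ [a] \<in> Xnr_star n s" using star_prefix[of "W @ [a]" v] by simp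
    then show ?case using 1 step_out(1)[of W a] Cons(1)[of "W @ [a]"] by simp
  next
    case 2
    then have Wa: "W @ [a] \<in> Xnr_star n s" using star_prefix[of "W @ [a]" v] by simp
    then have "W @ [a] \<in> Xnr_plus n s" by (simp add: Xnr_star_def)
    from is_gcp_res(2)[OF this] have "G (W @ [a]) = G W @ out B a (id_of W)"
      using step_out(2)[OF Wa] by simp
    then show ?case using 2 step_out(1)[OF Wa] Cons(2)[of "W @ [a]"] by simp }
qed simp_all

lemma omega_out_B:
  assumes "W \<frown> x \<in> Cnr n s"
  shows "inf_output B x (id_of W)" and "omega_out B x (id_of W) = res W x"
proof -
  have star: "W @ pre k x \<in> Xnr_star n s" for k
    using Cnr_prefix_star[OF assms, of "length W + k"] by simp
  show inf: "inf_output B x (id_of W)"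
    unfolding inf_output_def
  proof
    fix m
    obtain k where "length (G W) + m \<le> length (G (W @ pre k x))"
      using long_G[OF assms] by blast
    then show "\<exists>k. m \<le> length (outs B (pre k x) (id_of W))"
      using run_outs(2)[OF star[of k]] by auto
  qed
  show "omega_out B x (id_of W) = res W x"
  proof (rule omega_out_eqI[OF inf])
    fix k
    have eq: "W \<frown> x = (W @ pre k x) \<frown> suf k x"
      by (simp flip: conc_conc)
    then have "G W \<frown> res W x = G (W @ pre k x) \<frown> res (W @ pre k x) (suf k x)"
      using H_split[OF assms] H_split[of "W @ pre k x" "suf k x"] assms by simp
    then have "res W x = outs B (pre k x) (id_of W) \<frown> res (W @ pre k x) (suf k x)"
      by (simp add: run_outs(2)[OF star] flip: conc_conc)
    then show "inf_prefix (outs B (pre k x) (id_of W)) (res W x)"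
      by simp
  qed
qed

text \<open>Emptiness of \<open>G W\<close> has to be visible in the residual alone. It is: once
  \<open>G W\<close> contains the dotted letter, the residual takes values in \<open>Cn n\<close>,
  and before that in \<open>Cnr n s\<close>.\<close>

lemma rstates_iff:
  assumes "W \<in> Xnr_star n s"
  shows "id_of W \<in> rstates B \<longleftrightarrow> G W = []"
proof
  assume "id_of W \<in> rstates B"
  then obtain W' where W': "W' \<in> Xnr_star n s" "G W' = []" "id_of W = id_of W'"
    by (auto simp: B_def)
  show "G W = []"
  proof (rule ccontr)
    assume nz: "G W \<noteq> []"
    then have W: "W \<noteq> []" by auto
    with W' assms have W'0: "W' \<noteq> []" by (auto simp: id_of_eq_iff)
    let ?x = "\<lambda>_::nat. Plain 0"
    have x: "?x \<in> Cn n" using n2 by simp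
    have C: "W \<frown> ?x \<in> Cnr n s" "W' \<frown> ?x \<in> Cnr n s"
      using W W'0 x assms W' by (auto simp: Cnr_conc Xnr_star_def)
    have "res W ?x \<in> Cn n"
      using maps[OF C(1)] H_split[OF C(1)] nz by (simp add: Cnr_conc)
    moreover have "res W' ?x \<in> Cnr n s"
      using maps[OF C(2)] H_split[OF C(2)] W'(2) by simp
    moreover have "res W ?x = res W' ?x"
      using id_of_eq_iff[OF assms W'(1)] W'(3) W x by simp
    ultimately show False
      by (auto simp: Cn_def Cnr_iff Xn_def dotted_def) (metis imageE letter.distinct(1))
  qed
qed (use assms in \<open>auto simp: B_def\<close>)

lemma init_B [simp]: "init B = 0" "id_of [] = 0" "id_of W = 0 \<longleftrightarrow> W = []" "0 < id_of W \<longleftrightarrow> W \<noteq> []"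
  by (auto simp: B_def id_of_def)

lemma states_B: "q \<in> states B \<longleftrightarrow> (\<exists>W\<in>Xnr_star n s. q = id_of W)"
  by (auto simp: B_def)

lemma words_at_B:
  "W \<in> Xnr_star n s \<Longrightarrow> v \<in> words_at n s B (id_of W) \<longleftrightarrow> W @ v \<in> Xnr_star n s"
  by (simp add: words_at_def append_cases)

lemma letters_at_B:
  "W \<in> Xnr_star n s \<Longrightarrow> a \<in> letters_at n s B (id_of W) \<longleftrightarrow> W @ [a] \<in> Xnr_star n s"
  by (simp add: letters_at_def append_cases) (auto simp: Xnr_star_def Xnr_plus_iff)

section \<open>The canonical transducer is finite, minimal and synchronizing\<close>

lemma finite_B: "finite (states B)"
proof -
  have "states B \<subseteq> insert 0 ((\<lambda>f. Suc (code f)) ` (\<lambda>W. restrict (res W) (Cn n)) ` Xnr_plus n s)"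
    by (auto simp: B_def id_of_def Xnr_star_def)
  then show ?thesis by (rule finite_subset) (use fin in simp)
qed

text \<open>A cycle inside \<open>R\<close> would emit nothing, so repeating its label forever would
  contradict infinite output.\<close>

lemma acyclic_B:
  assumes W: "W \<in> Xnr_star n s" and R: "G W = []" and w: "W @ w \<in> Xnr_star n s" "w \<noteq> []"
  shows "run B w (id_of W) \<noteq> id_of W"
proof
  assume cyc: "run B w (id_of W) = id_of W"
  then have id: "id_of (W @ w) = id_of W"
    using run_outs(1)[OF w(1)] by simp
  then have W0: "W \<noteq> []" using w(2) init_B(2,3) by (metis append_is_Nil_conv)
  have "G (W @ w) = []"
    using rstates_iff[OF w(1)] rstates_iff[OF W] R id by simp
  then have outs: "outs B w (id_of W) = []"
    using run_outs(2)[OF w(1)] by simp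
  let ?x = "w\<^sup>\<omega>"
  have unroll: "?x = w \<frown> ?x" using w(2) by (intro iter_unroll) simp
  have stay: "outs B (pre (j * length w) ?x) (id_of W) = []" for j
  proof (induction j)
    case (Suc j)
    have "pre (Suc j * length w) ?x = w @ pre (j * length w) ?x"
      by (subst unroll) simp
    then show ?case using Suc by (simp add: outs_append outs cyc)
  qed simp
  have "w \<in> lists (Xn n)" using w W W0 by (simp add: append_cases)
  then have "?x \<in> Cn n" using w(2) by (auto simp: Cn_def in_lists_conv_set)
  then have "W \<frown> ?x \<in> Cnr n s" using W W0 by (auto simp: Cnr_conc Xnr_star_def)
  from omega_out_B(1)[OF this] obtain k where "1 \<le> length (outs B (pre k ?x) (id_of W))"
    unfolding inf_output_def by blast
  moreover have "k \<le> k * length w" using w(2) by (cases w) auto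
  ultimately show False
    using outs_mono[of k "k * length w" B ?x "id_of W"] stay[of k] by auto
qed

lemma is_nr_transducer_B: "is_nr_transducer n s B"
proof -
  have G_mono: "G (W @ v) \<noteq> []" if "W @ v \<in> Xnr_star n s" "G W \<noteq> []" for W v
    using run_outs(2)[OF that(1)] that(2) by simp
  have 1: "rstates B \<subseteq> states B" "finite (rstates B)" "init B \<in> rstates B"
  proof -
    show sub: "rstates B \<subseteq> states B" by (auto simp: B_def)
    then show "finite (rstates B)" using finite_B finite_subset by blast
    show "init B \<in> rstates B"
      using rstates_iff[of "[]"] by (simp add: Xnr_star_def)
  qed
  have 2: "step B a q \<in> states B - {init B}" if "q \<in> states B" "a \<in> letters_at n s B q" for q a
    using that by (auto simp: states_B letters_at_B step_out)
  have GX: "G W \<in> Xnr_plus n s" if "W \<in> Xnr_plus n s" "G W \<noteq> []" for W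
  proof -
    have C: "W \<frown> (\<lambda>_. Plain 0) \<in> Cnr n s"
      using that n2 Cnr_conc[of W] by (metis Xnr_plus_iff zeros_Cn)
    show ?thesis using maps[OF C] H_split[OF C] that(2) by (simp add: Cnr_conc)
  qed
  have 3: "if step B a q \<in> rstates B then out B a q = [] else out B a q \<in> Xnr_plus n s"
    if q: "q \<in> rstates B" and a: "a \<in> letters_at n s B q" for q a
  proof -
    obtain W where W: "W \<in> Xnr_star n s" "q = id_of W" "G W = []"
      using q by (auto simp: B_def)
    have Wa: "W @ [a] \<in> Xnr_star n s" using a W by (simp add: letters_at_B)
    have "out B a q = G (W @ [a])" using run_outs(2)[OF Wa] W by simp
    moreover have "step B a q \<in> rstates B \<longleftrightarrow> G (W @ [a]) = []"
      using step_out(1)[OF Wa] rstates_iff[OF Wa] W by simp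
    moreover have "W @ [a] \<in> Xnr_plus n s" using Wa by (simp add: Xnr_star_def)
    ultimately show ?thesis using GX by auto
  qed
  have 4: "step B a q \<notin> rstates B \<and> out B a q \<in> lists (Xn n)"
    if q: "q \<in> states B - rstates B" and a: "a \<in> Xn n" for q a
  proof -
    obtain W where W: "W \<in> Xnr_star n s" "q = id_of W"
      using q by (auto simp: states_B)
    then have GW: "G W \<noteq> []" using q rstates_iff by auto
    then have W0: "W \<noteq> []" by auto
    have Wa: "W @ [a] \<in> Xnr_star n s" using a W W0 by (simp add: append_cases)
    have GWa: "G (W @ [a]) = G W @ out B a q" using run_outs(2)[OF Wa] W by simp
    have "W @ [a] \<in> Xnr_plus n s" using Wa by (simp add: Xnr_star_def)
    then have "G W @ out B a q \<in> Xnr_plus n s" using GX[of "W @ [a]"] GWa GW by simp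
    then have "out B a q \<in> lists (Xn n)" using GW by (auto simp: Xnr_plus_iff)
    moreover have "step B a q \<notin> rstates B"
      using step_out(1)[OF Wa] rstates_iff[OF Wa] W GWa GW by simp
    ultimately show ?thesis by simp
  qed
  have 5: "inf_output B x q" if q: "q \<in> states B - rstates B" and x: "x \<in> Cn n" for q x
  proof -
    obtain W where W: "W \<in> Xnr_star n s" "q = id_of W"
      using q by (auto simp: states_B)
    then have "G W \<noteq> []" using q rstates_iff by auto
    then have "W \<noteq> []" by auto
    then have "W \<frown> x \<in> Cnr n s" using W x by (auto simp: Cnr_conc Xnr_star_def)
    then show ?thesis using omega_out_B(1) W by simp
  qed
  have 6: "run B w q \<noteq> q" if q: "q \<in> rstates B" and w: "w \<in> words_at n s B q" "w \<noteq> []" for q w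
  proof -
    obtain W where W: "W \<in> Xnr_star n s" "q = id_of W" "G W = []"
      using q by (auto simp: B_def)
    then show ?thesis using acyclic_B[of W w] w by (simp add: words_at_B)
  qed
  show ?thesis
    unfolding is_nr_transducer_def using 1 2 3 4 5 6 by blast
qed

lemma minimal_B: "minimal n s B"
proof -
  have Nil: "[] \<in> Xnr_star n s" by (simp add: Xnr_star_def)
  have 1: "\<exists>w\<in>words_at n s B (init B). run B w (init B) = q" if q: "q \<in> states B" for q
  proof -
    obtain W where W: "W \<in> Xnr_star n s" "q = id_of W" using q by (auto simp: states_B)
    have "run B W (init B) = q" using run_outs(1)[of "[]" W] W by simp
    moreover have "W \<in> words_at n s B (init B)" using words_at_B[OF Nil, of W] W by simp
    ultimately show ?thesis by blast
  qed
  have 2: "\<exists>x\<in>Cn n. omega_out B x p \<noteq> omega_out B x q"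
    if p: "p \<in> states B - {init B}" and q: "q \<in> states B - {init B}" and "p \<noteq> q" for p q
  proof -
    obtain W where W: "W \<in> Xnr_star n s" "p = id_of W" "W \<noteq> []"
      using p by (auto simp: states_B)
    obtain V where V: "V \<in> Xnr_star n s" "q = id_of V" "V \<noteq> []"
      using q by (auto simp: states_B)
    obtain x where x: "x \<in> Cn n" "res W x \<noteq> res V x"
      using id_of_eq_iff[OF W(1) V(1)] W V \<open>p \<noteq> q\<close> by auto
    have "W \<frown> x \<in> Cnr n s" "V \<frown> x \<in> Cnr n s"
      using W V x by (auto simp: Cnr_conc Xnr_star_def)
    then have "omega_out B x p \<noteq> omega_out B x q" using omega_out_B(2) x W V by simp
    then show ?thesis using x by blast
  qed
  have 3: "is_gcp (out B a q) {omega_out B ([a] \<frown> x) q | x. x \<in> Cn n}"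
    if q: "q \<in> states B" and a: "a \<in> letters_at n s B q" for q a
  proof -
    obtain W where W: "W \<in> Xnr_star n s" "q = id_of W" using q by (auto simp: states_B)
    then have Wa: "W @ [a] \<in> Xnr_star n s" using a letters_at_B by blast
    then have plus: "W @ [a] \<in> Xnr_plus n s" by (simp add: Xnr_star_def)
    have "omega_out B ([a] \<frown> x) q = res W ([a] \<frown> x)" if "x \<in> Cn n" for x
    proof -
      have "W \<frown> ([a] \<frown> x) \<in> Cnr n s"
        using plus that Cnr_conc[of "W @ [a]" x n s] by simp
      then show ?thesis using omega_out_B(2) W by simp
    qed
    then have "{omega_out B ([a] \<frown> x) q | x. x \<in> Cn n} = (\<lambda>x. res W ([a] \<frown> x)) ` Cn n"
      unfolding Setcompr_eq_image by (rule image_cong[OF refl])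
    then show ?thesis using is_gcp_res(1)[OF plus] step_out(2)[OF Wa] W by simp
  qed
  show ?thesis
    unfolding minimal_def using is_nr_transducer_B 1 2 3 by blast
qed

text \<open>Level \<open>Suc K\<close> ensures a nonempty word even for \<open>K = 0\<close>. Such a
  word starts with a dotted letter if it is read from the initial state, and with a plain one
  otherwise, so the two kinds of state never compete.\<close>

lemma sync_at_B: "sync_at n s B (Suc K)"
  unfolding sync_at_def
proof (intro allI impI ballI, elim conjE)
  fix w p q
  assume len: "length w = Suc K" and p: "p \<in> states B" and q: "q \<in> states B"
    and wp: "w \<in> words_at n s B p" and wq: "w \<in> words_at n s B q"
  obtain W where W: "W \<in> Xnr_star n s" "p = id_of W" using p by (auto simp: states_B)
  obtain V where V: "V \<in> Xnr_star n s" "q = id_of V" using q by (auto simp: states_B)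
  have Ww: "W @ w \<in> Xnr_star n s" and Vw: "V @ w \<in> Xnr_star n s"
    using wp wq W V by (auto simp: words_at_B)
  have w0: "w \<noteq> []" using len by auto
  have dp: "w \<in> Xnr_star n s \<Longrightarrow> w \<notin> lists (Xn n)"
    using w0 by (cases w) (auto simp: Xnr_star_def Xnr_plus_iff dotted_def Xn_def)
  have "W = [] \<longleftrightarrow> V = []"
    using Ww Vw W V dp by (auto simp: append_cases split: if_splits)
  moreover have "id_of (W @ w) = id_of (V @ w)" if "W \<noteq> []" "V \<noteq> []"
  proof -
    have "W \<in> Xnr_plus n s" "V \<in> Xnr_plus n s" "w \<in> lists (Xn n)"
      using that W V Ww append_cases[OF W(1), of w] by (auto simp: Xnr_star_def)
    then show ?thesis
      using id_of_eq_iff[OF Ww Vw] that res_sync[of W V w] len by simp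
  qed
  ultimately show "run B w p = run B w q"
    using run_outs(1)[OF Ww] run_outs(1)[OF Vw] W V by auto
qed

lemma represents_B: "represents n s B H"
  unfolding represents_def using omega_out_B(2)[of "[]"] by simp

lemma fin_sync_H: "fin_sync n s H"
  unfolding fin_sync_def using minimal_B represents_B finite_B sync_at_B by blast

end

lemma (in cantor_embedding) fin_syncI:
  assumes "finite ((\<lambda>W. restrict (res W) (Cn n)) ` Xnr_plus n s)"
    and "\<And>u u' v x. \<lbrakk>u \<in> Xnr_plus n s; u' \<in> Xnr_plus n s; v \<in> lists (Xn n); K \<le> length v; x \<in> Cn n\<rbrakk>
      \<Longrightarrow> res (u @ v) x = res (u' @ v) x"
  shows "fin_sync n s H"
proof -
  obtain code :: "((nat \<Rightarrow> letter) \<Rightarrow> (nat \<Rightarrow> letter)) \<Rightarrow> nat"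
    where code: "inj_on code ((\<lambda>W. restrict (res W) (Cn n)) ` Xnr_plus n s)"
    using finite_imp_inj_to_nat_seg[OF assms(1)] by blast
  interpret finite_residuals n s H code K
    by unfold_locales (fact assms(1) | fact code | erule (4) assms(2))+
  show ?thesis by (rule fin_sync_H)
qed


section \<open>Maps that agree with a given map up to changes of prefixes\<close>

text \<open>The shared tail \<open>t\<close> says that \<open>H\<close> below \<open>W\<close> and
  \<open>h\<close> below \<open>w\<close> are one map up to exchanging \<open>W\<close> with
  \<open>w\<close> and \<open>V\<close> with \<open>v\<close>. Only such local agreement is needed
  to transfer finiteness, synchronization and the core.\<close>

definition modelled :: "nat \<Rightarrow> nat \<Rightarrow> nat \<Rightarrow> ((nat \<Rightarrow> letter) \<Rightarrow> (nat \<Rightarrow> letter)) \<Rightarrow>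
    ((nat \<Rightarrow> letter) \<Rightarrow> (nat \<Rightarrow> letter)) \<Rightarrow> letter list \<Rightarrow> bool"
  where "modelled n s r H h W \<longleftrightarrow> (\<exists>V w v. W \<in> Xnr_plus n s \<and> V \<in> Xnr_plus n s \<and>
    w \<in> Xnr_plus n r \<and> v \<in> Xnr_plus n r \<and>
    (\<forall>x\<in>Cn n. \<exists>t\<in>Cn n. H (W \<frown> x) = V \<frown> t \<and> h (w \<frown> x) = v \<frown> t))"

definition loc_modelled :: "nat \<Rightarrow> nat \<Rightarrow> nat \<Rightarrow> ((nat \<Rightarrow> letter) \<Rightarrow> (nat \<Rightarrow> letter)) \<Rightarrow>
    ((nat \<Rightarrow> letter) \<Rightarrow> (nat \<Rightarrow> letter)) \<Rightarrow> bool"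
  where "loc_modelled n s r H h \<longleftrightarrow> (\<forall>X\<in>Cnr n s. \<exists>k. modelled n s r H h (pre k X))"

lemma modelledE:
  assumes "modelled n s r H h W"
  obtains V w v t where "W \<in> Xnr_plus n s" "V \<in> Xnr_plus n s" "w \<in> Xnr_plus n r" "v \<in> Xnr_plus n r"
    "\<And>x. x \<in> Cn n \<Longrightarrow> t x \<in> Cn n" "\<And>x. x \<in> Cn n \<Longrightarrow> H (W \<frown> x) = V \<frown> t x"
    "\<And>x. x \<in> Cn n \<Longrightarrow> h (w \<frown> x) = v \<frown> t x"
proof -
  obtain V w v where *: "W \<in> Xnr_plus n s" "V \<in> Xnr_plus n s" "w \<in> Xnr_plus n r" "v \<in> Xnr_plus n r"
    "\<forall>x\<in>Cn n. \<exists>t\<in>Cn n. H (W \<frown> x) = V \<frown> t \<and> h (w \<frown> x) = v \<frown> t"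
    using assms unfolding modelled_def by blast
  obtain t where "\<forall>x\<in>Cn n. t x \<in> Cn n \<and> H (W \<frown> x) = V \<frown> t x \<and> h (w \<frown> x) = v \<frown> t x"
    using bchoice[of "Cn n" "\<lambda>x t. t \<in> Cn n \<and> H (W \<frown> x) = V \<frown> t \<and> h (w \<frown> x) = v \<frown> t"] *(5)
    by blast
  with * that show ?thesis by blast
qed

lemma loc_modelled_maps:
  assumes "loc_modelled n s r H h" "X \<in> Cnr n s"
  shows "H X \<in> Cnr n s"
proof -
  obtain k where k: "modelled n s r H h (pre k X)"
    using assms by (auto simp: loc_modelled_def)
  then obtain V w v t where m: "pre k X \<in> Xnr_plus n s" "V \<in> Xnr_plus n s"
    "\<And>x. x \<in> Cn n \<Longrightarrow> t x \<in> Cn n" "\<And>x. x \<in> Cn n \<Longrightarrow> H (pre k X \<frown> x) = V \<frown> t x"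
    by (rule modelledE) blast
  have "suf k X \<in> Cn n"
    using Cnr_conc[of "pre k X" "suf k X" n s] m(1) assms(2) by (cases "k = 0") auto
  then have "H (pre k X \<frown> suf k X) = V \<frown> t (suf k X)" "t (suf k X) \<in> Cn n"
    using m by blast+
  then show ?thesis using Cnr_concI[OF m(2)] by simp
qed

lemma word_cont_modelled:
  assumes "word_cont n r h" "loc_modelled n s r H h"
  shows "word_cont n s H"
  unfolding word_cont_def
proof (intro ballI allI)
  fix X m assume X: "X \<in> Cnr n s"
  then obtain l where "modelled n s r H h (pre l X)"
    using assms(2) by (auto simp: loc_modelled_def)
  then obtain V w v t where m: "pre l X \<in> Xnr_plus n s" "w \<in> Xnr_plus n r"
    "\<And>x. x \<in> Cn n \<Longrightarrow> H (pre l X \<frown> x) = V \<frown> t x" "\<And>x. x \<in> Cn n \<Longrightarrow> h (w \<frown> x) = v \<frown> t x"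
    by (rule modelledE) blast
  have suf: "suf l Y \<in> Cn n" if "Y \<in> Cnr n s" for Y
    using Cnr_prefix[OF that, of l] m(1) by (cases "l = 0") auto
  let ?x = "suf l X"
  have x: "?x \<in> Cn n" using suf X by blast
  \<comment> \<open>Values of \<open>h\<close> carry \<open>v\<close> in front of the common tail,
    so \<open>length v + m\<close> letters are needed to control \<open>m\<close> letters of the
    tail.\<close>
  obtain k where k: "\<And>y. y \<in> Cnr n r \<Longrightarrow> pre k y = pre k (w \<frown> ?x) \<Longrightarrow>
      pre (length v + m) (h y) = pre (length v + m) (h (w \<frown> ?x))"
    using assms(1) Cnr_concI[OF m(2) x] unfolding word_cont_def by blast
  have "pre m (H Y) = pre m (H X)" if Y: "Y \<in> Cnr n s" "pre (l + k) Y = pre (l + k) X" for Y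
  proof -
    let ?y = "suf l Y"
    have y: "?y \<in> Cn n" using suf Y by blast
    have l: "pre l Y = pre l X" using prefix_mono_eq[OF Y(2), of l] by simp
    have "pre k ?y = pre k ?x"
      using Y(2) by (simp add: prefix_eq_iff del: subsequence_shift)
    then have "pre (length w + k) (w \<frown> ?y) = pre (length w + k) (w \<frown> ?x)"
      by (simp del: subsequence_shift)
    then have "pre k (w \<frown> ?y) = pre k (w \<frown> ?x)"
      by (rule prefix_mono_eq) simp
    then have "pre (length v + m) (h (w \<frown> ?y)) = pre (length v + m) (h (w \<frown> ?x))"
      using k Cnr_concI[OF m(2) y] by blast
    then have t: "pre m (t ?y) = pre m (t ?x)"
      using m(4)[OF x] m(4)[OF y] by simp
    have "H Y = V \<frown> t ?y" "H X = V \<frown> t ?x"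
      using m(3)[OF x] m(3)[OF y] l prefix_suffix[of X l] prefix_suffix[of Y l] by metis+
    then have "pre (length V + m) (H Y) = pre (length V + m) (H X)"
      using t by simp
    then show ?thesis by (rule prefix_mono_eq) simp
  qed
  then show "\<exists>k. \<forall>y\<in>Cnr n s. pre k y = pre k X \<longrightarrow> pre m (H y) = pre m (H X)" by blast
qed

text \<open>The value of \<open>h\<close> at \<open>(w @ u) \<frown> x\<close> is computed through
  \<open>A\<close> and through the model. As states of \<open>A\<close> have trivial common prefix,
  \<open>gcp_strip\<close> cancels \<open>v\<close>, and up to a prefix \<open>H\<close> below
  \<open>W @ u\<close> is the map of a state of \<open>A\<close>.\<close>

lemma (in min_sync) modelled_residual:
  assumes rep: "represents n r A h" and "modelled n s r H h W"
  obtains w where "w \<in> Xnr_plus n r"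
    "\<And>u. u \<in> lists (Xn n) \<Longrightarrow> \<exists>a. \<forall>x\<in>Cn n. H ((W @ u) \<frown> x) = a \<frown> omega_out A x (run A (w @ u) (init A))"
proof -
  obtain V w v t where m: "W \<in> Xnr_plus n s" "V \<in> Xnr_plus n s" "w \<in> Xnr_plus n r" "v \<in> Xnr_plus n r"
    "\<And>x. x \<in> Cn n \<Longrightarrow> t x \<in> Cn n" "\<And>x. x \<in> Cn n \<Longrightarrow> H (W \<frown> x) = V \<frown> t x"
    "\<And>x. x \<in> Cn n \<Longrightarrow> h (w \<frown> x) = v \<frown> t x"
    using modelledE[OF assms(2)] by metis
  have "\<exists>a. \<forall>x\<in>Cn n. H ((W @ u) \<frown> x) = a \<frown> omega_out A x (run A (w @ u) (init A))"
    if u: "u \<in> lists (Xn n)" for u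
  proof -
    have wu: "w @ u \<in> Xnr_plus n r" using m(3) u by (rule Xnr_plus_append)
    have ux: "u \<frown> x \<in> Cn n" if "x \<in> Cn n" for x using u that by (simp add: Cn_conc)
    have eq: "outs A (w @ u) (init A) \<frown> omega_out A x (run A (w @ u) (init A)) = v \<frown> t (u \<frown> x)"
      if "x \<in> Cn n" for x
    proof -
      have "h ((w @ u) \<frown> x) = outs A (w @ u) (init A) \<frown> omega_out A x (run A (w @ u) (init A))"
        using rep omega_out_init[OF wu that] Cnr_concI[OF wu that] by (simp add: represents_def)
      moreover have "h ((w @ u) \<frown> x) = v \<frown> t (u \<frown> x)"
        using m(7)[OF ux[OF that]] by simp
      ultimately show ?thesis by simp
    qed
    obtain a where a: "\<And>x. x \<in> Cn n \<Longrightarrow> t (u \<frown> x) = a \<frown> omega_out A x (run A (w @ u) (init A))"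
      using gcp_strip[OF is_gcp_P[OF run_init[OF wu]] Cn_nonempty, of _ v "\<lambda>x. t (u \<frown> x)"] eq by metis
    have "\<forall>x\<in>Cn n. H ((W @ u) \<frown> x) = (V @ a) \<frown> omega_out A x (run A (w @ u) (init A))"
    proof
      fix x assume x: "x \<in> Cn n"
      show "H ((W @ u) \<frown> x) = (V @ a) \<frown> omega_out A x (run A (w @ u) (init A))"
        using m(6)[OF ux[OF x]] a[OF x] by simp
    qed
    then show ?thesis by blast
  qed
  with m(3) that show ?thesis by blast
qed

text \<open>A factor \<open>f\<close> with trivial common prefix forces \<open>a\<close> to be the
  greatest common prefix \<open>G W\<close>, so nothing else is left for the residual.\<close>

lemma (in cantor_embedding) res_eqI:
  assumes "W \<in> Xnr_plus n s" "is_gcp [] (f ` Cn n)" "\<And>x. x \<in> Cn n \<Longrightarrow> H (W \<frown> x) = a \<frown> f x" "x \<in> Cn n"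
  shows "res W x = f x"
proof -
  have W: "W \<noteq> []" using assms(1) by auto
  have "(\<lambda>x. H (W \<frown> x)) ` Cn n = (\<lambda>y. a \<frown> y) ` f ` Cn n"
    unfolding image_image using assms(3) by (rule image_cong[OF refl])
  then have "is_gcp a ((\<lambda>x. H (W \<frown> x)) ` Cn n)"
    using is_gcp_append[of "f ` Cn n" a "[]"] assms(2) Cn_nonempty by simp
  then have "G W = a" using gp_eqI W by (auto simp: G_def)
  then show ?thesis using assms(3,4) by (simp add: res_def)
qed

text \<open>By compactness every word of length at least \<open>N\<close> extends a modelled one, so
  its residual is the map of a state of \<open>A\<close>, and further letters move this state as in
  \<open>A\<close>.\<close>

lemma fin_sync_modelled:
  assumes A: "min_sync n r A k" "represents n r A h" "finite (states A)"
    and H: "cantor_embedding n s H" and model: "loc_modelled n s r H h"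
  shows "fin_sync n s H"
proof -
  interpret A: min_sync n r A k by fact
  interpret H: cantor_embedding n s H by fact
  obtain N where N: "\<And>X. X \<in> Cnr n s \<Longrightarrow> \<exists>k\<le>N. modelled n s r H h (pre k X)"
    using Cnr_uniform[of n s "modelled n s r H h"] model unfolding loc_modelled_def by blast
  define P where "P = states A - {init A}"
  have key: "\<exists>p\<in>P. \<forall>x\<in>Cn n. H.res (u @ v) x = omega_out A x (run A v p)"
    if u: "u \<in> Xnr_plus n s" "N \<le> length u" and v: "v \<in> lists (Xn n)" for u v
  proof -
    \<comment> \<open>Any point below \<open>u\<close> would do: its modelled prefix has length at
      most \<open>N\<close>, so it is a prefix of \<open>u\<close> itself.\<close>
    have "u \<frown> (\<lambda>_. Plain 0) \<in> Cnr n s"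
      using u A.n2 by (intro Cnr_concI) auto
    then obtain j where j: "j \<le> N" "modelled n s r H h (pre j (u \<frown> (\<lambda>_. Plain 0)))"
      using N by blast
    then have "modelled n s r H h (take j u)" using u(2) by simp
    then obtain w where w: "w \<in> Xnr_plus n r"
      "\<And>z. z \<in> lists (Xn n) \<Longrightarrow> \<exists>a. \<forall>x\<in>Cn n. H ((take j u @ z) \<frown> x) = a \<frown> omega_out A x (run A (w @ z) (init A))"
      using A.modelled_residual[OF A(2)] by metis
    have "take j u \<in> Xnr_plus n s" 
      using \<open>modelled n s r H h (take j u)\<close> by (auto simp: modelled_def)
    then have d: "drop j u \<in> lists (Xn n)"
      using u(1) by (cases u; cases j) (auto simp: Xnr_plus_iff dest: in_set_dropD)
    let ?z = "drop j u @ v"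
    have z: "?z \<in> lists (Xn n)" using d v by simp
    then obtain a where "\<forall>x\<in>Cn n. H ((take j u @ ?z) \<frown> x) = a \<frown> omega_out A x (run A (w @ ?z) (init A))"
      using w(2) by blast
    moreover have "take j u @ ?z = u @ v" by (simp flip: append_assoc)
    ultimately have a: "\<And>x. x \<in> Cn n \<Longrightarrow> H ((u @ v) \<frown> x) = a \<frown> omega_out A x (run A (w @ ?z) (init A))"
      by simp
    have run: "run A (w @ ?z) (init A) \<in> P" "run A (w @ drop j u) (init A) \<in> P"
      using A.run_init[OF Xnr_plus_append[OF w(1) z]] A.run_init[OF Xnr_plus_append[OF w(1) d]]
      by (simp_all add: P_def)
    have "H.res (u @ v) x = omega_out A x (run A (w @ ?z) (init A))" if "x \<in> Cn n" for x
    proof (rule H.res_eqI[OF _ _ a that])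
      show "u @ v \<in> Xnr_plus n s" using u(1) v by (rule Xnr_plus_append)
      show "is_gcp [] ((\<lambda>x. omega_out A x (run A (w @ ?z) (init A))) ` Cn n)"
        using run(1) unfolding P_def by (rule A.is_gcp_P)
    qed
    then have "\<forall>x\<in>Cn n. H.res (u @ v) x = omega_out A x (run A v (run A (w @ drop j u) (init A)))"
      by (simp add: run_append)
    with run(2) show ?thesis by blast
  qed
  show ?thesis
  proof (rule H.fin_syncI)
    let ?F = "\<lambda>W. restrict (H.res W) (Cn n)"
    \<comment> \<open>Words of length at most \<open>N\<close> are finitely many; all others
      contribute only maps of the finitely many states of \<open>A\<close>.\<close>
    have "?F ` Xnr_plus n s \<subseteq> ?F ` {W \<in> Xnr_plus n s. length W \<le> N}
        \<union> (\<lambda>p. restrict (\<lambda>x. omega_out A x p) (Cn n)) ` states A"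
    proof
      fix f assume "f \<in> ?F ` Xnr_plus n s"
      then obtain W where W: "W \<in> Xnr_plus n s" "f = ?F W" by blast
      show "f \<in> ?F ` {W \<in> Xnr_plus n s. length W \<le> N}
        \<union> (\<lambda>p. restrict (\<lambda>x. omega_out A x p) (Cn n)) ` states A"
      proof (cases "length W \<le> N")
        case False
        then obtain p where "p \<in> P" "\<forall>x\<in>Cn n. H.res W x = omega_out A x p"
          using key[OF W(1), of "[]"] by auto
        then have "f = restrict (\<lambda>x. omega_out A x p) (Cn n)" "p \<in> states A"
          by (auto simp: W(2) P_def)
        then show ?thesis by blast
      qed (use W in blast)
    qed
    moreover have "finite {W \<in> Xnr_plus n s. length W \<le> N}"
    proof (rule finite_subset)
      show "{W \<in> Xnr_plus n s. length W \<le> N} \<subseteq> {W. set W \<subseteq> dotted s \<union> Xn n \<and> length W \<le> N}"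
        by (auto simp: Xnr_plus_def)
      show "finite {W. set W \<subseteq> dotted s \<union> Xn n \<and> length W \<le> N}"
        by (rule finite_lists_length_le) (simp add: dotted_def Xn_def)
    qed
    ultimately show "finite (?F ` Xnr_plus n s)"
      using A(3) by (auto intro: finite_subset)
  next
    fix u u' v x
    assume u: "u \<in> Xnr_plus n s" "u' \<in> Xnr_plus n s" and v: "v \<in> lists (Xn n)" "N + k \<le> length v"
      and x: "x \<in> Cn n"
    \<comment> \<open>The level is \<open>N + k\<close>: the first \<open>N\<close> letters of
      \<open>v\<close> reach the modelled depth, and the remaining ones, at least \<open>k\<close>,
      synchronize \<open>A\<close>.\<close>
    have v12: "take N v \<in> lists (Xn n)" "drop N v \<in> lists (Xn n)" "k \<le> length (drop N v)"
      using v by (auto dest: in_set_takeD in_set_dropD)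
    obtain p where p: "p \<in> P" "\<forall>x\<in>Cn n. H.res ((u @ take N v) @ drop N v) x = omega_out A x (run A (drop N v) p)"
      using key[of "u @ take N v" "drop N v"] u v v12 by (auto intro: Xnr_plus_append)
    obtain q where q: "q \<in> P" "\<forall>x\<in>Cn n. H.res ((u' @ take N v) @ drop N v) x = omega_out A x (run A (drop N v) q)"
      using key[of "u' @ take N v" "drop N v"] u v v12 by (auto intro: Xnr_plus_append)
    have "run A (drop N v) p = run A (drop N v) q"
      using p q v12 unfolding P_def by (intro A.run_sync) auto
    then show "H.res (u @ v) x = H.res (u' @ v) x"
      using p(2) q(2) x by simp
  qed
qed

text \<open>Below \<open>W\<close> the map of a state \<open>p\<close> of \<open>A\<close> is that
  of a state \<open>q\<close> of \<open>B\<close> with a prefix \<open>c\<close> in front. Both have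
  trivial common prefix, so \<open>c\<close> is empty, and \<open>renaming_core\<close> applies to
  \<open>p\<close> and \<open>q\<close>. Both directions serve the two inclusions of
  \<open>Core_modelled\<close>.\<close>

lemma core_modelled:
  assumes A: "min_sync n r A k" "represents n r A h" and B: "min_sync n s B l" "represents n s B H"
    and W: "modelled n s r H h W"
  shows "renaming n (core n A k) (core n B l)" and "renaming n (core n B l) (core n A k)"
proof -
  interpret A: min_sync n r A k by fact
  interpret B: min_sync n s B l by fact
  interpret AB: min_sync_pair n r s A B k l ..
  interpret BA: min_sync_pair n s r B A l k ..
  obtain w where w: "w \<in> Xnr_plus n r"
    "\<And>u. u \<in> lists (Xn n) \<Longrightarrow> \<exists>a. \<forall>x\<in>Cn n. H ((W @ u) \<frown> x) = a \<frown> omega_out A x (run A (w @ u) (init A))"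
    using A.modelled_residual[OF A(2) W] by metis
  define p where "p = run A w (init A)"
  define q where "q = run B W (init B)"
  have W': "W \<in> Xnr_plus n s" using W by (simp add: modelled_def)
  have p: "p \<in> states A - {init A}" and q: "q \<in> states B - {init B}"
    unfolding p_def q_def using w(1) W' by (auto dest: A.run_init B.run_init)
  obtain a where a: "\<forall>x\<in>Cn n. H (W \<frown> x) = a \<frown> omega_out A x p"
    using w(2)[of "[]"] by (auto simp: p_def)
  have b: "H (W \<frown> x) = outs B W (init B) \<frown> omega_out B x q" if "x \<in> Cn n" for x
    using B(2) B.omega_out_init[OF W' that] Cnr_concI[OF W' that] by (simp add: represents_def q_def)
  have "outs B W (init B) \<frown> omega_out B x q = a \<frown> omega_out A x p" if "x \<in> Cn n" for x
    using a b that by metis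
  from gcp_strip[OF B.is_gcp_P[OF q] B.Cn_nonempty this] obtain c where
    c: "is_gcp c ((\<lambda>x. omega_out A x p) ` Cn n)" "\<And>x. x \<in> Cn n \<Longrightarrow> omega_out A x p = c \<frown> omega_out B x q"
    by metis
  have "c = []" using is_gcp_unique[OF c(1) A.is_gcp_P[OF p]] .
  then have eq: "omega_out A x p = omega_out B x q" if "x \<in> Cn n" for x
    using c(2)[OF that] by simp
  show "renaming n (core n A k) (core n B l)"
    by (rule AB.renaming_core[OF p q]) (simp add: AB.sim_def eq)
  show "renaming n (core n B l) (core n A k)"
    by (rule BA.renaming_core[OF q p]) (simp add: BA.sim_def eq)
qed

text \<open>\<open>Core\<close> ranges over all minimal transducers of a map. Each one is compared
  with a fixed transducer of the other map, and a single modelled cylinder is enough for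
  that.\<close>

lemma Core_modelled:
  assumes "n \<ge> 2" "r \<ge> 1" "s \<ge> 1" "fin_sync n r h" "fin_sync n s H" "loc_modelled n s r H h"
  shows "Core n r h = Core n s H"
proof -
  obtain A :: "nat nr_transducer" and k where A: "minimal n r A" "represents n r A h" "sync_at n r A k"
    using assms(4) by (auto simp: fin_sync_def)
  obtain B :: "nat nr_transducer" and l where B: "minimal n s B" "represents n s B H" "sync_at n s B l"
    using assms(5) by (auto simp: fin_sync_def)
  have "[Dotted 0] \<in> Xnr_plus n s" using assms(3) by (simp add: Xnr_plus_iff dotted_def)
  then have "[Dotted 0] \<frown> (\<lambda>_. Plain 0) \<in> Cnr n s" using assms(1) by (intro Cnr_concI) auto
  then obtain W where W: "modelled n s r H h W"
    using assms(6) unfolding loc_modelled_def by blast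
  have ms: "min_sync n r' C j" if "minimal n r' C" "sync_at n r' C j" "r' \<ge> 1"
    for r' j and C :: "nat nr_transducer"
    using that assms(1) by (simp add: min_sync_def)
  show ?thesis
  proof (intro set_eqI iffI)
    fix T assume "T \<in> Core n r h"
    then obtain A' :: "nat nr_transducer" and k' where A': "minimal n r A'" "represents n r A' h"
      "sync_at n r A' k'" "renaming n T (core n A' k')"
      by (auto simp: Core_def)
    have "renaming n (core n A' k') (core n B l)"
      using core_modelled(1)[OF ms[OF A'(1,3)] A'(2) ms[OF B(1,3)] B(2) W] assms by simp
    then show "T \<in> Core n s H"
      using A'(4) B renaming_trans unfolding Core_def by blast
  next
    fix T assume "T \<in> Core n s H"
    then obtain B' :: "nat nr_transducer" and l' where B': "minimal n s B'" "represents n s B' H"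
      "sync_at n s B' l'" "renaming n T (core n B' l')"
      by (auto simp: Core_def)
    have "renaming n (core n B' l') (core n A k)"
      using core_modelled(2)[OF ms[OF A(1,3)] A(2) ms[OF B'(1,3)] B'(2) W] assms by simp
    then show "T \<in> Core n r h"
      using B'(4) A renaming_trans unfolding Core_def by blast
  qed
qed

lemma B_nr_modelled:
  assumes "n \<ge> 2" "r \<ge> 1" "s \<ge> 1"
    and hg: "homeomorphic_maps (Cnr_top n r) (Cnr_top n r) h g" "fin_sync n r h" "fin_sync n r g"
    and model: "loc_modelled n s r H h" "loc_modelled n s r E g"
    and inv: "\<And>x. x \<in> Cnr n s \<Longrightarrow> E (H x) = x" "\<And>x. x \<in> Cnr n s \<Longrightarrow> H (E x) = x"
  shows "H \<in> B_nr n s" and "Core n r h = Core n s H"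
proof -
  have maps: "\<And>x. x \<in> Cnr n s \<Longrightarrow> H x \<in> Cnr n s" "\<And>x. x \<in> Cnr n s \<Longrightarrow> E x \<in> Cnr n s"
    using loc_modelled_maps model by blast+
  have "word_cont n r h" "word_cont n r g"
    using hg(1) by (auto simp: homeomorphic_maps_def continuous_map_Cnr)
  then have cont: "word_cont n s H" "word_cont n s E"
    using word_cont_modelled model by blast+
  have "inj_on H (Cnr n s)" "inj_on E (Cnr n s)"
    using inv by (metis inj_on_inverseI)+
  then have emb: "cantor_embedding n s H" "cantor_embedding n s E"
    using assms(1,3) maps cont by (simp_all add: cantor_embedding_def)
  have fs: "fin_sync n s F" if "fin_sync n r f" "loc_modelled n s r F f" "cantor_embedding n s F" for f F
  proof -
    obtain A :: "nat nr_transducer" and k where A: "minimal n r A" "represents n r A f"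
      "finite (states A)" "sync_at n r A k"
      using \<open>fin_sync n r f\<close> by (auto simp: fin_sync_def)
    then have "min_sync n r A k" using assms by (simp add: min_sync_def)
    then show ?thesis using fin_sync_modelled A that by blast
  qed
  have "fin_sync n s H" "fin_sync n s E" using fs hg model emb by blast+
  moreover have "homeomorphic_maps (Cnr_top n s) (Cnr_top n s) H E"
    using maps cont inv by (simp add: homeomorphic_maps_def continuous_map_Cnr)
  ultimately show "H \<in> B_nr n s" by (auto simp: B_nr_def)
  show "Core n r h = Core n s H"
    using Core_modelled assms \<open>fin_sync n s H\<close> by blast
qed


section \<open>The relation \<open>\<simeq>\<close> and the lexicographic order\<close>

text \<open>Forgetting the dot is harmless for comparisons: two points of such Cantor spaces have
  letters of the same kind at every position.\<close>

primrec lval :: "letter \<Rightarrow> nat" where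
  "lval (Dotted a) = a"
| "lval (Plain i) = i"

definition lexless :: "(nat \<Rightarrow> letter) \<Rightarrow> (nat \<Rightarrow> letter) \<Rightarrow> bool"
  where "lexless x y \<longleftrightarrow> (\<exists>k. (\<forall>i<k. x i = y i) \<and> lval (x k) < lval (y k))"

text \<open>\<open>x\<close> is the immediate successor of \<open>y\<close> in the lexicographic order.\<close>

definition adj :: "nat \<Rightarrow> (nat \<Rightarrow> letter) \<Rightarrow> (nat \<Rightarrow> letter) \<Rightarrow> bool"
  where "adj n y x \<longleftrightarrow> (\<exists>k. (\<forall>i<k. y i = x i) \<and> lval (x k) = Suc (lval (y k)) \<and>
    (\<forall>i>k. x i = Plain 0 \<and> y i = Plain (n - 1)))"

definition min_pt :: "nat \<Rightarrow> letter"
  where "min_pt = [Dotted 0] \<frown> (\<lambda>_. Plain 0)"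

definition max_pt :: "nat \<Rightarrow> nat \<Rightarrow> nat \<Rightarrow> letter"
  where "max_pt n r = [Dotted (r - 1)] \<frown> (\<lambda>_. Plain (n - 1))"

lemma min_pt_nth: "min_pt i = (if i = 0 then Dotted 0 else Plain 0)"
  by (simp add: min_pt_def conc_def)

lemma max_pt_nth: "max_pt n r i = (if i = 0 then Dotted (r - 1) else Plain (n - 1))"
  by (simp add: max_pt_def conc_def)

lemma Cnr_nth:
  "x \<in> Cnr n r \<longleftrightarrow> (\<exists>a<r. x 0 = Dotted a) \<and> (\<forall>k>0. \<exists>i<n. x k = Plain i)"
proof -
  have "(\<forall>k>0. \<exists>i<n. x k = Plain i) \<longleftrightarrow> (\<forall>k. \<exists>i<n. x (Suc k) = Plain i)"
    by (metis gr0_conv_Suc)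
  moreover have "a \<in> dotted r \<longleftrightarrow> (\<exists>b<r. a = Dotted b)" "a \<in> Xn n \<longleftrightarrow> (\<exists>i<n. a = Plain i)" for a
    by (auto simp: dotted_def Xn_def)
  ultimately show ?thesis by (simp add: Cnr_iff)
qed

lemma lval_inj: "x \<in> Cnr n r \<Longrightarrow> y \<in> Cnr n r' \<Longrightarrow> lval (x k) = lval (y k) \<longleftrightarrow> x k = y k"
proof -
  assume "x \<in> Cnr n r" "y \<in> Cnr n r'"
  then have "(\<exists>a b. x k = Dotted a \<and> y k = Dotted b) \<or> (\<exists>i j. x k = Plain i \<and> y k = Plain j)"
    unfolding Cnr_nth by (cases "k = 0") blast+
  then show ?thesis by auto
qed

lemma lval_le: "x \<in> Cnr n r \<Longrightarrow> 0 < k \<Longrightarrow> lval (x k) \<le> n - 1"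
proof -
  assume "x \<in> Cnr n r" "0 < k"
  then obtain i where "i < n" "x k = Plain i" unfolding Cnr_nth by blast
  then show ?thesis by simp
qed

lemma min_pt_in: "n \<ge> 2 \<Longrightarrow> r \<ge> 1 \<Longrightarrow> min_pt \<in> Cnr n r"
  by (auto simp: Cnr_nth min_pt_nth)

lemma max_pt_in: "n \<ge> 2 \<Longrightarrow> r \<ge> 1 \<Longrightarrow> max_pt n r \<in> Cnr n r"
  by (auto simp: Cnr_nth max_pt_nth)

lemma first_difference:
  fixes x y :: "'a word"
  assumes "x \<noteq> y" obtains k where "\<forall>i<k. x i = y i" "x k \<noteq> y k"
proof -
  have "\<exists>k. x k \<noteq> y k" using assms by blast
  then show ?thesis using that exists_least_iff[of "\<lambda>k. x k \<noteq> y k"] by blast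
qed

lemma gluedE:
  assumes "glued n r x y"
  obtains (1) w i where "0 < i" "x = w \<frown> [Plain i] \<frown> (\<lambda>_. Plain 0)"
      "y = w \<frown> [Plain (i - 1)] \<frown> (\<lambda>_. Plain (n - 1))"
    | (2) a where "0 < a" "x = [Dotted a] \<frown> (\<lambda>_. Plain 0)" "y = [Dotted (a - 1)] \<frown> (\<lambda>_. Plain (n - 1))"
    | (3) "x = min_pt" "y = max_pt n r"
  using assms unfolding glued_def min_pt_def max_pt_def by blast

text \<open>The first two cases of \<open>glued\<close> are adjacency with the first difference at a
  plain letter and at the dotted letter, respectively; the third case joins the two extreme
  points.\<close>

lemma glued_iff:
  assumes "n \<ge> 2" "r \<ge> 1" "x \<in> Cnr n r" "y \<in> Cnr n r"
  shows "glued n r x y \<longleftrightarrow> adj n y x \<or> x = min_pt \<and> y = max_pt n r"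
proof
  assume "glued n r x y"
  then show "adj n y x \<or> x = min_pt \<and> y = max_pt n r"
  proof (cases rule: gluedE)
    case (1 w i)
    then have "adj n y x"
      unfolding adj_def by (intro exI[of _ "length w"]) (auto simp: conc_def nth_append)
    then show ?thesis ..
  next
    case (2 a)
    then have "adj n y x"
      unfolding adj_def by (intro exI[of _ 0]) (auto simp: conc_def)
    then show ?thesis ..
  qed simp
next
  assume "adj n y x \<or> x = min_pt \<and> y = max_pt n r"
  then show "glued n r x y"
  proof
    assume "adj n y x"
    then obtain k where k: "\<forall>i<k. y i = x i" "lval (x k) = Suc (lval (y k))"
      "\<forall>i>k. x i = Plain 0 \<and> y i = Plain (n - 1)"
      by (auto simp: adj_def)
    have form: "x = pre k x \<frown> [x k] \<frown> (\<lambda>_. Plain 0)" "y = pre k x \<frown> [y k] \<frown> (\<lambda>_. Plain (n - 1))"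
    proof (safe intro!: ext)
      fix i
      consider "i < k" | "i = k" | "i > k" by linarith
      then show "x i = (pre k x \<frown> [x k] \<frown> (\<lambda>_. Plain 0)) i"
        "y i = (pre k x \<frown> [y k] \<frown> (\<lambda>_. Plain (n - 1))) i"
        by (cases; use k(1,3) in \<open>simp add: conc_def nth_append\<close>)+
    qed
    show ?thesis
    proof (cases "k = 0")
      case True
      then obtain a b where "a < r" "x k = Dotted a" "y k = Dotted b"
        using assms by (auto simp: Cnr_nth)
      then show ?thesis
        using k(2) form True unfolding glued_def by auto
    next
      case False
      then obtain i j where "i < n" "x k = Plain i" "y k = Plain j"
        using assms(3,4) unfolding Cnr_nth by blast
      moreover have "pre k x \<in> Xnr_plus n r" using Cnr_prefix assms False by blast
      ultimately show ?thesis
        using k(2) form unfolding glued_def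
        by (intro disjI1 exI[of _ "pre k x"] exI[of _ i]) auto
    qed
  qed (simp add: glued_def min_pt_def max_pt_def)
qed

lemma glued_tails:
  assumes "glued n r x y"
  shows "\<exists>k. \<forall>i>k. x i = Plain 0 \<and> y i = Plain (n - 1)"
proof -
  from assms show ?thesis
  proof (cases rule: gluedE)
    case (1 w i)
    then show ?thesis by (intro exI[of _ "length w"]) (auto simp: conc_def nth_append)
  qed (auto simp: conc_def min_pt_nth max_pt_nth intro!: exI[of _ 0])
qed

lemma glued_tails_disjoint:
  fixes x y :: "letter word"
  assumes "n \<ge> 2" "\<exists>k. \<forall>i>k. x i = Plain 0 \<and> y i = Plain (n - 1)"
  shows "\<not> (\<exists>k. \<forall>i>k. x i = Plain (n - 1))" "\<not> (\<exists>k. \<forall>i>k. y i = Plain 0)"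
proof -
  obtain k where k: "\<And>i. i > k \<Longrightarrow> x i = Plain 0 \<and> y i = Plain (n - 1)" using assms by blast
  show "\<not> (\<exists>k. \<forall>i>k. x i = Plain (n - 1))"
  proof
    assume "\<exists>k. \<forall>i>k. x i = Plain (n - 1)"
    then obtain l where "\<And>i. i > l \<Longrightarrow> x i = Plain (n - 1)" by blast
    from k[of "Suc (k + l)"] this[of "Suc (k + l)"] show False using assms(1) by simp
  qed
  show "\<not> (\<exists>k. \<forall>i>k. y i = Plain 0)"
  proof
    assume "\<exists>k. \<forall>i>k. y i = Plain 0"
    then obtain l where "\<And>i. i > l \<Longrightarrow> y i = Plain 0" by blast
    from k[of "Suc (k + l)"] this[of "Suc (k + l)"] show False using assms(1) by simp
  qed
qed

text \<open>The tails give a glued pair its direction: the first point ends in letters 0 and the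
  second in letters \<open>n - 1\<close>, which differ.\<close>

lemma glued_asym:
  assumes "n \<ge> 2" "glued n r x y"
  shows "\<not> glued n r y x" "x \<noteq> y" "y \<noteq> min_pt" "x \<noteq> max_pt n r"
proof -
  note t = glued_tails_disjoint[OF assms(1) glued_tails[OF assms(2)]]
  show "\<not> glued n r y x" using t glued_tails[of n r y x] by blast
  show "x \<noteq> y" using t glued_tails[OF assms(2)] by blast
  have "\<exists>k. \<forall>i>k. min_pt i = Plain 0" "\<exists>k. \<forall>i>k. max_pt n r i = Plain (n - 1)"
    by (auto simp: min_pt_nth max_pt_nth)
  with t show "y \<noteq> min_pt" "x \<noteq> max_pt n r" by metis+
qed

section \<open>Adjacency in the lexicographic order\<close>

lemma adj_min_pt: "\<not> adj n y min_pt"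
  by (auto simp: adj_def min_pt_nth split: if_splits)

lemma adj_lexless: "adj n y x \<Longrightarrow> lexless y x"
  unfolding adj_def lexless_def by auto

lemma lexless_irrefl: "\<not> lexless x x"
  by (simp add: lexless_def)

lemma lexless_trans:
  assumes "lexless x y" "lexless y z" shows "lexless x z"
proof -
  obtain k where k: "\<forall>i<k. x i = y i" "lval (x k) < lval (y k)" using assms by (auto simp: lexless_def)
  obtain l where l: "\<forall>i<l. y i = z i" "lval (y l) < lval (z l)" using assms by (auto simp: lexless_def)
  consider "k < l" | "k = l" | "l < k" by linarith
  then show ?thesis
  proof cases
    case 1
    then show ?thesis unfolding lexless_def using k l by (intro exI[of _ k]) simp
  next
    case 2
    then show ?thesis unfolding lexless_def using k l by (intro exI[of _ k]) simp
  next
    case 3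
    then show ?thesis unfolding lexless_def using k l by (intro exI[of _ l]) simp
  qed
qed

lemma lexless_at:
  assumes "\<forall>i<k. x i = y i" "x k \<noteq> y k"
  shows "lexless x y \<longleftrightarrow> lval (x k) < lval (y k)"
proof
  assume "lexless x y"
  then obtain j where j: "\<forall>i<j. x i = y i" "lval (x j) < lval (y j)" by (auto simp: lexless_def)
  consider "j < k" | "j = k" | "k < j" by linarith
  then show "lval (x k) < lval (y k)" by cases (use assms j in auto)
qed (use assms in \<open>auto simp: lexless_def\<close>)

lemma adj_no_between:
  assumes "adj n y x" "lexless y p" "x \<noteq> p" "x \<in> Cnr n r" "p \<in> Cnr n r"
  shows "lexless x p"
proof -
  obtain k where k: "\<forall>i<k. y i = x i" "lval (x k) = Suc (lval (y k))"
      "\<forall>i>k. x i = Plain 0 \<and> y i = Plain (n - 1)"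
    using assms(1) by (auto simp: adj_def)
  obtain j where j: "\<forall>i<j. y i = p i" "lval (y j) < lval (p j)"
    using assms(2) by (auto simp: lexless_def)
  obtain d where d: "\<forall>i<d. x i = p i" "x d \<noteq> p d"
    using first_difference[OF assms(3)] .
  have d': "lval (x d) \<noteq> lval (p d)" using lval_inj[OF assms(4,5)] d(2) by simp
  \<comment> \<open>After position \<open>k\<close> the letters of \<open>y\<close> are maximal, so
    \<open>p\<close> cannot first exceed \<open>y\<close> there.\<close>
  have "j \<le> k"
  proof (rule ccontr)
    assume "\<not> j \<le> k"
    then have "lval (p j) \<le> lval (y j)" using k(3) lval_le[OF assms(5), of j] by simp
    then show False using j by simp
  qed
  then consider "j < k" | "j = k" by linarith
  then have "lval (x d) < lval (p d)"
  proof cases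
    case 1
    have "x j = y j" using k(1) 1 by metis
    then have *: "lval (x j) < lval (p j)" using j(2) by simp
    moreover have "\<forall>i<j. x i = p i" using k(1) j(1) 1 by (metis order.strict_trans)
    ultimately have "d = j" using d by (metis linorder_neqE_nat nat_neq_iff)
    then show ?thesis using * by simp
  next
    case 2
    then have "\<forall>i<k. x i = p i" using k(1) j(1) by metis
    moreover have "lval (x k) \<le> lval (p k)" using k(2) j(2) 2 by simp
    ultimately have eq: "\<forall>i<k. x i = p i" "lval (x k) \<le> lval (p k)" by blast+
    then have "k \<le> d" using d(2) by (metis not_le)
    then show ?thesis using eq(2) k(3) d' by (cases "d = k") auto
  qed
  then show ?thesis using d by (auto simp: lexless_def)
qed

text \<open>The position of the change can be read off \<open>x\<close>: it is the last one whose
  letter has nonzero value.\<close>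

lemma adj_unique:
  assumes "adj n y x" "adj n z x" "y \<in> Cnr n r" "z \<in> Cnr n r"
  shows "y = z"
proof -
  obtain k where k: "\<forall>i<k. y i = x i" "lval (x k) = Suc (lval (y k))"
      "\<forall>i>k. x i = Plain 0 \<and> y i = Plain (n - 1)"
    using assms(1) by (auto simp: adj_def)
  obtain l where l: "\<forall>i<l. z i = x i" "lval (x l) = Suc (lval (z l))"
      "\<forall>i>l. x i = Plain 0 \<and> z i = Plain (n - 1)"
    using assms(2) by (auto simp: adj_def)
  have "k = l"
    using k(2,3) l(2,3) by (metis lval.simps(2) linorder_neqE_nat nat.distinct(1))
  moreover have "y k = z k"
    using k(2) l(2) \<open>k = l\<close> lval_inj[OF assms(3,4), of k] by simp
  ultimately have "y i = z i" for i
    using k(1,3) l(1,3) by (cases "i < k"; cases "i = k") auto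
  then show ?thesis by blast
qed

lemma not_lexless_min_pt: "\<not> lexless x min_pt"
  by (auto simp: lexless_def min_pt_nth split: if_splits)

lemma not_lexless_max_pt:
  assumes "x \<in> Cnr n r" shows "\<not> lexless (max_pt n r) x"
proof -
  have "lval (x k) \<le> lval (max_pt n r k)" for k
    using assms lval_le[OF assms, of k] by (cases "k = 0") (auto simp: Cnr_nth max_pt_nth)
  then show ?thesis by (auto simp: lexless_def not_less)
qed

lemma lexless_min_pt:
  assumes "x \<in> Cnr n r" "x \<noteq> min_pt" "n \<ge> 2" "r \<ge> 1"
  shows "lexless min_pt x"
proof -
  obtain k where k: "\<forall>i<k. min_pt i = x i" "min_pt k \<noteq> x k"
    using first_difference[of min_pt x] assms(2) by metis
  have "lval (min_pt k) \<noteq> lval (x k)" using lval_inj[OF min_pt_in[OF assms(3,4)] assms(1)] k by simp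
  then have "lval (min_pt k) < lval (x k)" by (auto simp: min_pt_nth split: if_splits)
  then show ?thesis using k by (auto simp: lexless_def)
qed

text \<open>Comparison with \<open>P\<close> can fail to be locally constant only at
  \<open>P\<close> itself. There the gluing helps: \<open>P\<close> is the least point or ends in
  zeros, so no point sharing a long prefix with \<open>P\<close> lies below it.\<close>

lemma loc_const_lexless:
  assumes "n \<ge> 2" "r \<ge> 1" "P \<in> Cnr n r" "Q \<in> Cnr n r" "glued n r P Q"
  shows "loc_const n r (\<lambda>x. lexless x P)"
  unfolding loc_const_def
proof
  fix x
  show "\<exists>k. \<forall>y\<in>Cnr n r. pre k y = pre k x \<longrightarrow> lexless y P = lexless x P"
  proof (cases "x = P")
    case False
    then obtain k where k: "\<forall>i<k. x i = P i" "x k \<noteq> P k" by (rule first_difference)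
    have "lexless y P = lexless x P" if "pre (Suc k) y = pre (Suc k) x" for y
    proof -
      have y: "\<And>i. i < Suc k \<Longrightarrow> y i = x i" using that unfolding prefix_eq_iff by blast
      then have "\<forall>i<k. y i = P i" "y k \<noteq> P k" using k by auto
      from lexless_at[OF this] lexless_at[OF k] y show ?thesis by simp
    qed
    then show ?thesis by blast
  next
    case True
    consider "P = min_pt" | "adj n Q P" using assms glued_iff by blast
    then show ?thesis
    proof cases
      case 1
      then show ?thesis using not_lexless_min_pt by blast
    next
      case 2
      then obtain k where k: "\<forall>i>k. P i = Plain 0" by (auto simp: adj_def)
      have "\<not> lexless y P" if "pre (Suc k) y = pre (Suc k) x" for y
      proof
        assume "lexless y P"
        then obtain j where j: "lval (y j) < lval (P j)" by (auto simp: lexless_def)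
        show False
        proof (cases "j \<le> k")
          case True
          then have "y j = x j" using that unfolding prefix_eq_iff by auto
          then show False using j \<open>x = P\<close> by simp
        next
          case False
          then show False using j k by simp
        qed
      qed
      then show ?thesis using True lexless_irrefl by blast
    qed
  qed
qed

lemma simeq_iff:
  assumes "n \<ge> 2" "r \<ge> 1" "x \<in> Cnr n r" "y \<in> Cnr n r"
  shows "simeq n r x y \<longleftrightarrow> x = y \<or> (adj n y x \<or> x = min_pt \<and> y = max_pt n r)
    \<or> (adj n x y \<or> y = min_pt \<and> x = max_pt n r)"
  using glued_iff[OF assms] glued_iff[OF assms(1,2,4,3)] by (simp add: simeq_def)

section \<open>Adjacency and initial letters\<close>

lemma adj_conc: "adj n (w \<frown> y) (w \<frown> x) \<longleftrightarrow> adj n y x"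
proof
  assume "adj n (w \<frown> y) (w \<frown> x)"
  then obtain k where k: "\<And>i. i < k \<Longrightarrow> (w \<frown> y) i = (w \<frown> x) i"
      "lval ((w \<frown> x) k) = Suc (lval ((w \<frown> y) k))"
      "\<And>i. i > k \<Longrightarrow> (w \<frown> x) i = Plain 0 \<and> (w \<frown> y) i = Plain (n - 1)"
    unfolding adj_def by blast
  have "\<not> k < length w" using k(2) by auto
  then have "y i = x i" if "i < k - length w" for i
    using k(1)[of "length w + i"] that by simp
  moreover have "x i = Plain 0 \<and> y i = Plain (n - 1)" if "i > k - length w" for i
    using k(3)[of "length w + i"] that by simp
  moreover have "lval (x (k - length w)) = Suc (lval (y (k - length w)))"
    using k(2) \<open>\<not> k < length w\<close> by simp
  ultimately show "adj n y x" unfolding adj_def by blast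
next
  assume "adj n y x"
  then obtain k where k: "\<And>i. i < k \<Longrightarrow> y i = x i" "lval (x k) = Suc (lval (y k))"
      "\<And>i. i > k \<Longrightarrow> x i = Plain 0 \<and> y i = Plain (n - 1)"
    unfolding adj_def by blast
  then show "adj n (w \<frown> y) (w \<frown> x)"
    unfolding adj_def by (intro exI[of _ "length w + k"]) (simp add: conc_def)
qed

lemma head_tail: "x = [x 0] \<frown> suf 1 x"
  by (simp add: build_cons)

lemma adj_tail:
  assumes "x 0 = y 0"
  shows "adj n y x \<longleftrightarrow> adj n (suf 1 y) (suf 1 x)"
proof -
  have "adj n y x \<longleftrightarrow> adj n ([x 0] \<frown> suf 1 y) ([x 0] \<frown> suf 1 x)"
    using head_tail[of x] head_tail[of y] assms by metis
  then show ?thesis by (simp only: adj_conc)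
qed

lemma not_adj_min_pt: "n \<ge> 2 \<Longrightarrow> \<not> adj n min_pt x"
  by (force simp: adj_def min_pt_nth)

lemma adj_head:
  assumes "x 0 \<noteq> y 0" "n \<ge> 2"
  shows "adj n y x \<longleftrightarrow> lval (x 0) = Suc (lval (y 0)) \<and> (\<forall>i>0. x i = Plain 0 \<and> y i = Plain (n - 1))"
proof
  assume "adj n y x"
  then obtain k where k: "\<forall>i<k. y i = x i" "lval (x k) = Suc (lval (y k))"
      "\<forall>i>k. x i = Plain 0 \<and> y i = Plain (n - 1)"
    unfolding adj_def by blast
  then have "k = 0" using assms(1) by (metis gr0I)
  then show "lval (x 0) = Suc (lval (y 0)) \<and> (\<forall>i>0. x i = Plain 0 \<and> y i = Plain (n - 1))"
    using k by simp
qed (auto simp: adj_def)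

lemma eq_min_pt: "x = min_pt \<longleftrightarrow> x 0 = Dotted 0 \<and> (\<forall>i>0. x i = Plain 0)"
  unfolding fun_eq_iff min_pt_nth by (metis neq0_conv)

lemma eq_max_pt: "x = max_pt n r \<longleftrightarrow> x 0 = Dotted (r - 1) \<and> (\<forall>i>0. x i = Plain (n - 1))"
  unfolding fun_eq_iff max_pt_nth by (metis neq0_conv)


section \<open>Lifting to covers of the circle\<close>

text \<open>
  For \<open>x \<simeq> y\<close>, \<open>wrap n r x y\<close> counts with sign how often the passage from \<open>y\<close> to \<open>x\<close> crosses the
  base point of the circle.
\<close>

definition wrap :: "nat \<Rightarrow> nat \<Rightarrow> (nat \<Rightarrow> letter) \<Rightarrow> (nat \<Rightarrow> letter) \<Rightarrow> int"
  where "wrap n r x y = (if x = min_pt \<and> y = max_pt n r then 1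
    else if x = max_pt n r \<and> y = min_pt then - 1 else 0)"

lemma min_pt_neq_max_pt: "n \<ge> 2 \<Longrightarrow> min_pt \<noteq> max_pt n r"
  by (auto simp: fun_eq_iff min_pt_nth max_pt_nth intro!: exI[of _ 1])

lemma wrap_swap: "n \<ge> 2 \<Longrightarrow> wrap n r y x = - wrap n r x y"
  using min_pt_neq_max_pt[of n r] by (auto simp: wrap_def)

lemma wrap_self: "n \<ge> 2 \<Longrightarrow> wrap n r x x = 0"
  using min_pt_neq_max_pt[of n r] by (auto simp: wrap_def)

text \<open>Cutting the circle at \<open>P\<close> instead of the base point changes the crossing
  count by the coboundary of the indicator of the points not below \<open>P\<close>. The indicator
  jumps to 1 between \<open>Q\<close> and \<open>P\<close> and falls back at the base point, where
  \<open>wrap\<close> compensates; if \<open>P\<close> is \<open>min_pt\<close>, it is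
  constant.\<close>

lemma wrap_coboundary:
  assumes "n \<ge> 2" "r \<ge> 1" and P: "P \<in> Cnr n r" "Q \<in> Cnr n r" "glued n r P Q"
    and x: "x \<in> Cnr n r" "y \<in> Cnr n r" "glued n r x y"
  shows "(if x = P \<and> y = Q then 1 else 0) =
    wrap n r x y + (if lexless x P then 0 else 1) - (if lexless y P then 0 else 1)"
proof -
  have PQ: "adj n Q P \<or> P = min_pt \<and> Q = max_pt n r"
    using glued_iff[of n r P Q] assms by blast
  have xy: "adj n y x \<or> x = min_pt \<and> y = max_pt n r"
    using glued_iff[of n r x y] assms by blast
  have w: "wrap n r x y = (if x = min_pt \<and> y = max_pt n r then 1 else 0)"
    using glued_asym[OF assms(1) x(3)] by (auto simp: wrap_def)
  show ?thesis
  proof (cases "x = P \<and> y = Q")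
    case True
    have "adj n Q P \<Longrightarrow> P \<noteq> min_pt" using adj_min_pt by blast
    then show ?thesis
      using PQ True w lexless_irrefl adj_lexless not_lexless_min_pt by auto
  next
    case False
    from xy show ?thesis
    proof
      assume a: "adj n y x"
      have "x \<noteq> P"
        using False PQ a adj_unique[OF a _ x(2) P(2)] adj_min_pt by blast
      then have "lexless x P = lexless y P"
        using adj_no_between[OF a _ _ x(1) P(1)] lexless_trans[OF adj_lexless[OF a]] by blast
      moreover have "x \<noteq> min_pt" using a adj_min_pt by blast
      ultimately show ?thesis using False w by auto
    next
      assume m: "x = min_pt \<and> y = max_pt n r"
      then have "P \<noteq> min_pt" using False PQ adj_min_pt by blast
      then show ?thesis
        using m w False lexless_min_pt[OF P(1)] not_lexless_max_pt[OF P(1)] assms by auto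
    qed
  qed
qed

text \<open>
  Cutting the circle at the preimage of its base point gives a lift of \<open>h\<close>; the sign is
  determined by the order of the two points over that preimage, so that no monotonicity of \<open>h\<close>
  is needed.
\<close>

lemma exists_wrap_lift:
  assumes n: "n \<ge> 2" "r \<ge> 1"
    and h: "\<And>x. x \<in> Cnr n r \<Longrightarrow> h x \<in> Cnr n r" and g: "\<And>x. x \<in> Cnr n r \<Longrightarrow> g x \<in> Cnr n r"
    and inv: "\<And>x. x \<in> Cnr n r \<Longrightarrow> g (h x) = x" "\<And>x. x \<in> Cnr n r \<Longrightarrow> h (g x) = x"
    and simeq: "\<And>x y. x \<in> Cnr n r \<Longrightarrow> y \<in> Cnr n r \<Longrightarrow> simeq n r (h x) (h y) \<longleftrightarrow> simeq n r x y"
  obtains e :: int and c where "e = 1 \<or> e = - 1" "loc_const n r c"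
    "\<And>x y. x \<in> Cnr n r \<Longrightarrow> y \<in> Cnr n r \<Longrightarrow> simeq n r x y \<Longrightarrow>
       wrap n r (h x) (h y) = e * wrap n r x y + c x - c y"
proof -
  define P where "P = g min_pt"
  define Q where "Q = g (max_pt n r)"
  note mm = min_pt_in[OF n] max_pt_in[OF n]
  have PQ: "P \<in> Cnr n r" "Q \<in> Cnr n r" unfolding P_def Q_def using g mm by auto
  have hPQ: "h P = min_pt" "h Q = max_pt n r" unfolding P_def Q_def using inv mm by auto
  have "P \<noteq> Q" using hPQ min_pt_neq_max_pt[OF n(1), of r] by metis
  moreover have "simeq n r P Q"
    using simeq[OF PQ] hPQ glued_iff[OF n mm] by (simp add: simeq_def)
  ultimately consider (pos) "glued n r P Q" | (neg) "glued n r Q P"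
    by (auto simp: simeq_def)
  then obtain e :: int and c where ec: "e = 1 \<or> e = - 1" "loc_const n r c"
    "\<And>x y. x \<in> Cnr n r \<Longrightarrow> y \<in> Cnr n r \<Longrightarrow> glued n r x y \<Longrightarrow>
       wrap n r (h x) (h y) = e * wrap n r x y + c x - c y"
  proof cases
    have hx: "h x = min_pt \<longleftrightarrow> x = P" "h x = max_pt n r \<longleftrightarrow> x = Q" if "x \<in> Cnr n r" for x
      using inv hPQ that P_def Q_def by metis+
    { case pos
      define c :: "(nat \<Rightarrow> letter) \<Rightarrow> int" where "c x = (if lexless x P then 0 else 1)" for x
      have lc: "loc_const n r c"
        using loc_const_lexless[OF n PQ pos] unfolding loc_const_def c_def by metis
      have "wrap n r (h x) (h y) = 1 * wrap n r x y + c x - c y"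
        if x: "x \<in> Cnr n r" "y \<in> Cnr n r" "glued n r x y" for x y
      proof -
        have "\<not> (x = Q \<and> y = P)" using glued_asym(1)[OF n(1) pos] x by blast
        then have "wrap n r (h x) (h y) = (if x = P \<and> y = Q then 1 else 0)"
          using hx x \<open>P \<noteq> Q\<close> by (auto simp: wrap_def)
        then show ?thesis
          using wrap_coboundary[OF n PQ pos x] by (simp add: c_def)
      qed
      then show ?thesis using that[of 1 c] lc by simp
    next
      case neg
      \<comment> \<open>Orientation is reversed here: the coboundary identity for the pair
        \<open>Q\<close>, \<open>P\<close> enters with a minus sign, which gives both
        \<open>e = - 1\<close> and the negated indicator.\<close>
      define c :: "(nat \<Rightarrow> letter) \<Rightarrow> int" where "c x = (if lexless x Q then 0 else - 1)" for x
      have lc: "loc_const n r c"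
        using loc_const_lexless[OF n PQ(2,1) neg] unfolding loc_const_def c_def by metis
      have "wrap n r (h x) (h y) = (- 1) * wrap n r x y + c x - c y"
        if x: "x \<in> Cnr n r" "y \<in> Cnr n r" "glued n r x y" for x y
      proof -
        have "\<not> (x = P \<and> y = Q)" using glued_asym(1)[OF n(1) neg] x by blast
        then have "wrap n r (h x) (h y) = - (if x = Q \<and> y = P then 1 else 0)"
          using hx x \<open>P \<noteq> Q\<close> by (auto simp: wrap_def)
        then show ?thesis
          using wrap_coboundary[OF n PQ(2,1) neg x] by (simp add: c_def split: if_splits)
      qed
      then show ?thesis using that[of "- 1" c] lc by simp }
  qed
  have "wrap n r (h x) (h y) = e * wrap n r x y + c x - c y"
    if "x \<in> Cnr n r" "y \<in> Cnr n r" "simeq n r x y" for x y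
  proof -
    consider "x = y" | "glued n r x y" | "glued n r y x" using \<open>simeq n r x y\<close> by (auto simp: simeq_def)
    then show ?thesis
    proof cases
      case 1
      then show ?thesis by (simp add: wrap_self[OF n(1)])
    next
      case 2
      then show ?thesis using ec(3) \<open>x \<in> Cnr n r\<close> \<open>y \<in> Cnr n r\<close> by blast
    next
      case 3
      then have "wrap n r (h y) (h x) = e * wrap n r y x + c y - c x"
        using ec(3) \<open>x \<in> Cnr n r\<close> \<open>y \<in> Cnr n r\<close> by blast
      then show ?thesis
        using wrap_swap[OF n(1), of r "h x" "h y"] wrap_swap[OF n(1), of r x y] by simp
    qed
  qed
  with ec that show ?thesis by blast
qed

text \<open>
  \<open>sh X\<close> is the sheet of \<open>X\<close> in an \<open>m\<close>-fold cover of the circle of length \<open>r\<close> by that of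
  length \<open>s\<close>.
\<close>

locale cover =
  fixes n r s m :: nat and pr :: "(nat \<Rightarrow> letter) \<Rightarrow> (nat \<Rightarrow> letter)" and sh :: "(nat \<Rightarrow> letter) \<Rightarrow> nat"
    and lift :: "nat \<Rightarrow> (nat \<Rightarrow> letter) \<Rightarrow> (nat \<Rightarrow> letter)"
  assumes n2: "n \<ge> 2" and r1: "r \<ge> 1" and s1: "s \<ge> 1"
    and pr_in: "X \<in> Cnr n s \<Longrightarrow> pr X \<in> Cnr n r"
    and sh_less: "X \<in> Cnr n s \<Longrightarrow> sh X < m"
    and lift_in: "j < m \<Longrightarrow> x \<in> Cnr n r \<Longrightarrow> lift j x \<in> Cnr n s"
    and lift_pr: "X \<in> Cnr n s \<Longrightarrow> lift (sh X) (pr X) = X"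
    and pr_lift: "j < m \<Longrightarrow> x \<in> Cnr n r \<Longrightarrow> pr (lift j x) = x"
    and sh_lift: "j < m \<Longrightarrow> x \<in> Cnr n r \<Longrightarrow> sh (lift j x) = j"
    and pr_local: "X \<in> Cnr n s \<Longrightarrow> \<exists>k>0. \<exists>w\<in>Xnr_plus n r. \<forall>z\<in>Cn n.
      pr (pre k X \<frown> z) = w \<frown> z \<and> sh (pre k X \<frown> z) = sh X"
    and lift_local: "j < m \<Longrightarrow> x \<in> Cnr n r \<Longrightarrow> \<exists>k>0. \<exists>V\<in>Xnr_plus n s. \<forall>z\<in>Cn n.
      lift j (pre k x \<frown> z) = V \<frown> z"
    and simeq_cover: "X \<in> Cnr n s \<Longrightarrow> Y \<in> Cnr n s \<Longrightarrow> simeq n s X Y \<longleftrightarrow>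
      simeq n r (pr X) (pr Y) \<and> int m dvd int (sh X) - int (sh Y) - wrap n r (pr X) (pr Y)"
begin

text \<open>The sign makes the sheets run backwards if \<open>h\<close> reverses orientation, and
  \<open>c\<close> corrects for the base point having been moved.\<close>

definition lift_map :: "((nat \<Rightarrow> letter) \<Rightarrow> (nat \<Rightarrow> letter)) \<Rightarrow> int \<Rightarrow> ((nat \<Rightarrow> letter) \<Rightarrow> int) \<Rightarrow>
    (nat \<Rightarrow> letter) \<Rightarrow> (nat \<Rightarrow> letter)"
  where "lift_map h e c X = lift (nat ((e * int (sh X) + c (pr X)) mod int m)) (h (pr X))"

lemma sheet_less: "X \<in> Cnr n s \<Longrightarrow> nat (a mod int m) < m"
proof -
  assume "X \<in> Cnr n s"
  then have "0 < m" using sh_less by fastforce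
  then show ?thesis by (simp add: nat_less_iff)
qed

lemma
  assumes "X \<in> Cnr n s" "h (pr X) \<in> Cnr n r"
  shows pr_lift_map: "pr (lift_map h e c X) = h (pr X)"
    and sh_lift_map: "int (sh (lift_map h e c X)) = (e * int (sh X) + c (pr X)) mod int m"
proof -
  have "0 < m" using sh_less[OF assms(1)] by simp
  then show "pr (lift_map h e c X) = h (pr X)"
    and "int (sh (lift_map h e c X)) = (e * int (sh X) + c (pr X)) mod int m"
    using sheet_less[OF assms(1)] assms(2) by (simp_all add: lift_map_def pr_lift sh_lift)
qed

text \<open>On a small cylinder the sheet and \<open>c\<close> are constant, so one fixed branch
  \<open>lift j\<close> is used, and \<open>pr\<close> and this branch merely exchange
  prefixes.\<close>

lemma loc_modelled_lift_map:
  assumes h: "\<And>x. x \<in> Cnr n r \<Longrightarrow> h x \<in> Cnr n r" "word_cont n r h" and c: "loc_const n r c"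
  shows "loc_modelled n s r (lift_map h e c) h"
  unfolding loc_modelled_def
proof
  fix X assume X: "X \<in> Cnr n s"
  obtain k w where k: "k > 0" "w \<in> Xnr_plus n r"
    "\<And>z. z \<in> Cn n \<Longrightarrow> pr (pre k X \<frown> z) = w \<frown> z \<and> sh (pre k X \<frown> z) = sh X"
    using pr_local[OF X] by blast
  define z0 where "z0 = suf k X"
  have z0: "pre k X \<in> Xnr_plus n s" "z0 \<in> Cn n" using Cnr_prefix[OF X k(1)] by (auto simp: z0_def)
  define x0 where "x0 = w \<frown> z0"
  have x0: "x0 \<in> Cnr n r" using k z0 by (simp add: x0_def Cnr_concI)
  define j where "j = nat ((e * int (sh X) + c x0) mod int m)"
  have j: "j < m" using sheet_less[OF X] by (simp add: j_def)
  obtain l V where l: "l > 0" "V \<in> Xnr_plus n s"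
    "\<And>t. t \<in> Cn n \<Longrightarrow> lift j (pre l (h x0) \<frown> t) = V \<frown> t"
    using lift_local[OF j h(1)[OF x0]] by blast
  define v where "v = pre l (h x0)"
  have v: "v \<in> Xnr_plus n r" using Cnr_prefix[OF h(1)[OF x0] l(1)] by (simp add: v_def)
  obtain k1 where k1: "\<And>y. y \<in> Cnr n r \<Longrightarrow> pre k1 y = pre k1 x0 \<Longrightarrow> pre l (h y) = v"
    using h(2) x0 unfolding word_cont_def v_def by blast
  obtain k2 where k2: "\<And>y. y \<in> Cnr n r \<Longrightarrow> pre k2 y = pre k2 x0 \<Longrightarrow> c y = c x0"
    using c x0 unfolding loc_const_def by blast
  \<comment> \<open>Depth \<open>k1\<close> fixes the \<open>l\<close> letters of the value that
    \<open>lift j\<close> exchanges; depth \<open>k2\<close> fixes \<open>c\<close> and with it the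
    target sheet.\<close>
  define K where "K = max k1 k2"
  define u where "u = pre K z0"
  have u: "u \<in> lists (Xn n)" using Cn_prefix[OF z0(2)] by (simp add: u_def)
  have W: "pre (k + K) X = pre k X @ u"
    unfolding u_def z0_def by (simp add: subsequence_append)
  have main: "\<exists>t\<in>Cn n. lift_map h e c ((pre k X @ u) \<frown> x) = V \<frown> t \<and> h ((w @ u) \<frown> x) = v \<frown> t"
    if x: "x \<in> Cn n" for x
  proof -
    let ?y = "(w @ u) \<frown> x"
    have y: "?y \<in> Cnr n r" using k(2) u x by (intro Cnr_concI Xnr_plus_append)
    have ux: "u \<frown> x \<in> Cn n" using u x by (simp add: Cn_conc)
    have "pre (length w + K) ?y = pre (length w + K) x0"
      by (simp add: x0_def u_def flip: conc_conc)
    then have "pre k1 ?y = pre k1 x0" "pre k2 ?y = pre k2 x0"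
      by (auto elim!: prefix_mono_eq simp: K_def)
    then have hy: "pre l (h ?y) = v" "c ?y = c x0" using k1 k2 y by blast+
    define t where "t = suf l (h ?y)"
    have t: "t \<in> Cn n" using Cnr_prefix[OF h(1)[OF y] l(1)] by (simp add: t_def)
    have ht: "h ?y = v \<frown> t" using prefix_suffix[of "h ?y" l] hy by (simp add: t_def)
    have "pr ((pre k X @ u) \<frown> x) = ?y" "sh ((pre k X @ u) \<frown> x) = sh X"
      using k(3)[OF ux] by simp_all
    then have "lift_map h e c ((pre k X @ u) \<frown> x) = lift j (h ?y)"
      using hy(2) by (simp add: lift_map_def j_def)
    also have "\<dots> = V \<frown> t" using l(3)[OF t] ht by (simp add: v_def)
    finally show ?thesis using t ht by blast
  qed
  have "modelled n s r (lift_map h e c) h (pre (k + K) X)"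
    unfolding modelled_def W using main l(2) v Xnr_plus_append[OF k(2) u] Xnr_plus_append[OF z0(1) u]
    by blast
  then show "\<exists>k. modelled n s r (lift_map h e c) h (pre k X)" ..
qed

text \<open>On sheets this inverts a -> e a + c by a -> e a - e c, which works modulo
  \<open>m\<close> because \<open>e * e = 1\<close>.\<close>

lemma lift_map_inverse:
  assumes X: "X \<in> Cnr n s" and h: "h (pr X) \<in> Cnr n r" and g: "g (h (pr X)) = pr X"
    and c: "d (h (pr X)) = - e * c (pr X)" and e: "e * e = 1"
  shows "lift_map g e d (lift_map h e c X) = X"
proof -
  let ?a = "e * int (sh X) + c (pr X)"
  have "(e * (?a mod int m) + - e * c (pr X)) mod int m = (e * ?a + - e * c (pr X)) mod int m"
    by (intro mod_add_cong) (simp_all add: mod_mult_right_eq)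
  also have "e * ?a + - e * c (pr X) = int (sh X)"
    using e by (simp add: algebra_simps flip: mult.assoc)
  also have "int (sh X) mod int m = int (sh X)"
    using sh_less[OF X] by simp
  finally show ?thesis
    unfolding lift_map_def[of g] pr_lift_map[OF X, of h, OF h] sh_lift_map[OF X, of h, OF h] g c
    using lift_pr[OF X] by simp
qed

text \<open>By the identity for \<open>wrap\<close> the terms with \<open>c\<close> cancel, and the
  sheet condition for the images is \<open>e\<close> times the one for \<open>X\<close> and
  \<open>Y\<close>; a sign does not affect divisibility.\<close>

lemma simeq_lift_map:
  assumes h: "\<And>x. x \<in> Cnr n r \<Longrightarrow> h x \<in> Cnr n r"
    and simeq: "\<And>x y. x \<in> Cnr n r \<Longrightarrow> y \<in> Cnr n r \<Longrightarrow> simeq n r (h x) (h y) \<longleftrightarrow> simeq n r x y"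
    and e: "e = 1 \<or> e = - 1"
    and wrap: "\<And>x y. x \<in> Cnr n r \<Longrightarrow> y \<in> Cnr n r \<Longrightarrow> simeq n r x y \<Longrightarrow>
       wrap n r (h x) (h y) = e * wrap n r x y + c x - c y"
    and XY: "X \<in> Cnr n s" "Y \<in> Cnr n s"
  shows "simeq n s (lift_map h e c X) (lift_map h e c Y) \<longleftrightarrow> simeq n s X Y"
proof -
  let ?x = "pr X" and ?y = "pr Y"
  note xy = pr_in[OF XY(1)] pr_in[OF XY(2)]
  have in_s: "lift_map h e c Z \<in> Cnr n s" if "Z \<in> Cnr n s" for Z
    unfolding lift_map_def using that by (intro lift_in sheet_less h pr_in)
  have "int m dvd (e * int (sh X) + c ?x) mod int m - (e * int (sh Y) + c ?y) mod int m
        - wrap n r (h ?x) (h ?y) \<longleftrightarrow> int m dvd int (sh X) - int (sh Y) - wrap n r ?x ?y"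
    if s: "simeq n r ?x ?y"
  proof -
    let ?a = "e * int (sh X) + c ?x" and ?b = "e * int (sh Y) + c ?y"
    have "(?a mod int m - ?b mod int m - wrap n r (h ?x) (h ?y)) mod int m
        = (?a - ?b - wrap n r (h ?x) (h ?y)) mod int m"
      by (intro mod_diff_cong) simp_all
    also have "?a - ?b - wrap n r (h ?x) (h ?y) = e * (int (sh X) - int (sh Y) - wrap n r ?x ?y)"
      by (simp add: wrap[OF xy s] algebra_simps)
    finally have "int m dvd ?a mod int m - ?b mod int m - wrap n r (h ?x) (h ?y) \<longleftrightarrow>
        int m dvd e * (int (sh X) - int (sh Y) - wrap n r ?x ?y)"
      by (simp only: dvd_eq_mod_eq_0)
    moreover have "int m dvd e * z \<longleftrightarrow> int m dvd z" for z using e by auto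
    ultimately show ?thesis by simp
  qed
  then show ?thesis
    using simeq_cover[OF in_s[OF XY(1)] in_s[OF XY(2)]] simeq_cover[OF XY] simeq[OF xy]
    by (auto simp: pr_lift_map sh_lift_map XY h xy)
qed

theorem TO_nr_subset: "TO_nr n r \<subseteq> TO_nr n s"
proof
  fix T assume "T \<in> TO_nr n r"
  then obtain h where T: "T = Core n r h" and h: "h \<in> TB_nr n r"
    by (auto simp: TO_nr_def)
  then obtain g where hg: "homeomorphic_maps (Cnr_top n r) (Cnr_top n r) h g" "fin_sync n r h" "fin_sync n r g"
    and simeq: "\<And>x y. x \<in> Cnr n r \<Longrightarrow> y \<in> Cnr n r \<Longrightarrow> simeq n r (h x) (h y) \<longleftrightarrow> simeq n r x y"
    by (auto simp: TB_nr_def B_nr_def)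
  have maps: "\<And>x. x \<in> Cnr n r \<Longrightarrow> h x \<in> Cnr n r" "\<And>x. x \<in> Cnr n r \<Longrightarrow> g x \<in> Cnr n r"
    and cont: "word_cont n r h" "word_cont n r g"
    and inv: "\<And>x. x \<in> Cnr n r \<Longrightarrow> g (h x) = x" "\<And>x. x \<in> Cnr n r \<Longrightarrow> h (g x) = x"
    using hg(1) by (auto simp: homeomorphic_maps_def continuous_map_Cnr)
  obtain e :: int and c where e: "e = 1 \<or> e = - 1" and c: "loc_const n r c" and wrap:
    "\<And>x y. x \<in> Cnr n r \<Longrightarrow> y \<in> Cnr n r \<Longrightarrow> simeq n r x y \<Longrightarrow>
       wrap n r (h x) (h y) = e * wrap n r x y + c x - c y"
    using exists_wrap_lift[OF n2 r1 maps inv simeq] by blast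
  \<comment> \<open>The correction for the inverse map, as dictated by
    \<open>lift_map_inverse\<close>; continuity of \<open>g\<close> makes it locally
    constant.\<close>
  define d where "d y = - e * c (g y)" for y
  have ee: "e * e = 1" using e by auto
  have d: "loc_const n r d"
    unfolding loc_const_def
  proof
    fix x assume x: "x \<in> Cnr n r"
    obtain k where k: "\<And>y. y \<in> Cnr n r \<Longrightarrow> pre k y = pre k (g x) \<Longrightarrow> c y = c (g x)"
      using c maps(2)[OF x] unfolding loc_const_def by blast
    obtain l where "\<And>y. y \<in> Cnr n r \<Longrightarrow> pre l y = pre l x \<Longrightarrow> pre k (g y) = pre k (g x)"
      using cont(2) x unfolding word_cont_def by blast
    then show "\<exists>k. \<forall>y\<in>Cnr n r. pre k y = pre k x \<longrightarrow> d y = d x"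
      unfolding d_def using k maps(2) by metis
  qed
  define H where "H = lift_map h e c"
  define E where "E = lift_map g e d"
  have EH: "E (H X) = X" if "X \<in> Cnr n s" for X
    unfolding E_def H_def using that pr_in maps inv ee
    by (intro lift_map_inverse) (auto simp: d_def)
  have HE: "H (E X) = X" if "X \<in> Cnr n s" for X
    unfolding E_def H_def
  proof (rule lift_map_inverse[OF that])
    show "c (g (pr X)) = - e * d (pr X)"
      using ee by (simp add: d_def flip: mult.assoc)
  qed (use that pr_in maps inv ee in auto)
  have model: "loc_modelled n s r H h" "loc_modelled n s r E g"
    unfolding H_def E_def using maps cont c d by (auto intro: loc_modelled_lift_map)
  have "H \<in> B_nr n s" "Core n r h = Core n s H"
    using B_nr_modelled[OF n2 r1 s1 hg model EH HE] by auto
  moreover have "simeq n s (H X) (H Y) \<longleftrightarrow> simeq n s X Y" if "X \<in> Cnr n s" "Y \<in> Cnr n s" for X Y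
    unfolding H_def using simeq_lift_map[OF maps(1) simeq e wrap that] .
  ultimately have "H \<in> TB_nr n s" by (auto simp: TB_nr_def)
  then show "T \<in> TO_nr n s"
    unfolding TO_nr_def T using \<open>Core n r h = Core n s H\<close> by blast
qed

end


section \<open>Multiplying \<open>r\<close>\<close>

text \<open>Going upwards, the sheet changes only from dotted letter \<open>r - 1\<close> to dotted
  letter 0. For consecutive sheets this is an adjacency upstairs; from the last sheet to sheet 0 it
  is the passage through the base point. The divisibility condition covers both.\<close>

lemma glued_mult:
  assumes "n \<ge> 2" and a: "a < r" "a' < r" and j: "j < m" "j' < m"
    and x: "x 0 = Dotted a" "y 0 = Dotted a'"
    and X: "X = x(0 := Dotted (j * r + a))" "Y = y(0 := Dotted (j' * r + a'))"
  shows "adj n Y X \<or> X = min_pt \<and> Y = max_pt n (m * r) \<longleftrightarrow>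
    adj n y x \<and> j = j' \<or> x = min_pt \<and> y = max_pt n r \<and> int m dvd int j - int j' - 1"
proof -
  have dvd: "int m dvd int j - int j' - 1 \<longleftrightarrow> j = Suc j' \<or> j = 0 \<and> Suc j' = m"
  proof
    assume "int m dvd int j - int j' - 1"
    then obtain q where q: "int j - int j' - 1 = int m * q" ..
    \<comment> \<open>Since \<open>j\<close> and \<open>j'\<close> are below \<open>m\<close>, the
      difference lies between \<open>- m\<close> and \<open>m - 2\<close>, which leaves only the
      quotients 0 and -1.\<close>
    have "- 2 < q \<and> q < 1"
    proof
      show "- 2 < q"
      proof (rule ccontr)
        assume "\<not> - 2 < q"
        then have "int m * q \<le> int m * (- 2)" by (intro mult_left_mono) auto
        then show False using q j by linarith
      qed
      show "q < 1"
      proof (rule ccontr)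
        assume "\<not> q < 1"
        then have "int m * 1 \<le> int m * q" by (intro mult_left_mono) auto
        then show False using q j by linarith
      qed
    qed
    then have "q = 0 \<or> q = - 1" by linarith
    then show "j = Suc j' \<or> j = 0 \<and> Suc j' = m" using q j by auto
  next
    assume "j = Suc j' \<or> j = 0 \<and> Suc j' = m"
    then show "int m dvd int j - int j' - 1"
    proof
      assume "j = 0 \<and> Suc j' = m"
      then have "int j - int j' - 1 = int m * (- 1)" by auto
      then show ?thesis by (rule dvdI)
    qed simp
  qed
  have r: "0 < r" and m: "0 < m" using a j by auto
  have eq_iff: "p * r + c = q * r + d \<longleftrightarrow> p = q \<and> c = d" if "c < r" "d < r" for p q c d
  proof
    assume eq: "p * r + c = q * r + d"
    have "(p * r + c) div r = p" "(q * r + d) div r = q" using that by simp_all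
    with eq show "p = q \<and> c = d" by simp
  qed simp
  have suc_iff: "j * r + a = Suc (j' * r + a') \<longleftrightarrow> j = j' \<and> a = Suc a' \<or> j = Suc j' \<and> a = 0 \<and> a' = r - 1"
  proof (cases "Suc a' < r")
    case True
    then show ?thesis using eq_iff[OF a(1), of "Suc a'" j j'] by auto
  next
    case False
    then have a': "a' = r - 1" using a by simp
    then have "Suc (j' * r + a') = Suc j' * r + 0" using r by simp
    then show ?thesis using eq_iff[OF a(1), of 0 j "Suc j'"] r a a' by auto
  qed
  have max_iff: "j' * r + a' = m * r - 1 \<longleftrightarrow> Suc j' = m \<and> a' = r - 1"
  proof -
    have "m * r - 1 = (m - 1) * r + (r - 1)" using m r by (cases m; cases r) auto
    then show ?thesis using eq_iff[OF a(2), of "r - 1" j' "m - 1"] r m by auto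
  qed
  have min_iff: "j * r + a = 0 \<longleftrightarrow> j = 0 \<and> a = 0" using r by simp
  have mm: "x = min_pt \<longleftrightarrow> a = 0 \<and> (\<forall>i>0. x i = Plain 0)"
    "X = min_pt \<longleftrightarrow> j = 0 \<and> a = 0 \<and> (\<forall>i>0. x i = Plain 0)"
    "y = max_pt n r \<longleftrightarrow> a' = r - 1 \<and> (\<forall>i>0. y i = Plain (n - 1))"
    "Y = max_pt n (m * r) \<longleftrightarrow> Suc j' = m \<and> a' = r - 1 \<and> (\<forall>i>0. y i = Plain (n - 1))"
    unfolding eq_min_pt eq_max_pt X using x min_iff max_iff by auto
  show ?thesis
  proof (cases "j = j' \<and> a = a'")
    case True
    then have "adj n Y X \<longleftrightarrow> adj n y x"
      unfolding X using adj_tail[of x y n] adj_tail[of "x(0 := Dotted (j * r + a))" "y(0 := Dotted (j' * r + a'))" n] x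
      by (simp add: Omega_Words_Fun.suffix_def)
    then show ?thesis
      unfolding dvd mm using True j by auto
  next
    case False
    then have "adj n Y X \<longleftrightarrow> j * r + a = Suc (j' * r + a') \<and> (\<forall>i>0. x i = Plain 0 \<and> y i = Plain (n - 1))"
      unfolding X using adj_head[of "x(0 := Dotted (j * r + a))" "y(0 := Dotted (j' * r + a'))" n]
        eq_iff[OF a, of j j'] assms(1) by auto
    moreover have "j = j' \<Longrightarrow> adj n y x \<longleftrightarrow> a = Suc a' \<and> (\<forall>i>0. x i = Plain 0 \<and> y i = Plain (n - 1))"
      using adj_head[of x y n] x False assms(1) by auto
    ultimately show ?thesis
      unfolding dvd mm suc_iff by auto
  qed
qed

text \<open>Division of the dotted letter by \<open>r\<close> with remainder: the quotient is the
  sheet and the remainder is the dotted letter downstairs.\<close>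

lemma cover_mult:
  assumes n: "n \<ge> 2" and r: "r \<ge> 1" and m: "m \<ge> 1"
  shows "cover n r (m * r) m (\<lambda>X. X(0 := Dotted (lval (X 0) mod r))) (\<lambda>X. lval (X 0) div r)
    (\<lambda>j x. x(0 := Dotted (j * r + lval (x 0))))"
    (is "cover n r ?s m ?pr ?sh ?lift")
proof
  show "n \<ge> 2" "r \<ge> 1" "?s \<ge> 1" using assms by auto
  show pr: "?pr X \<in> Cnr n r" if "X \<in> Cnr n ?s" for X
    using that r by (auto simp: Cnr_nth)
  show sh: "?sh X < m" if "X \<in> Cnr n ?s" for X
    using that by (auto simp: Cnr_nth less_mult_imp_div_less)
  have bound: "j * r + a < m * r" if "j < m" "a < r" for j a
  proof -
    have "j * r + a < Suc j * r" using that by simp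
    also have "\<dots> \<le> m * r" using that by (intro mult_right_mono) auto
    finally show ?thesis .
  qed
  show "?lift j x \<in> Cnr n ?s" if "j < m" "x \<in> Cnr n r" for j x
    using that bound by (auto simp: Cnr_nth)
  show lift_pr: "?lift (?sh X) (?pr X) = X" if "X \<in> Cnr n ?s" for X
    using that by (auto simp: Cnr_nth)
  show "?pr (?lift j x) = x" if "j < m" "x \<in> Cnr n r" for j x
    using that by (auto simp: Cnr_nth)
  show "?sh (?lift j x) = j" if "j < m" "x \<in> Cnr n r" for j x
    using that by (auto simp: Cnr_nth)
  show "\<exists>k>0. \<exists>w\<in>Xnr_plus n r. \<forall>z\<in>Cn n. ?pr (pre k X \<frown> z) = w \<frown> z \<and> ?sh (pre k X \<frown> z) = ?sh X"
    if "X \<in> Cnr n ?s" for X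
    using r by (intro exI[of _ 1] bexI[of _ "[Dotted (lval (X 0) mod r)]"] conjI ballI)
      (auto simp: conc_def Xnr_plus_iff dotted_def)
  show "\<exists>k>0. \<exists>V\<in>Xnr_plus n ?s. \<forall>z\<in>Cn n. ?lift j (pre k x \<frown> z) = V \<frown> z"
    if "j < m" "x \<in> Cnr n r" for j x
    using bound[of j "lval (x 0)"] that
    by (intro exI[of _ 1] bexI[of _ "[Dotted (j * r + lval (x 0))]"] conjI ballI)
      (auto simp: conc_def Xnr_plus_iff dotted_def Cnr_nth)
  show "simeq n ?s X Y \<longleftrightarrow>
      simeq n r (?pr X) (?pr Y) \<and> int m dvd int (?sh X) - int (?sh Y) - wrap n r (?pr X) (?pr Y)"
    if X: "X \<in> Cnr n ?s" and Y: "Y \<in> Cnr n ?s" for X Y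
  proof -
    define x y where "x = ?pr X" and "y = ?pr Y"
    define j l where "j = ?sh X" and "l = ?sh Y"
    have jl: "j < m" "l < m" using sh[OF X] sh[OF Y] by (simp_all add: j_def l_def)
    have xy: "x \<in> Cnr n r" "y \<in> Cnr n r" using pr[OF X] pr[OF Y] by (simp_all only: x_def y_def)
    obtain a b where ab: "a < r" "x 0 = Dotted a" "b < r" "y 0 = Dotted b"
      using xy by (auto simp: Cnr_nth)
    have XY: "X = x(0 := Dotted (j * r + a))" "Y = y(0 := Dotted (l * r + b))"
      using lift_pr[OF X] lift_pr[OF Y] ab unfolding x_def y_def j_def l_def by (metis lval.simps(1))+
    have g1: "adj n Y X \<or> X = min_pt \<and> Y = max_pt n ?s \<longleftrightarrow>
      adj n y x \<and> j = l \<or> x = min_pt \<and> y = max_pt n r \<and> int m dvd int j - int l - 1"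
      by (rule glued_mult[OF n ab(1,3) jl ab(2,4) XY])
    have g2: "adj n X Y \<or> Y = min_pt \<and> X = max_pt n ?s \<longleftrightarrow>
      adj n x y \<and> l = j \<or> y = min_pt \<and> x = max_pt n r \<and> int m dvd int l - int j - 1"
      by (rule glued_mult[OF n ab(3,1) jl(2,1) ab(4,2) XY(2,1)])
    have eq: "X = Y \<longleftrightarrow> x = y \<and> j = l"
    proof
      assume "x = y \<and> j = l"
      then show "X = Y" using XY ab by simp
    qed (simp add: x_def y_def j_def l_def)
    have small: "int m dvd int j - int l \<longleftrightarrow> j = l"
      using jl by (metis mod_eq_dvd_iff zmod_int mod_less of_nat_eq_iff)
    have s1: "?s \<ge> 1" using r m by simp
    have swap: "int m dvd int l - int j - 1 \<longleftrightarrow> int m dvd int j - int l + 1"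
      by (metis dvd_minus_iff minus_diff_eq diff_diff_eq2 add.commute diff_diff_eq add_diff_eq)
    have "simeq n ?s X Y \<longleftrightarrow> simeq n r x y \<and> int m dvd int j - int l - wrap n r x y"
    \<comment> \<open>Only for this pair of points is \<open>wrap\<close> nonzero; otherwise the
      divisibility just says that the sheets are equal.\<close>
    proof (cases "x = min_pt \<and> y = max_pt n r \<or> x = max_pt n r \<and> y = min_pt")
      case True
      then have "x \<noteq> y" "simeq n r x y"
        using min_pt_neq_max_pt[OF n, of r] simeq_iff[OF n r xy] by auto
      have no: "\<not> adj n y x" "\<not> adj n x y" 
        using True adj_min_pt not_adj_min_pt[OF n] by auto
      from True show ?thesis
        unfolding simeq_iff[OF n s1 X Y] g1 g2 eq
        using no \<open>simeq n r x y\<close> \<open>x \<noteq> y\<close> min_pt_neq_max_pt[OF n, of r] swap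
        by (auto simp: wrap_def)
    next
      case False
      then have "wrap n r x y = 0" by (auto simp: wrap_def)
      then show ?thesis
        unfolding simeq_iff[OF n s1 X Y] g1 g2 eq simeq_iff[OF n r xy]
        using False small by auto
    qed
    then show ?thesis by (simp only: x_def y_def j_def l_def)
  qed
qed

lemma TO_nr_mult: "n \<ge> 2 \<Longrightarrow> r \<ge> 1 \<Longrightarrow> m \<ge> 1 \<Longrightarrow> TO_nr n r \<subseteq> TO_nr n (m * r)"
  using cover.TO_nr_subset[OF cover_mult] .


section \<open>Splitting a dotted letter\<close>

text \<open>The dotted letters from \<open>r - 1\<close> to \<open>r + n - 2\<close> become the
  \<open>n\<close> two-letter words starting with \<open>r - 1\<close>, in the same order.\<close>

definition split_last :: "nat \<Rightarrow> (nat \<Rightarrow> letter) \<Rightarrow> (nat \<Rightarrow> letter)"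
  where "split_last r X = (if lval (X 0) < r - 1 then X
    else [Dotted (r - 1), Plain (lval (X 0) - (r - 1))] \<frown> suf 1 X)"

definition join_last :: "nat \<Rightarrow> (nat \<Rightarrow> letter) \<Rightarrow> (nat \<Rightarrow> letter)"
  where "join_last r x = (if lval (x 0) < r - 1 then x
    else [Dotted (r - 1 + lval (x 1))] \<frown> suf 2 x)"

lemma conc_two: "([a, b] \<frown> x) i = (if i = 0 then a else if i = 1 then b else x (i - 2))"
  by (simp add: conc_def nth_Cons' numeral_2_eq_2)

lemma conc_one: "([a] \<frown> x) i = (if i = 0 then a else x (i - 1))"
  by (simp add: conc_def)

context
  fixes n r :: nat
  assumes n: "n \<ge> 2" and r: "r \<ge> 1"
begin

lemma split_last_in:
  assumes "X \<in> Cnr n (r + (n - 1))" shows "split_last r X \<in> Cnr n r"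
proof -
  obtain a where a: "X 0 = Dotted a" "a < r + (n - 1)" and t: "\<forall>k>0. \<exists>i<n. X k = Plain i"
    using assms by (auto simp: Cnr_nth)
  show ?thesis
  proof (cases "a < r - 1")
    case False
    have "\<exists>i<n. ([Dotted (r - 1), Plain (a - (r - 1))] \<frown> suf 1 X) k = Plain i" if "k > 0" for k
      using that t a False by (auto simp: conc_two)
    then show ?thesis using a False r by (auto simp: split_last_def Cnr_nth conc_two)
  qed (use assms a in \<open>auto simp: split_last_def Cnr_nth\<close>)
qed

lemma join_last_in:
  assumes "x \<in> Cnr n r" shows "join_last r x \<in> Cnr n (r + (n - 1))"
proof -
  obtain a where a: "x 0 = Dotted a" "a < r" and t: "\<forall>k>0. \<exists>i<n. x k = Plain i"
    using assms by (auto simp: Cnr_nth)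
  obtain i where i: "x 1 = Plain i" "i < n" using t by auto
  show ?thesis
  proof (cases "a < r - 1")
    case False
    have "\<exists>i<n. ([Dotted (r - 1 + lval (x 1))] \<frown> suf 2 x) k = Plain i" if "k > 0" for k
      using that t by (auto simp: conc_one)
    then show ?thesis using a i False r by (auto simp: join_last_def Cnr_nth conc_one)
  qed (use a t in \<open>auto simp: join_last_def Cnr_nth\<close>)
qed

lemma join_split:
  assumes "X \<in> Cnr n (r + (n - 1))" shows "join_last r (split_last r X) = X"
proof (cases "lval (X 0) < r - 1")
  case False
  obtain a where "X 0 = Dotted a" using assms by (auto simp: Cnr_nth)
  then show ?thesis
    using False by (auto simp: split_last_def join_last_def conc_two conc_one fun_eq_iff)
qed (simp add: split_last_def join_last_def)

lemma split_join:
  assumes "x \<in> Cnr n r" shows "split_last r (join_last r x) = x"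
proof (cases "lval (x 0) < r - 1")
  case False
  obtain a i where ai: "x 0 = Dotted a" "a < r" "x 1 = Plain i"
    using assms unfolding Cnr_nth by (metis zero_less_one)
  then have "a = r - 1" using False by simp
  then show ?thesis
    using False ai by (auto simp: split_last_def join_last_def conc_two conc_one fun_eq_iff numeral_2_eq_2
        intro!: arg_cong[where f = x])
qed (simp add: split_last_def join_last_def)

lemma split_last_local:
  assumes "X \<in> Cnr n (r + (n - 1))"
  shows "\<exists>k>0. \<exists>w\<in>Xnr_plus n r. \<forall>z\<in>Cn n. split_last r (pre k X \<frown> z) = w \<frown> z"
proof -
  obtain a where a: "X 0 = Dotted a" "a < r + (n - 1)" using assms by (auto simp: Cnr_nth)
  let ?w = "if a < r - 1 then [Dotted a] else [Dotted (r - 1), Plain (a - (r - 1))]"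
  have "a - (r - 1) < n" using a n r by linarith
  then have "Plain (a - (r - 1)) \<in> Xn n" unfolding Xn_def by blast
  then have w: "?w \<in> Xnr_plus n r"
    using r by (simp add: Xnr_plus_iff dotted_def)
  have "split_last r (pre 1 X \<frown> z) = ?w \<frown> z" for z
  proof -
    have p: "pre 1 X = [Dotted a]" using a by simp
    have "suf 1 ([Dotted a] \<frown> z) = z" using suffix_conc_length[of "[Dotted a]" z] by simp
    then show ?thesis
      unfolding p split_last_def by simp
  qed
  with w show ?thesis by (intro exI[of _ 1]) auto
qed

lemma join_last_local:
  assumes "x \<in> Cnr n r"
  shows "\<exists>k>0. \<exists>V\<in>Xnr_plus n (r + (n - 1)). \<forall>z\<in>Cn n. join_last r (pre k x \<frown> z) = V \<frown> z"
proof -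
  obtain a i where a: "x 0 = Dotted a" "a < r" "x 1 = Plain i" "i < n"
    using assms unfolding Cnr_nth by (metis zero_less_one)
  let ?w = "if a < r - 1 then [Dotted a, Plain i] else [Dotted (r - 1 + i)]"
  have w: "?w \<in> Xnr_plus n (r + (n - 1))"
    using a r n by (auto simp: Xnr_plus_iff dotted_def Xn_def)
  have "join_last r (pre 2 x \<frown> z) = ?w \<frown> z" for z
  proof -
    have p: "pre 2 x = [Dotted a, Plain i]" using a by (simp add: numeral_2_eq_2)
    have "suf 2 ([Dotted a, Plain i] \<frown> z) = z"
      using suffix_conc_length[of "[Dotted a, Plain i]" z] by simp
    then show ?thesis
      unfolding p join_last_def using a by (auto simp: conc_two)
  qed
  with w show ?thesis by (intro exI[of _ 2]) auto
qed

text \<open>The splitting preserves the order, so adjacency should survive. Only a change of the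
  dotted letter needs care, because it may turn into a change at the second position or straddle the
  first split letter.\<close>

lemma adj_split_last:
  assumes X: "X \<in> Cnr n (r + (n - 1))" and Y: "Y \<in> Cnr n (r + (n - 1))"
  shows "adj n (split_last r Y) (split_last r X) \<longleftrightarrow> adj n Y X"
proof -
  obtain a where a: "X 0 = Dotted a" using X by (auto simp: Cnr_nth)
  obtain b where b: "Y 0 = Dotted b" using Y by (auto simp: Cnr_nth)
  let ?x = "[Plain (a - (r - 1))] \<frown> suf 1 X" and ?y = "[Plain (b - (r - 1))] \<frown> suf 1 Y"
  have sX: "split_last r X = (if a < r - 1 then X else [Dotted (r - 1)] \<frown> ?x)"
    and sY: "split_last r Y = (if b < r - 1 then Y else [Dotted (r - 1)] \<frown> ?y)"
    by (simp_all add: split_last_def a b)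
  have tails: "(\<forall>i>0. ?x i = Plain 0) \<longleftrightarrow> (\<forall>i>0. X i = Plain 0)"
    "(\<forall>i>0. ?y i = Plain (n - 1)) \<longleftrightarrow> (\<forall>i>0. Y i = Plain (n - 1))"
    by (auto simp: conc_one)
  show ?thesis
  proof (cases "a = b")
    case True
    then have "adj n ?y ?x \<longleftrightarrow> adj n Y X"
      using adj_tail[of X Y n] a b by (simp only: adj_conc)
    then show ?thesis
      by (cases "b < r - 1") (simp_all only: True sX sY adj_conc if_True if_False)
  next
    case False
    then have YX: "adj n Y X \<longleftrightarrow> a = Suc b \<and> (\<forall>i>0. X i = Plain 0 \<and> Y i = Plain (n - 1))"
      using adj_head[of X Y n] a b n by simp
    consider "a < r - 1" "b < r - 1" | "\<not> a < r - 1" "\<not> b < r - 1" | "\<not> a < r - 1" "b < r - 1"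
      | "a < r - 1" "\<not> b < r - 1" by blast
    then show ?thesis
    proof cases
      case 2
      then have ab: "a - (r - 1) \<noteq> b - (r - 1)" "a - (r - 1) = Suc (b - (r - 1)) \<longleftrightarrow> a = Suc b"
        using False by linarith+
      have "adj n ?y ?x \<longleftrightarrow> a = Suc b \<and> (\<forall>i>0. ?x i = Plain 0 \<and> ?y i = Plain (n - 1))"
        using adj_head[of ?x ?y n] ab n by simp
      also have "\<dots> \<longleftrightarrow> adj n Y X"
        unfolding YX using tails by blast
      finally show ?thesis
        by (simp only: sX sY adj_conc 2 if_False)
    next
      case 3
      let ?X = "[Dotted (r - 1)] \<frown> ?x"
      \<comment> \<open>At this border the new second letter must be 0, which singles out the first
        split letter. This matches \<open>a = Suc b\<close>, because
        \<open>Suc b \<le> r - 1 \<le> a\<close>.\<close>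
      have "(\<forall>i>0. ?X i = Plain 0) \<longleftrightarrow> a = r - 1 \<and> (\<forall>i>0. X i = Plain 0)"
      proof -
        have "(\<forall>i>0. ?X i = Plain 0) \<longleftrightarrow> (\<forall>i. ?x i = Plain 0)"
          by (metis One_nat_def conc_one diff_Suc_1 gr0_conv_Suc nat.distinct(1) zero_less_Suc)
        also have "\<dots> \<longleftrightarrow> ?x 0 = Plain 0 \<and> (\<forall>i>0. ?x i = Plain 0)"
          by (metis neq0_conv)
        finally show ?thesis using 3(1) by (simp add: tails)
      qed
      moreover have "adj n Y ?X \<longleftrightarrow> r - 1 = Suc b \<and> (\<forall>i>0. ?X i = Plain 0 \<and> Y i = Plain (n - 1))"
        using adj_head[of ?X Y n] b 3 n by simp
      moreover have "split_last r X = ?X" "split_last r Y = Y" using sX sY 3 by simp_all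
      ultimately show ?thesis
        using YX 3 by (metis Suc_leI antisym not_less)
    next
      case 4
      let ?Y = "[Dotted (r - 1)] \<frown> ?y"
      \<comment> \<open>Here \<open>X\<close> lies below every split letter, so it cannot be the
        successor of \<open>Y\<close>, before or after splitting.\<close>
      have "a \<noteq> Suc (r - 1)" using 4 by simp
      then have "\<not> adj n ?Y X" using adj_head[of X ?Y n] a 4 n by simp
      then show ?thesis unfolding sX sY using 4 YX by auto
    qed (simp add: sX sY)
  qed
qed

lemma simeq_split_last:
  assumes X: "X \<in> Cnr n (r + (n - 1))" and Y: "Y \<in> Cnr n (r + (n - 1))"
  shows "simeq n r (split_last r X) (split_last r Y) \<longleftrightarrow> simeq n (r + (n - 1)) X Y"
proof -
  let ?s = "r + (n - 1)"
  have s1: "?s \<ge> 1" using r by simp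
  have inj: "split_last r U = split_last r V \<longleftrightarrow> U = V" if "U \<in> Cnr n ?s" "V \<in> Cnr n ?s" for U V
    using join_split that by metis
  have "split_last r min_pt = min_pt"
    unfolding split_last_def by (auto simp: conc_two min_pt_nth fun_eq_iff)
  then have mi: "split_last r U = min_pt \<longleftrightarrow> U = min_pt" if "U \<in> Cnr n ?s" for U
    using inj[OF that min_pt_in[OF n s1]] by simp
  have "split_last r (max_pt n ?s) = max_pt n r"
  proof -
    have "\<not> ?s - 1 < r - 1" "?s - 1 - (r - 1) = n - 1" using r n by auto
    then show ?thesis
      unfolding split_last_def max_pt_nth by (auto simp: conc_two max_pt_nth fun_eq_iff)
  qed
  then have ma: "split_last r U = max_pt n r \<longleftrightarrow> U = max_pt n ?s" if "U \<in> Cnr n ?s" for U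
    using inj[OF that max_pt_in[OF n s1]] by simp
  show ?thesis
    unfolding simeq_iff[OF n s1 X Y] simeq_iff[OF n r split_last_in[OF X] split_last_in[OF Y]]
    by (simp only: adj_split_last[OF X Y] adj_split_last[OF Y X] mi[OF X] mi[OF Y] ma[OF X] ma[OF Y]
        inj[OF X Y])
qed

text \<open>A one-sheeted cover has an empty divisibility condition, so the bijection and its
  inverse are both covers and yield the two inclusions.\<close>

lemma TO_nr_split: "TO_nr n (r + (n - 1)) = TO_nr n r"
proof
  have "cover n r (r + (n - 1)) 1 (split_last r) (\<lambda>_. 0) (\<lambda>_. join_last r)"
    using n r split_last_in join_last_in join_split split_join split_last_local join_last_local
      simeq_split_last
    by unfold_locales auto
  then show "TO_nr n r \<subseteq> TO_nr n (r + (n - 1))" by (rule cover.TO_nr_subset)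
  have s: "simeq n r x y \<longleftrightarrow> simeq n (r + (n - 1)) (join_last r x) (join_last r y)"
    if "x \<in> Cnr n r" "y \<in> Cnr n r" for x y
    using simeq_split_last[OF join_last_in join_last_in] that split_join by metis
  have "cover n (r + (n - 1)) r 1 (join_last r) (\<lambda>_. 0) (\<lambda>_. split_last r)"
    using n r split_last_in join_last_in join_split split_join split_last_local join_last_local s
    by unfold_locales auto
  then show "TO_nr n (r + (n - 1)) \<subseteq> TO_nr n r" by (rule cover.TO_nr_subset)
qed

end

section \<open>Arithmetic of the second index\<close>

lemma TO_nr_add: "n \<ge> 2 \<Longrightarrow> r \<ge> 1 \<Longrightarrow> TO_nr n (r + t * (n - 1)) = TO_nr n r"
proof (induction t)
  case (Suc t)
  have "r + Suc t * (n - 1) = (r + t * (n - 1)) + (n - 1)" by simp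
  then show ?case using Suc TO_nr_split[of n "r + t * (n - 1)"] by simp
qed simp

theorem corollary1p4:
  fixes n i :: nat
  assumes "n \<ge> 2" and "1 \<le> i" and "i \<le> n - 1"
  shows "TO_nr n 1 \<subseteq> TO_nr n i \<and>
         TO_nr n i \<subseteq> TO_nr n (n - 1) \<and>
         TO_nr n i = TO_nr n (gcd (n - 1) i)"
proof (intro conjI equalityI)
  show "TO_nr n 1 \<subseteq> TO_nr n i"
    using TO_nr_mult[of n 1 i] assms by simp
  \<comment> \<open>The cover with \<open>n - 1\<close> sheets leads to the index
    \<open>(n - 1) * i\<close>, which exceeds \<open>n - 1\<close> by a multiple of
    \<open>n - 1\<close>.\<close>
  have "(n - 1) * i = (n - 1) + (i - 1) * (n - 1)"
    using assms by (cases i) (simp_all add: algebra_simps)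
  then show "TO_nr n i \<subseteq> TO_nr n (n - 1)"
    using TO_nr_mult[of n i "n - 1"] TO_nr_add[of n "n - 1" "i - 1"] assms by simp
  let ?d = "gcd (n - 1) i"
  have d: "?d \<ge> 1" using assms by (metis One_nat_def Suc_leI gcd_pos_nat not_one_le_zero)
  obtain k where k: "i = k * ?d" by (metis dvd_def gcd_dvd2 mult.commute)
  then have "k \<ge> 1" using assms(2) by (cases k) auto
  then show "TO_nr n ?d \<subseteq> TO_nr n i"
    using TO_nr_mult[of n ?d k] assms d k by simp
  \<comment> \<open>By Bezout some multiple of \<open>i\<close> is congruent to the gcd modulo
    \<open>n - 1\<close>, so the \<open>x\<close>-sheeted cover followed by removing
    \<open>y\<close> splittings leads from \<open>i\<close> to the gcd.\<close>
  obtain x y where xy: "i * x = (n - 1) * y + gcd i (n - 1)"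
    using bezout_nat[of i "n - 1"] assms by auto
  then have "x * i = ?d + y * (n - 1)" by (simp add: gcd.commute mult.commute)
  moreover have "x \<ge> 1" using xy d by (cases x) (auto simp: gcd.commute)
  ultimately show "TO_nr n i \<subseteq> TO_nr n ?d"
    using TO_nr_mult[of n i x] TO_nr_add[of n ?d y] assms d by simp
qed

end
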